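(* Let $S$ be a truncation set. Let $0\to I_\nu \to A_\nu \xrightarrow{\pi_\nu} R_\nu \to 0$ ($\nu=1,2$) be presentations of commutative (possibly non-unital) rings $R_\nu$, where the rings $A_\nu$ have no $S$-torsion, and let $\alpha : R_1\to R_2$ be a ring homomorphism. Let $E_S(\alpha) : E_S(R_1,\pi_1) \to E_S(R_2,\pi_2)$ be the map defined by $E_S(\alpha)\circ\psi_S = \psi_S\circ\alpha^S$. a) The map $E_S(\alpha)$ is a continuous homomorphism of rings which commutes with the Teichmüller maps, i.e. $E_S(\alpha)(\langle r\rangle_S) = \langle\alpha(r)\rangle_S$ for $r\in R_1$. Moreover, for $n\in S$, $E_S(\alpha)$ and $E_{S/n}(\alpha)$ commute with $F_n$ and $V_n$, i.e. $F_n\circ E_S(\alpha) = E_{S/n}(\alpha)\circ F_n$ and $V_n\circ E_{S/n}(\alpha) = E_S(\alpha)\circ V_n$. b) $E_S(\alpha)$ is the unique continuous additive map $E_S(R_1,\pi_1)\to E_S(R_2,\pi_2)$ which sends $V_n\langle r\rangle$ to $V_n\langle\alpha(r)\rangle$ for all $r\in R_1$ and $n\in S$. c) For any presentation $0\to I\to A\xrightarrow{\pi} R\to 0$ with $A$ without $S$-torsion, the map $E_S(\mathrm{id}_R)$ gives an identification (isomorphism of topological rings, compatible with $\langle\,\rangle_S$, $F_n$, $V_n$) $E_S(R,\pi)\cong E_S(R)$.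
   Context: Rings are commutative and possibly non-unital. A truncation set is a non-empty subset $S \subset \mathbb{N} = \{1,2,3,\ldots\}$ closed under taking positive divisors; for $n\in S$, $S/n=\{\nu\in\mathbb{N}\mid \nu n\in S\}$. A ring $A$ has no $S$-torsion if $nx=0$ with $n\in S$, $x\in A$ implies $x=0$. For a ring $A$ (discrete), $A^S$ carries componentwise operations and the product topology. For $n\in S$: $F_n : A^S\to A^{S/n}$, $F_n((a_\nu)_{\nu\in S}) = (a_{\nu n})_{\nu\in S/n}$, and $V_n : A^{S/n}\to A^S$, $V_n((a_\nu)_{\nu\in S/n}) = n(\delta_{n\mid\nu}a_{\nu/n})_{\nu\in S}$ ($\delta_{n\mid\nu}=1$ if $n\mid \nu$, else $0$). For $a\in A$: $\langle a\rangle_S=(a^\nu)_{\nu\in S}$ and $V_n\langle a\rangle = V_n(\langle a\rangle_{S/n})$. $X_S(A)$ is the closed additive subgroup of $A^S$ generated by all $V_n\langle a\rangle$, $n\in S$, $a\in A$; it is a closed subring, $X_S(I)$ is a closed ideal in it for every ideal $I\subset A$, and $F_n$, $V_n$ restrict to these objects. For a presentation (exact sequence) $0\to I\to A\xrightarrow{\pi}R\to 0$ with $A$ without $S$-torsion, $E_S(R,\pi) = X_S(A)/X_S(I)$ with the quotient topology and induced maps $F_n,V_n$. There is a unique bijection (a homeomorphism) $\psi_S : R^S\to E_S(R,\pi)$ such that $\psi_S((\pi(a_n))_{n\in S})$ is the class of $\sum_{n\in S}V_n\langle a_n\rangle$ for all $(a_n)\in A^S$. The Teichmüller map $\langle\,\rangle_S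 : R\to E_S(R,\pi)$ is $\langle r\rangle_S = \psi_S((r,0,0,\ldots))$ ($r$ at the index $1$); equivalently $\langle\pi(a)\rangle_S$ is the class of $\langle a\rangle_S$. For $r \in R$, $V_n\langle r\rangle := V_n(\langle r\rangle_{S/n})$. $\mathbb{Z}R$ is the semigroup algebra of $(R,\cdot)$: the free $\mathbb{Z}$-module on symbols $[r]$, $r\in R$, with $[r][s]=[rs]$. $E_S(R)$ denotes $E_S(R,\pi)$ for the standard presentation $0\to I\to\mathbb{Z}R\xrightarrow{\pi}R\to 0$, $\pi([r])=r$. *)

theory Defs
  imports "HOL-Analysis.Analysis" "HOL-Library.Poly_Mapping"
begin

section \<open>Non-unital commutative rings\<close>

text \<open>Rings are types of class \<open>comm_ring\<close>, which does not require a unit. The library's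
  \<open>of_nat\<close>, \<open>of_int\<close> and \<open>^\<close> need a unit, hence the following substitutes.\<close>

definition nat_multiple :: "nat \<Rightarrow> 'a::comm_ring \<Rightarrow> 'a" where
  "nat_multiple n x = (\<Sum>i<n. x)"

definition int_multiple :: "int \<Rightarrow> 'a::comm_ring \<Rightarrow> 'a" where
  "int_multiple k x = (if 0 \<le> k then nat_multiple (nat k) x else - nat_multiple (nat (- k)) x)"

text \<open>Only used for exponents \<open>n \<ge> 1\<close>; the value at \<open>n = 0\<close> is irrelevant.\<close>

definition pos_power :: "'a::comm_ring \<Rightarrow> nat \<Rightarrow> 'a" where
  "pos_power a n = (((*) a) ^^ (n - 1)) a"

definition rng_hom :: "('a::comm_ring \<Rightarrow> 'b::comm_ring) \<Rightarrow> bool" where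
  "rng_hom f \<longleftrightarrow> (\<forall>x y. f (x + y) = f x + f y) \<and> (\<forall>x y. f (x * y) = f x * f y)"

definition kernel :: "('a::comm_ring \<Rightarrow> 'b::comm_ring) \<Rightarrow> 'a set" where
  "kernel f = {x. f x = 0}"


section \<open>Truncation sets and the ring of sequences\<close>

definition truncation_set :: "nat set \<Rightarrow> bool" where
  "truncation_set S \<longleftrightarrow> S \<noteq> {} \<and> 0 \<notin> S \<and> (\<forall>n\<in>S. \<forall>d. d dvd n \<longrightarrow> d \<in> S)"

definition trunc_quot :: "nat set \<Rightarrow> nat \<Rightarrow> nat set" where
  "trunc_quot S n = {\<nu>. 1 \<le> \<nu> \<and> \<nu> * n \<in> S}"

definition no_torsion :: "nat set \<Rightarrow> 'a::comm_ring itself \<Rightarrow> bool" where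
  "no_torsion S _ \<longleftrightarrow> (\<forall>n\<in>S. \<forall>x::'a. nat_multiple n x = 0 \<longrightarrow> x = 0)"

text \<open>A presentation \<open>0 \<rightarrow> I \<rightarrow> A \<rightarrow> R \<rightarrow> 0\<close> is given by the surjection \<open>\<pi> : A \<rightarrow> R\<close>, with
  \<open>I = kernel \<pi>\<close>.\<close>

definition presentation :: "nat set \<Rightarrow> ('a::comm_ring \<Rightarrow> 'r::comm_ring) \<Rightarrow> bool" where
  "presentation S \<pi> \<longleftrightarrow> rng_hom \<pi> \<and> surj \<pi> \<and> no_torsion S TYPE('a)"

text \<open>Elements of \<open>A\<^sup>S\<close> are functions on \<^typ>\<open>nat\<close> that are \<^const>\<open>undefined\<close> outside \<open>S\<close>.\<close>

abbreviation seqs :: "nat set \<Rightarrow> (nat \<Rightarrow> 'a) set" where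
  "seqs S \<equiv> S \<rightarrow>\<^sub>E UNIV"

definition seq_topology :: "nat set \<Rightarrow> (nat \<Rightarrow> 'a) topology" where
  "seq_topology S = product_topology (\<lambda>_. discrete_topology UNIV) S"

definition seq_map :: "nat set \<Rightarrow> ('a \<Rightarrow> 'b) \<Rightarrow> (nat \<Rightarrow> 'a) \<Rightarrow> (nat \<Rightarrow> 'b)" where
  "seq_map S f x = (\<lambda>\<nu>\<in>S. f (x \<nu>))"

definition seq_zero :: "nat set \<Rightarrow> (nat \<Rightarrow> 'a::comm_ring)" where
  "seq_zero S = (\<lambda>\<nu>\<in>S. 0)"

definition seq_add :: "nat set \<Rightarrow> (nat \<Rightarrow> 'a::comm_ring) \<Rightarrow> (nat \<Rightarrow> 'a) \<Rightarrow> (nat \<Rightarrow> 'a)" where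
  "seq_add S x y = (\<lambda>\<nu>\<in>S. x \<nu> + y \<nu>)"

definition seq_diff :: "nat set \<Rightarrow> (nat \<Rightarrow> 'a::comm_ring) \<Rightarrow> (nat \<Rightarrow> 'a) \<Rightarrow> (nat \<Rightarrow> 'a)" where
  "seq_diff S x y = (\<lambda>\<nu>\<in>S. x \<nu> - y \<nu>)"

definition seq_mult :: "nat set \<Rightarrow> (nat \<Rightarrow> 'a::comm_ring) \<Rightarrow> (nat \<Rightarrow> 'a) \<Rightarrow> (nat \<Rightarrow> 'a)" where
  "seq_mult S x y = (\<lambda>\<nu>\<in>S. x \<nu> * y \<nu>)"

definition seq_sums ::
    "nat set \<Rightarrow> (nat \<Rightarrow> nat \<Rightarrow> 'a::comm_ring) \<Rightarrow> (nat \<Rightarrow> 'a) \<Rightarrow> bool" where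
  "seq_sums S f s \<longleftrightarrow>
     limitin (seq_topology S) (\<lambda>N. \<lambda>\<nu>\<in>S. \<Sum>n\<in>N. f n \<nu>) s (finite_subsets_at_top S)"

definition Fro :: "nat set \<Rightarrow> nat \<Rightarrow> (nat \<Rightarrow> 'a) \<Rightarrow> (nat \<Rightarrow> 'a)" where
  "Fro S n x = (\<lambda>\<nu>\<in>trunc_quot S n. x (\<nu> * n))"

definition Ver :: "nat set \<Rightarrow> nat \<Rightarrow> (nat \<Rightarrow> 'a::comm_ring) \<Rightarrow> (nat \<Rightarrow> 'a)" where
  "Ver S n x = (\<lambda>\<nu>\<in>S. nat_multiple n (if n dvd \<nu> then x (\<nu> div n) else 0))"

definition power_seq :: "nat set \<Rightarrow> 'a::comm_ring \<Rightarrow> (nat \<Rightarrow> 'a)" where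
  "power_seq S a = (\<lambda>\<nu>\<in>S. pos_power a \<nu>)"

definition Ver_power :: "nat set \<Rightarrow> nat \<Rightarrow> 'a::comm_ring \<Rightarrow> (nat \<Rightarrow> 'a)" where
  "Ver_power S n a = Ver S n (power_seq (trunc_quot S n) a)"


section \<open>The rings \<open>X\<^sub>S(A)\<close> and \<open>E\<^sub>S(R, \<pi>)\<close>\<close>

definition seq_subgroup :: "nat set \<Rightarrow> (nat \<Rightarrow> 'a::comm_ring) set \<Rightarrow> bool" where
  "seq_subgroup S H \<longleftrightarrow>
     H \<subseteq> seqs S \<and> seq_zero S \<in> H \<and> (\<forall>x\<in>H. \<forall>y\<in>H. seq_diff S x y \<in> H)"

text \<open>For \<open>B = UNIV\<close> this is \<open>X\<^sub>S(A)\<close>; for an ideal \<open>B = I\<close> of \<open>A\<close> it is \<open>X\<^sub>S(I)\<close>, as a subset of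
  \<open>A\<^sup>S\<close>. The closure may be taken in \<open>A\<^sup>S\<close> because \<open>I\<^sup>S\<close> is closed in it and carries the
  subspace topology.\<close>

definition XS :: "nat set \<Rightarrow> 'a::comm_ring set \<Rightarrow> (nat \<Rightarrow> 'a) set" where
  "XS S B = (\<lambda>H. closedin (seq_topology S) H \<and> seq_subgroup S H) hull
              {Ver_power S n a | n a. n \<in> S \<and> a \<in> B}"

definition E_rel ::
    "nat set \<Rightarrow> ('a::comm_ring \<Rightarrow> 'r::comm_ring) \<Rightarrow> ((nat \<Rightarrow> 'a) \<times> (nat \<Rightarrow> 'a)) set" where
  "E_rel S \<pi> = {(x, y). x \<in> XS S UNIV \<and> y \<in> XS S UNIV \<and> seq_diff S x y \<in> XS S (kernel \<pi>)}"

definition E_set ::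
    "nat set \<Rightarrow> ('a::comm_ring \<Rightarrow> 'r::comm_ring) \<Rightarrow> (nat \<Rightarrow> 'a) set set" where
  "E_set S \<pi> = XS S UNIV // E_rel S \<pi>"

definition E_class ::
    "nat set \<Rightarrow> ('a::comm_ring \<Rightarrow> 'r::comm_ring) \<Rightarrow> (nat \<Rightarrow> 'a) \<Rightarrow> (nat \<Rightarrow> 'a) set" where
  "E_class S \<pi> x = E_rel S \<pi> `` {x}"

definition E_add where
  "E_add S \<pi> c d = (\<Union>x\<in>c. \<Union>y\<in>d. E_class S \<pi> (seq_add S x y))"

definition E_mult where
  "E_mult S \<pi> c d = (\<Union>x\<in>c. \<Union>y\<in>d. E_class S \<pi> (seq_mult S x y))"

definition quotient_topology :: "'a topology \<Rightarrow> ('a \<Rightarrow> 'b) \<Rightarrow> 'b topology" where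
  "quotient_topology X q =
     topology (\<lambda>U. U \<subseteq> q ` topspace X \<and> openin X {x \<in> topspace X. q x \<in> U})"

lemma openin_quotient_topology:
  "openin (quotient_topology X q) U \<longleftrightarrow>
     U \<subseteq> q ` topspace X \<and> openin X {x \<in> topspace X. q x \<in> U}"
proof -
  let ?P = "\<lambda>U. U \<subseteq> q ` topspace X \<and> openin X {x \<in> topspace X. q x \<in> U}"
  have "istopology ?P"
    unfolding istopology_def
  proof (intro conjI allI impI)
    fix U V assume "?P U" "?P V"
    moreover have "{x \<in> topspace X. q x \<in> U \<inter> V} =
        {x \<in> topspace X. q x \<in> U} \<inter> {x \<in> topspace X. q x \<in> V}" by auto
    ultimately show "U \<inter> V \<subseteq> q ` topspace X" "openin X {x \<in> topspace X. q x \<in> U \<inter> V}"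
      by (auto simp del: Int_iff)
  next
    fix K assume K: "\<forall>U\<in>K. ?P U"
    have "{x \<in> topspace X. q x \<in> \<Union>K} = (\<Union>U\<in>K. {x \<in> topspace X. q x \<in> U})" by auto
    moreover have "openin X (\<Union>U\<in>K. {x \<in> topspace X. q x \<in> U})" using K by blast
    ultimately show "openin X {x \<in> topspace X. q x \<in> \<Union>K}" by simp
    show "\<Union>K \<subseteq> q ` topspace X" using K by blast
  qed
  then show ?thesis by (simp add: quotient_topology_def)
qed

lemma topspace_quotient_topology: "topspace (quotient_topology X q) = q ` topspace X"
proof -
  have "openin (quotient_topology X q) (q ` topspace X)"
    using openin_topspace[of X] by (simp add: openin_quotient_topology cong: conj_cong)
  then show ?thesis
    by (metis openin_quotient_topology openin_subset openin_topspace subset_antisym)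
qed

lemma quotient_map_quotient_topology: "quotient_map X (quotient_topology X q) q"
  by (auto simp: quotient_map_def topspace_quotient_topology openin_quotient_topology)

definition E_topology ::
    "nat set \<Rightarrow> ('a::comm_ring \<Rightarrow> 'r::comm_ring) \<Rightarrow> (nat \<Rightarrow> 'a) set topology" where
  "E_topology S \<pi> = quotient_topology (subtopology (seq_topology S) (XS S UNIV)) (E_class S \<pi>)"

text \<open>\<open>F\<^sub>n : E\<^sub>S \<rightarrow> E\<^bsub>S/n\<^esub>\<close> and \<open>V\<^sub>n : E\<^bsub>S/n\<^esub> \<rightarrow> E\<^sub>S\<close>\<close>

definition E_Fro where
  "E_Fro S \<pi> n c = (\<Union>x\<in>c. E_class (trunc_quot S n) \<pi> (Fro S n x))"

definition E_Ver where
  "E_Ver S \<pi> n c = (\<Union>x\<in>c. E_class S \<pi> (Ver S n x))"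

definition psi ::
    "nat set \<Rightarrow> ('a::comm_ring \<Rightarrow> 'r::comm_ring) \<Rightarrow> (nat \<Rightarrow> 'r) \<Rightarrow> (nat \<Rightarrow> 'a) set" where
  "psi S \<pi> = (THE \<psi>. \<psi> \<in> extensional (seqs S) \<and> bij_betw \<psi> (seqs S) (E_set S \<pi>) \<and>
     (\<forall>a\<in>seqs S. \<exists>s. seq_sums S (\<lambda>n. Ver_power S n (a n)) s \<and>
        \<psi> (seq_map S \<pi> a) = E_class S \<pi> s))"

definition teich ::
    "nat set \<Rightarrow> ('a::comm_ring \<Rightarrow> 'r::comm_ring) \<Rightarrow> 'r \<Rightarrow> (nat \<Rightarrow> 'a) set" where
  "teich S \<pi> r = psi S \<pi> (\<lambda>\<nu>\<in>S. if \<nu> = 1 then r else 0)"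

definition Ver_teich ::
    "nat set \<Rightarrow> ('a::comm_ring \<Rightarrow> 'r::comm_ring) \<Rightarrow> nat \<Rightarrow> 'r \<Rightarrow> (nat \<Rightarrow> 'a) set" where
  "Ver_teich S \<pi> n r = E_Ver S \<pi> n (teich (trunc_quot S n) \<pi> r)"

definition E_map ::
    "nat set \<Rightarrow> ('a1::comm_ring \<Rightarrow> 'r1::comm_ring) \<Rightarrow> ('a2::comm_ring \<Rightarrow> 'r2::comm_ring) \<Rightarrow>
     ('r1 \<Rightarrow> 'r2) \<Rightarrow> (nat \<Rightarrow> 'a1) set \<Rightarrow> (nat \<Rightarrow> 'a2) set" where
  "E_map S \<pi>\<^sub>1 \<pi>\<^sub>2 \<alpha> = (THE f. f \<in> extensional (E_set S \<pi>\<^sub>1) \<and>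
     (\<forall>r\<in>seqs S. f (psi S \<pi>\<^sub>1 r) = psi S \<pi>\<^sub>2 (seq_map S \<alpha> r)))"

definition E_additive ::
    "nat set \<Rightarrow> ('a1::comm_ring \<Rightarrow> 'r1::comm_ring) \<Rightarrow> ('a2::comm_ring \<Rightarrow> 'r2::comm_ring) \<Rightarrow>
     ((nat \<Rightarrow> 'a1) set \<Rightarrow> (nat \<Rightarrow> 'a2) set) \<Rightarrow> bool" where
  "E_additive S \<pi>\<^sub>1 \<pi>\<^sub>2 f \<longleftrightarrow> f \<in> E_set S \<pi>\<^sub>1 \<rightarrow> E_set S \<pi>\<^sub>2 \<and>
     (\<forall>c\<in>E_set S \<pi>\<^sub>1. \<forall>d\<in>E_set S \<pi>\<^sub>1. f (E_add S \<pi>\<^sub>1 c d) = E_add S \<pi>\<^sub>2 (f c) (f d))"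

definition E_rng_hom ::
    "nat set \<Rightarrow> ('a1::comm_ring \<Rightarrow> 'r1::comm_ring) \<Rightarrow> ('a2::comm_ring \<Rightarrow> 'r2::comm_ring) \<Rightarrow>
     ((nat \<Rightarrow> 'a1) set \<Rightarrow> (nat \<Rightarrow> 'a2) set) \<Rightarrow> bool" where
  "E_rng_hom S \<pi>\<^sub>1 \<pi>\<^sub>2 f \<longleftrightarrow> E_additive S \<pi>\<^sub>1 \<pi>\<^sub>2 f \<and>
     (\<forall>c\<in>E_set S \<pi>\<^sub>1. \<forall>d\<in>E_set S \<pi>\<^sub>1. f (E_mult S \<pi>\<^sub>1 c d) = E_mult S \<pi>\<^sub>2 (f c) (f d))"


section \<open>The semigroup algebra \<open>\<int>R\<close> and the standard presentation\<close>

text \<open>The type \<^typ>\<open>'r \<Rightarrow>\<^sub>0 int\<close> is the free abelian group on the symbols \<^term>\<open>frag_of r\<close>. It is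
  wrapped because its library multiplication is the convolution for the addition of \<open>R\<close>, whereas
  here \<open>[r][s] = [rs]\<close>. The symbol \<open>[0]\<close> is not the zero of \<open>\<int>R\<close>.\<close>

typedef 'r semigroup_algebra = "UNIV :: ('r \<Rightarrow>\<^sub>0 int) set"
  morphisms sa_frag Sa_frag ..

setup_lifting type_definition_semigroup_algebra

definition frag_mult ::
    "('r::ab_semigroup_mult \<Rightarrow>\<^sub>0 int) \<Rightarrow> ('r \<Rightarrow>\<^sub>0 int) \<Rightarrow> ('r \<Rightarrow>\<^sub>0 int)" where
  "frag_mult f g = frag_extend (\<lambda>r. frag_extend (\<lambda>s. frag_of (r * s)) g) f"

lemma frag_induct [case_names zero one diff]:
  assumes "P 0" "\<And>r. P (frag_of r)" "\<And>a b. P a \<Longrightarrow> P b \<Longrightarrow> P (a - b)"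
  shows "P (f :: 'r \<Rightarrow>\<^sub>0 int)"
  by (rule frag_induction[where S = UNIV]) (use assms in auto)

lemma frag_mult_add_left: "frag_mult (f + g) h = frag_mult f h + frag_mult g h"
  by (simp add: frag_mult_def frag_extend_add)

lemma frag_mult_diff_left: "frag_mult (f - g) h = frag_mult f h - frag_mult g h"
  by (simp add: frag_mult_def frag_extend_diff)

lemma frag_mult_zero_left: "frag_mult 0 h = 0"
  by (simp add: frag_mult_def)

lemma frag_mult_of_of: "frag_mult (frag_of r) (frag_of s) = frag_of (r * s)"
  by (simp add: frag_mult_def)

lemma frag_mult_of_diff:
  "frag_mult (frag_of r) (g - h) = frag_mult (frag_of r) g - frag_mult (frag_of r) h"
  by (simp add: frag_mult_def frag_extend_diff)

lemma frag_mult_diff_right: "frag_mult f (g - h) = frag_mult f g - frag_mult f h"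
proof (induction f rule: frag_induct)
  case (diff a b)
  then show ?case by (simp add: frag_mult_diff_left)
qed (simp_all add: frag_mult_zero_left frag_mult_of_diff)

lemma frag_mult_zero_right: "frag_mult f 0 = 0"
  using frag_mult_diff_right[of f 0 0] by simp

lemma frag_mult_commute: "frag_mult f g = frag_mult g f"
proof (induction f rule: frag_induct)
  case (one r)
  show ?case
  proof (induction g rule: frag_induct)
    case (diff a b)
    then show ?case by (simp add: frag_mult_diff_left frag_mult_diff_right)
  qed (simp_all add: frag_mult_zero_left frag_mult_zero_right frag_mult_of_of mult.commute)
next
  case (diff a b)
  then show ?case by (simp add: frag_mult_diff_left frag_mult_diff_right)
qed (simp_all add: frag_mult_zero_left frag_mult_zero_right)

lemma frag_mult_assoc: "frag_mult (frag_mult f g) h = frag_mult f (frag_mult g h)"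
proof (induction f rule: frag_induct)
  case (one r)
  show ?case
  proof (induction g rule: frag_induct)
    case (one s)
    show ?case
    proof (induction h rule: frag_induct)
      case (diff a b)
      then show ?case by (simp add: frag_mult_diff_right)
    qed (simp_all add: frag_mult_zero_right frag_mult_of_of mult.assoc)
  next
    case (diff a b)
    then show ?case by (simp add: frag_mult_diff_left frag_mult_diff_right)
  qed (simp_all add: frag_mult_zero_left frag_mult_zero_right)
next
  case (diff a b)
  then show ?case by (simp add: frag_mult_diff_left)
qed (simp_all add: frag_mult_zero_left)

instantiation semigroup_algebra :: (ab_semigroup_mult) comm_ring
begin

lift_definition zero_semigroup_algebra :: "'a semigroup_algebra" is 0 .
lift_definition plus_semigroup_algebra ::
  "'a semigroup_algebra \<Rightarrow> 'a semigroup_algebra \<Rightarrow> 'a semigroup_algebra" is "(+)" .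
lift_definition minus_semigroup_algebra ::
  "'a semigroup_algebra \<Rightarrow> 'a semigroup_algebra \<Rightarrow> 'a semigroup_algebra" is "(-)" .
lift_definition uminus_semigroup_algebra ::
  "'a semigroup_algebra \<Rightarrow> 'a semigroup_algebra" is uminus .
lift_definition times_semigroup_algebra ::
  "'a semigroup_algebra \<Rightarrow> 'a semigroup_algebra \<Rightarrow> 'a semigroup_algebra" is frag_mult .

instance
proof
  fix a b c :: "'a semigroup_algebra"
  show "a + b + c = a + (b + c)" by transfer (rule add.assoc)
  show "a + b = b + a" by transfer (rule add.commute)
  show "0 + a = a" by transfer simp
  show "- a + a = 0" by transfer simp
  show "a - b = a + - b" by transfer simp
  show "a * b * c = a * (b * c)" by transfer (rule frag_mult_assoc)
  show "a * b = b * a" by transfer (rule frag_mult_commute)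
  show "(a + b) * c = a * c + b * c" by transfer (rule frag_mult_add_left)
qed

end

definition sa_of :: "'r \<Rightarrow> 'r semigroup_algebra" where
  "sa_of r = Sa_frag (frag_of r)"

definition std_proj :: "'r::comm_ring semigroup_algebra \<Rightarrow> 'r" where
  "std_proj f =
     (\<Sum>r\<in>Poly_Mapping.keys (sa_frag f). int_multiple (Poly_Mapping.lookup (sa_frag f) r) r)"

lemma sa_of_mult: "sa_of r * sa_of s = sa_of (r * s :: 'r::ab_semigroup_mult)"
  by (simp add: sa_of_def times_semigroup_algebra_def Sa_frag_inverse frag_mult_of_of)

lemma std_proj_sa_of: "std_proj (sa_of r) = r"
  by (simp add: std_proj_def sa_of_def Sa_frag_inverse int_multiple_def nat_multiple_def)

end

theory Submission
  imports Defs
begin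

text \<open>
  Every element of \<open>X\<^sub>S(A)\<close> is a sum \<open>\<Sum>\<^sub>n V\<^sub>n\<langle>a\<^sub>n\<rangle>\<close> with unique coefficients \<open>a\<^sub>n \<in> A\<close>, and its
  class in \<open>E\<^sub>S(R, \<pi>)\<close> depends exactly on the images \<open>\<pi> a\<^sub>n\<close>. Hence \<open>E\<^sub>S(\<alpha>)\<close> sends the class of
  \<open>\<Sum>\<^sub>n V\<^sub>n\<langle>a\<^sub>n\<rangle>\<close> to that of \<open>\<Sum>\<^sub>n V\<^sub>n\<langle>b\<^sub>n\<rangle>\<close> for any \<open>b\<close> with \<open>\<alpha> (\<pi>\<^sub>1 a\<^sub>n) = \<pi>\<^sub>2 b\<^sub>n\<close>. What has to be
  shown is that addition, multiplication, \<open>F\<^sub>n\<close> and \<open>V\<^sub>n\<close>, expressed in these coefficients,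
  respect this relation between \<open>a\<close> and \<open>b\<close>. A homomorphism \<open>A\<^sub>1 \<rightarrow> A\<^sub>2\<close> over \<open>\<alpha>\<close> would do it, but
  there may be none.

  Instead, consider the fibre product \<open>P = {(x, y). \<alpha> (\<pi>\<^sub>1 x) = \<pi>\<^sub>2 y}\<close>, a subring of
  \<open>A\<^sub>1 \<times> A\<^sub>2\<close>. Suppose that for every subring \<open>B\<close> of a ring without \<open>S\<close>-torsion the set
  \<^term>\<open>ghost_image S B\<close> of all \<open>\<Sum>\<^sub>n V\<^sub>n\<langle>c\<^sub>n\<rangle>\<close> with \<open>c\<^sub>n \<in> B\<close> is closed under the four operations. For
  \<open>B = P\<close> this says that pairs of coefficients in \<open>P\<close> yield pairs of coefficients in \<open>P\<close>, which
  is the required compatibility. For \<open>A\<^sub>1 = A\<^sub>2 = A\<close> and \<open>\<alpha> = id\<close> the same argument describes the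
  classes modulo \<open>X\<^sub>S(I)\<close>, so it also yields the bijection \<open>\<psi>\<^sub>S\<close> (lemmas
  \<open>ghost_related_ghost_iff\<close>, \<open>ghost_seq_E_rel_iff\<close>, \<open>psi_E_cls\<close>).

  Closure under subtraction is the heart of the matter. The sequence \<open>V\<^sub>n\<langle>c\<rangle>\<close> consists of the
  coefficients of \<open>- t f' / f\<close> for \<open>f = 1 - c t\<^sup>n\<close>. Logarithmic derivatives of power series in
  \<open>1 + t B[[t]]\<close> form a group, and each such series is an infinite product
  \<open>\<Prod>\<^sub>n (1 - c\<^sub>n t\<^sup>n)\<close> with \<open>c\<^sub>n \<in> B\<close>, so this group is exactly the set of all \<open>\<Sum>\<^sub>n V\<^sub>n\<langle>c\<^sub>n\<rangle>\<close>. As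
  \<open>B\<close> may lack a unit, \<open>1 + t B[[t]]\<close> is replaced by \<open>t B[[t]]\<close> with the circle operation
  \<open>e + g + e g\<close>. Products, \<open>F\<^sub>n\<close> and \<open>V\<^sub>n\<close> then follow from formulas on the generators and
  the fact that limits do not leave \<^term>\<open>ghost_image S B\<close> (\<open>ghost_image_limit\<close>).

  Two elements of \<open>E\<^sub>S\<close> are close when their coefficients in \<open>R\<close> agree up to a large index.
  Continuity of \<open>E\<^sub>S(\<alpha>)\<close> is immediate from this, and so is uniqueness: a continuous additive map is
  determined by its values on the \<open>V\<^sub>n\<langle>r\<rangle>\<close> because the finite sums of these are dense and the
  target is Hausdorff. For part c), \<open>E\<^sub>S(id)\<close> has the inverse \<open>E\<^sub>S(id)\<close> in the other direction.
\<close>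

section \<open>Multiples, powers and subrings without a unit\<close>

lemma nat_multiple_0 [simp]: "nat_multiple 0 x = 0"
  and nat_multiple_Suc [simp]: "nat_multiple (Suc n) x = nat_multiple n x + x"
  and nat_multiple_zero [simp]: "nat_multiple n 0 = 0"
  by (simp_all add: nat_multiple_def)

lemma nat_multiple_add: "nat_multiple n (x + y) = nat_multiple n x + nat_multiple n y"
  by (simp add: nat_multiple_def sum.distrib)

lemma nat_multiple_minus: "nat_multiple n (- x) = - nat_multiple n x"
  by (simp add: nat_multiple_def sum_negf)

lemma nat_multiple_diff: "nat_multiple n (x - y) = nat_multiple n x - nat_multiple n y"
  by (simp add: nat_multiple_def sum_subtractf)

lemma nat_multiple_sum: "nat_multiple n (sum f I) = (\<Sum>i\<in>I. nat_multiple n (f i))"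
  unfolding nat_multiple_def by (rule sum.swap)

lemma nat_multiple_add_left: "nat_multiple (m + n) x = nat_multiple m x + nat_multiple n x"
  by (induction n) (simp_all add: add.assoc)

lemma nat_multiple_mult_left: "nat_multiple n x * y = nat_multiple n (x * y)"
  by (simp add: nat_multiple_def sum_distrib_right)

lemma nat_multiple_mult_right: "y * nat_multiple n x = nat_multiple n (y * x)"
  by (simp add: nat_multiple_def sum_distrib_left)

lemma nat_multiple_nat_multiple: "nat_multiple m (nat_multiple n x) = nat_multiple (m * n) x"
  by (induction m) (simp_all add: nat_multiple_add_left add.commute)

lemma pos_power_1 [simp]: "pos_power a (Suc 0) = a"
  by (simp add: pos_power_def)

lemma pos_power_Suc: "0 < n \<Longrightarrow> pos_power a (Suc n) = a * pos_power a n"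
  by (cases n) (simp_all add: pos_power_def)

lemma pos_power_add: "0 < m \<Longrightarrow> 0 < n \<Longrightarrow> pos_power a (m + n) = pos_power a m * pos_power a n"
proof (induction m rule: nat_induct_non_zero)
  case 1
  then show ?case by (simp add: pos_power_Suc)
next
  case (Suc m)
  then show ?case by (simp add: pos_power_Suc mult.assoc)
qed

lemma pos_power_mult:
  assumes "0 < m"
  shows "0 < n \<Longrightarrow> pos_power a (m * n) = pos_power (pos_power a m) n"
  by (induction n rule: nat_induct_non_zero) (use assms in \<open>simp_all add: pos_power_Suc pos_power_add\<close>)

lemma pos_power_mult_distrib: "0 < n \<Longrightarrow> pos_power (a * b) n = pos_power a n * pos_power b n"
  by (induction n rule: nat_induct_non_zero) (simp_all add: pos_power_Suc mult_ac)

lemma pos_power_zero [simp]: "pos_power 0 n = (0 :: 'a::comm_ring)"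
  by (cases "n - 1") (simp_all add: pos_power_def)

definition subrng :: "'a::comm_ring set \<Rightarrow> bool" where
  "subrng B \<longleftrightarrow> 0 \<in> B \<and> (\<forall>x\<in>B. \<forall>y\<in>B. x - y \<in> B \<and> x * y \<in> B)"

lemma subrng_UNIV: "subrng UNIV"
  by (simp add: subrng_def)

context
  fixes B :: "'a::comm_ring set"
  assumes B: "subrng B"
begin

lemma subrng_zero: "0 \<in> B"
  and subrng_diff: "x \<in> B \<Longrightarrow> y \<in> B \<Longrightarrow> x - y \<in> B"
  and subrng_mult: "x \<in> B \<Longrightarrow> y \<in> B \<Longrightarrow> x * y \<in> B"
  using B by (auto simp: subrng_def)

lemma subrng_uminus: "x \<in> B \<Longrightarrow> - x \<in> B"
  using subrng_diff[of 0 x] subrng_zero by simp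

lemma subrng_add: "x \<in> B \<Longrightarrow> y \<in> B \<Longrightarrow> x + y \<in> B"
  using subrng_diff[of x "- y"] subrng_uminus by simp

lemma subrng_sum: "(\<And>i. i \<in> I \<Longrightarrow> f i \<in> B) \<Longrightarrow> sum f I \<in> B"
  by (induction I rule: infinite_finite_induct) (auto intro: subrng_zero subrng_add)

lemma subrng_pos_power: "x \<in> B \<Longrightarrow> pos_power x n \<in> B"
proof -
  assume x: "x \<in> B"
  have "(((*) x) ^^ k) x \<in> B" for k
    using x by (induction k) (auto intro: subrng_mult)
  then show ?thesis by (simp add: pos_power_def)
qed

end

lemma rng_hom_add: "rng_hom f \<Longrightarrow> f (x + y) = f x + f y"
  and rng_hom_mult: "rng_hom f \<Longrightarrow> f (x * y) = f x * f y"
  by (simp_all add: rng_hom_def)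

lemma rng_hom_zero: "rng_hom f \<Longrightarrow> f 0 = 0"
  using rng_hom_add[of f 0 0] by simp

lemma rng_hom_diff: "rng_hom f \<Longrightarrow> f (x - y) = f x - f y"
  using rng_hom_add[of f "x - y" y] by simp

lemma rng_hom_id: "rng_hom id"
  by (simp add: rng_hom_def)

lemma rng_hom_comp: "rng_hom f \<Longrightarrow> rng_hom g \<Longrightarrow> rng_hom (f \<circ> g)"
  by (simp add: rng_hom_def)

lemma subrng_kernel: "rng_hom f \<Longrightarrow> subrng (kernel f)"
  by (simp add: subrng_def kernel_def rng_hom_zero rng_hom_diff rng_hom_mult)

section \<open>Logarithmic derivatives of power series\<close>

text \<open>The derivation \<open>t d/dt\<close>, used instead of \<open>d/dt\<close> because it does not shift
  degrees: \<open>V\<^sub>n\<langle>c\<rangle>\<close> then has its components at the right indices.\<close>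

definition coeff_mult :: "'a::comm_ring fps \<Rightarrow> 'a fps" where
  "coeff_mult e = Abs_fps (\<lambda>k. nat_multiple k (fps_nth e k))"

lemma coeff_mult_add: "coeff_mult (e + g) = coeff_mult e + coeff_mult g"
  by (simp add: coeff_mult_def fps_eq_iff nat_multiple_add)

lemma coeff_mult_mult: "coeff_mult (e * g) = coeff_mult e * g + e * coeff_mult g"
proof (rule fps_ext)
  fix n
  \<comment> \<open>The Leibniz rule is the splitting \<open>n = i + (n - i)\<close> in each summand of the convolution.\<close>
  have "fps_nth (coeff_mult (e * g)) n =
      (\<Sum>i=0..n. nat_multiple (i + (n - i)) (fps_nth e i * fps_nth g (n - i)))"
    by (simp add: coeff_mult_def fps_mult_nth nat_multiple_sum)
  also have "\<dots> = fps_nth (coeff_mult e * g + e * coeff_mult g) n"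
    unfolding nat_multiple_add_left
    by (simp add: coeff_mult_def fps_mult_nth sum.distrib nat_multiple_mult_left
        nat_multiple_mult_right)
  finally show "fps_nth (coeff_mult (e * g)) n = fps_nth (coeff_mult e * g + e * coeff_mult g) n" .
qed

text \<open>Read \<open>f = 1 + e\<close>. The equation is \<open>X f = - t f'\<close>, that is \<open>X = - t f' / f\<close>, written without
  the unit.\<close>

definition is_log_deriv :: "'a::comm_ring fps \<Rightarrow> 'a fps \<Rightarrow> bool" where
  "is_log_deriv X e \<longleftrightarrow> X + X * e + coeff_mult e = 0"

text \<open>The circle operation corresponds to the product \<open>(1 + e) (1 + g)\<close>, and the logarithmic
  derivative of a product is the sum of the logarithmic derivatives.\<close>

lemma is_log_deriv_add:
  assumes "is_log_deriv X e" "is_log_deriv Y g"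
  shows "is_log_deriv (X + Y) (e + g + e * g)"
proof -
  let ?X = "X + X * e + coeff_mult e" and ?Y = "Y + Y * g + coeff_mult g"
  have "(X + Y) + (X + Y) * (e + g + e * g) + coeff_mult (e + g + e * g)
      = ?X + ?X * g + (?Y + ?Y * e)"
    by (simp add: coeff_mult_add coeff_mult_mult algebra_simps)
  also have "\<dots> = 0"
    using assms by (simp add: is_log_deriv_def)
  finally show ?thesis by (simp add: is_log_deriv_def)
qed

text \<open>The hypothesis on \<open>g\<close> says \<open>(1 + e) (1 + g) = 1\<close>.\<close>

lemma is_log_deriv_uminus:
  assumes X: "is_log_deriv X e" and g: "e + g + e * g = 0"
  shows "is_log_deriv (- X) g"
proof -
  let ?Z = "- X + - X * g + coeff_mult g" and ?X = "X + X * e + coeff_mult e"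
  have "?Z + e * ?Z = - ?X - ?X * g + coeff_mult (e + g + e * g)"
    by (simp add: coeff_mult_add coeff_mult_mult algebra_simps)
  also have "\<dots> = coeff_mult 0"
    using X by (simp add: is_log_deriv_def g)
  also have "\<dots> = 0"
    by (simp add: coeff_mult_def fps_eq_iff)
  finally have Z: "?Z + e * ?Z = 0" .
  \<comment> \<open>From \<open>(1 + e) Z = 0\<close>, multiplication by \<open>1 + g\<close> gives \<open>Z = 0\<close>.\<close>
  have "?Z = ?Z + e * ?Z + g * (?Z + e * ?Z) - (e + g + e * g) * ?Z"
    by (simp add: algebra_simps)
  also have "\<dots> = 0"
    by (simp only: Z g) simp
  finally show ?thesis by (simp add: is_log_deriv_def)
qed

text \<open>The ideal \<open>t B[[t]]\<close> of \<open>B[[t]]\<close>.\<close>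

definition fps_over :: "'a::comm_ring set \<Rightarrow> 'a fps set" where
  "fps_over B = {e. fps_nth e 0 = 0 \<and> (\<forall>k. fps_nth e k \<in> B)}"

lemma fps_over_circle:
  assumes "subrng B" "e \<in> fps_over B" "g \<in> fps_over B"
  shows "e + g + e * g \<in> fps_over B"
  using assms by (auto simp: fps_over_def fps_mult_nth
      intro!: subrng_add subrng_sum subrng_mult)

text \<open>The coefficients of the \<open>g\<close> with \<open>g = - e - e g\<close>. For \<open>e 0 = 0\<close> this equation determines \<open>g n\<close>
  from the \<open>g i\<close> with \<open>i < n\<close>.\<close>

fun circle_inverse_coeff :: "(nat \<Rightarrow> 'a::comm_ring) \<Rightarrow> nat \<Rightarrow> 'a" where
  "circle_inverse_coeff e n = - e n - (\<Sum>i<n. e (n - i) * circle_inverse_coeff e i)"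

declare circle_inverse_coeff.simps [simp del]

lemma fps_over_circle_inverse:
  assumes B: "subrng B" and e: "e \<in> fps_over B"
  obtains g where "g \<in> fps_over B" "e + g + e * g = 0"
proof
  let ?c = "circle_inverse_coeff (fps_nth e)"
  have e0: "fps_nth e 0 = 0" and eB: "fps_nth e k \<in> B" for k
    using e by (auto simp: fps_over_def)
  have "?c n \<in> B" for n
  proof (induction n rule: less_induct)
    case (less n)
    then show ?case
      unfolding circle_inverse_coeff.simps[of _ n]
      by (intro subrng_diff[OF B] subrng_uminus[OF B] subrng_sum[OF B] subrng_mult[OF B] eB) auto
  qed
  moreover have "?c 0 = 0"
    by (subst circle_inverse_coeff.simps) (simp add: e0)
  ultimately show "Abs_fps ?c \<in> fps_over B"
    by (simp add: fps_over_def)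
  show "e + Abs_fps ?c + e * Abs_fps ?c = 0"
  proof (rule fps_ext)
    fix n
    have "fps_nth (e * Abs_fps ?c) n = (\<Sum>i=0..n. ?c i * fps_nth e (n - i))"
      by (subst mult.commute) (simp add: fps_mult_nth)
    also have "\<dots> = (\<Sum>i<n. fps_nth e (n - i) * ?c i)"
      by (simp only: atLeast0AtMost lessThan_Suc_atMost[symmetric] sum.lessThan_Suc)
        (simp add: e0 mult.commute)
    finally show "fps_nth (e + Abs_fps ?c + e * Abs_fps ?c) n = fps_nth 0 n"
      using circle_inverse_coeff.simps[of "fps_nth e" n] by simp
  qed
qed

text \<open>The components of \<open>V\<^sub>n\<langle>c\<rangle>\<close> for all indices, independently of any truncation set. The value \<open>0\<close>
  at the index \<open>0\<close> turns the sequence into the coefficients of a power series without constant term.\<close>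

definition Ver_pow :: "nat \<Rightarrow> 'a::comm_ring \<Rightarrow> nat \<Rightarrow> 'a" where
  "Ver_pow n c \<nu> = (if 0 < \<nu> \<and> n dvd \<nu> then nat_multiple n (pos_power c (\<nu> div n)) else 0)"

definition log_derivs :: "'a::comm_ring set \<Rightarrow> (nat \<Rightarrow> 'a) set" where
  "log_derivs B = {x. \<exists>e\<in>fps_over B. is_log_deriv (Abs_fps x) e}"

lemma log_derivs_zero: "subrng B \<Longrightarrow> (\<lambda>_. 0) \<in> log_derivs B"
  unfolding log_derivs_def is_log_deriv_def fps_over_def fps_zero_def[symmetric]
  by (auto simp: subrng_zero coeff_mult_def fps_eq_iff intro!: exI[of _ 0])

lemma log_derivs_diff:
  assumes B: "subrng B" and "x \<in> log_derivs B" "y \<in> log_derivs B"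
  shows "(\<lambda>\<nu>. x \<nu> - y \<nu>) \<in> log_derivs B"
proof -
  obtain e g where e: "e \<in> fps_over B" "is_log_deriv (Abs_fps x) e"
    and g: "g \<in> fps_over B" "is_log_deriv (Abs_fps y) g"
    using assms by (auto simp: log_derivs_def)
  obtain g' where g': "g' \<in> fps_over B" "g + g' + g * g' = 0"
    using fps_over_circle_inverse[OF B g(1)] .
  have "is_log_deriv (Abs_fps x + - Abs_fps y) (e + g' + e * g')"
    using e(2) g(2) g'(2) by (intro is_log_deriv_add is_log_deriv_uminus)
  moreover have "Abs_fps x + - Abs_fps y = Abs_fps (\<lambda>\<nu>. x \<nu> - y \<nu>)"
    by (simp add: fps_eq_iff)
  ultimately show ?thesis
    using fps_over_circle[OF B e(1) g'(1)] by (auto simp: log_derivs_def)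
qed

lemma log_derivs_add:
  assumes B: "subrng B" and x: "x \<in> log_derivs B" and y: "y \<in> log_derivs B"
  shows "(\<lambda>\<nu>. x \<nu> + y \<nu>) \<in> log_derivs B"
  using log_derivs_diff[OF B x log_derivs_diff[OF B log_derivs_zero[OF B] y]] by simp

lemma log_derivs_sum:
  assumes B: "subrng B" and "\<And>i. i \<in> I \<Longrightarrow> f i \<in> log_derivs B"
  shows "(\<lambda>\<nu>. \<Sum>i\<in>I. f i \<nu>) \<in> log_derivs B"
  using assms(2) by (induction I rule: infinite_finite_induct)
    (auto intro: log_derivs_zero[OF B] log_derivs_add[OF B])

lemma log_derivs_nat_multiple:
  assumes B: "subrng B" and "x \<in> log_derivs B"
  shows "(\<lambda>\<nu>. nat_multiple k (x \<nu>)) \<in> log_derivs B"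
  unfolding nat_multiple_def by (rule log_derivs_sum[OF B assms(2)])

text \<open>The geometric series: \<open>- t f' / f = n c t\<^sup>n / (1 - c t\<^sup>n) = \<Sum>\<^sub>k n c\<^sup>k t\<^bsup>n k\<^esup>\<close> for \<open>f = 1 - c t\<^sup>n\<close>.\<close>

lemma Ver_pow_is_log_deriv:
  assumes n: "0 < n"
  shows "is_log_deriv (Abs_fps (Ver_pow n c)) (Abs_fps (\<lambda>k. if k = n then - c else 0))"
  unfolding is_log_deriv_def
proof (rule fps_ext)
  fix \<nu>
  let ?e = "Abs_fps (\<lambda>k. if k = n then - c else 0)"
  have "fps_nth (Abs_fps (Ver_pow n c) * ?e) \<nu> =
      (\<Sum>i=0..\<nu>. if i = \<nu> - n \<and> n \<le> \<nu> then - (Ver_pow n c (\<nu> - n) * c) else 0)"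
    unfolding fps_mult_nth by (rule sum.cong) auto
  also have "\<dots> = (if n \<le> \<nu> then - (Ver_pow n c (\<nu> - n) * c) else 0)"
    by (auto simp: sum.delta)
  finally have prod: "fps_nth (Abs_fps (Ver_pow n c) * ?e) \<nu> = \<dots>" .
  have "Ver_pow n c \<nu> + (if n \<le> \<nu> then - (Ver_pow n c (\<nu> - n) * c) else 0) +
      nat_multiple \<nu> (if \<nu> = n then - c else 0) = 0"
  proof (cases "n dvd \<nu> \<and> 0 < \<nu>")
    case False
    moreover have "n dvd \<nu>" if "n dvd \<nu> - n" "n \<le> \<nu>"
      using that by (simp add: dvd_minus_self)
    ultimately show ?thesis
      using n by (auto simp: Ver_pow_def)
  next
    case True
    then obtain k where k: "\<nu> = n * k" by blast
    then have "0 < k" using True by (cases k) auto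
    then consider "k = 1" | j where "k = Suc j" "0 < j" by (cases k) auto
    then show ?thesis
    proof cases
      case 1
      then show ?thesis using n k by (simp add: Ver_pow_def nat_multiple_minus)
    next
      case 2
      then have "\<nu> - n = n * j" "n \<le> \<nu>" "\<nu> \<noteq> n"
        using k n by auto
      then show ?thesis
        using n 2 k by (simp add: Ver_pow_def pos_power_Suc nat_multiple_mult_left mult.commute[of c])
    qed
  qed
  then show "fps_nth (Abs_fps (Ver_pow n c) + Abs_fps (Ver_pow n c) * ?e + coeff_mult ?e) \<nu>
      = fps_nth 0 \<nu>"
    unfolding fps_add_nth prod by (simp add: coeff_mult_def)
qed

lemma Ver_pow_in_log_derivs:
  assumes "subrng B" "c \<in> B" "0 < n"
  shows "Ver_pow n c \<in> log_derivs B"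
  using Ver_pow_is_log_deriv[OF assms(3)] assms
  by (force simp: log_derivs_def fps_over_def intro: subrng_uminus subrng_zero)

text \<open>The factorisation \<open>f = \<Prod>\<^sub>n\<^sub>\<le>\<^sub>N (1 - c\<^sub>n t\<^sup>n) \<cdot> (1 + e)\<close> with \<open>e\<close> divisible by \<open>t\<^sup>N\<^sup>+\<^sup>1\<close>, built one factor at a
  time. The \<open>c\<^sub>N\<^sub>+\<^sub>1\<close> of the next factor is minus the leading coefficient of the remainder,
  and hence lies in \<open>B\<close>. The remainder does not contribute to the logarithmic derivative up to the index \<open>N\<close>.\<close>

lemma log_derivs_factor:
  assumes B: "subrng B" and x: "x \<in> log_derivs B"
  shows "\<exists>c. (\<forall>n. c n \<in> B) \<and> (\<forall>\<nu>\<le>N. x \<nu> = (\<Sum>n=1..N. Ver_pow n (c n) \<nu>))"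
proof -
  have "\<exists>c e y. (\<forall>n. c n \<in> B) \<and> e \<in> fps_over B \<and> is_log_deriv (Abs_fps y) e \<and>
      (\<forall>k\<le>N. fps_nth e k = 0) \<and> (\<forall>\<nu>. x \<nu> = y \<nu> + (\<Sum>n=1..N. Ver_pow n (c n) \<nu>))"
  proof (induction N)
    case 0
    obtain e where "e \<in> fps_over B" "is_log_deriv (Abs_fps x) e"
      using x by (auto simp: log_derivs_def)
    then show ?case
      by (intro exI[of _ "\<lambda>_. 0"] exI[of _ e] exI[of _ x])
        (auto simp: fps_over_def subrng_zero[OF B])
  next
    case (Suc N)
    then obtain c e y where c: "\<And>n. c n \<in> B" and e: "e \<in> fps_over B"
      and ye: "is_log_deriv (Abs_fps y) e" and eN: "\<And>k. k \<le> N \<Longrightarrow> fps_nth e k = 0"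
      and xy: "\<And>\<nu>. x \<nu> = y \<nu> + (\<Sum>n=1..N. Ver_pow n (c n) \<nu>)"
      by blast
    \<comment> \<open>Dividing \<open>1 + e\<close> by \<open>1 - d t\<^sup>N\<^sup>+\<^sup>1\<close> removes the coefficient of \<open>t\<^sup>N\<^sup>+\<^sup>1\<close>.\<close>
    define d where "d = - fps_nth e (Suc N)"
    have d: "d \<in> B"
      using e by (auto simp: d_def fps_over_def intro: subrng_uminus[OF B])
    define h where "h = Abs_fps (\<lambda>k. if k = Suc N then - d else 0)"
    have h: "h \<in> fps_over B"
      using d by (auto simp: h_def fps_over_def intro: subrng_uminus[OF B] subrng_zero[OF B])
    obtain g where g: "g \<in> fps_over B" "h + g + h * g = 0"
      using fps_over_circle_inverse[OF B h] .
    have "is_log_deriv (Abs_fps y + - Abs_fps (Ver_pow (Suc N) d)) (e + g + e * g)"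
      using ye g(2) Ver_pow_is_log_deriv[of "Suc N" d]
      by (intro is_log_deriv_add is_log_deriv_uminus[of _ h]) (simp_all add: h_def)
    moreover have "Abs_fps y + - Abs_fps (Ver_pow (Suc N) d) =
        Abs_fps (\<lambda>\<nu>. y \<nu> - Ver_pow (Suc N) d \<nu>)"
      by (simp add: fps_eq_iff)
    moreover have "fps_nth (e + g + e * g) k = 0" if k: "k \<le> Suc N" for k
    proof -
      have g0: "fps_nth g 0 = 0" using g by (simp add: fps_over_def)
      have prod_zero: "fps_nth (f * g) k = 0" if "\<And>k. k \<le> N \<Longrightarrow> fps_nth f k = 0" for f
        unfolding fps_mult_nth
      proof (rule sum.neutral, intro ballI)
        fix i assume "i \<in> {0..k}"
        then show "fps_nth f i * fps_nth g (k - i) = 0"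
          using that[of i] k g0 by (cases "i \<le> N") (auto simp: le_Suc_eq)
      qed
      have "fps_nth (h + g + h * g) k = 0"
        by (simp add: g(2))
      then have "fps_nth g k = - fps_nth h k"
        using prod_zero[of h] by (simp add: h_def eq_neg_iff_add_eq_0 add.commute)
      moreover have "fps_nth e k = fps_nth h k"
        using eN k by (auto simp: h_def d_def le_Suc_eq)
      ultimately show ?thesis
        using prod_zero[of e] eN by simp
    qed
    moreover have "x \<nu> = y \<nu> - Ver_pow (Suc N) d \<nu> +
        (\<Sum>n=1..Suc N. Ver_pow n ((c(Suc N := d)) n) \<nu>)" for \<nu>
    proof -
      have "(\<Sum>n=1..N. Ver_pow n ((c(Suc N := d)) n) \<nu>) = (\<Sum>n=1..N. Ver_pow n (c n) \<nu>)"
        by (rule sum.cong) auto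
      then show ?thesis
        by (simp add: xy)
    qed
    ultimately show ?case
      using c d fps_over_circle[OF B e g(1)]
      by (intro exI[of _ "c(Suc N := d)"] exI[of _ "e + g + e * g"]
          exI[of _ "\<lambda>\<nu>. y \<nu> - Ver_pow (Suc N) d \<nu>"]) auto
  qed
  then obtain c e y where c: "\<And>n. c n \<in> B" and ye: "is_log_deriv (Abs_fps y) e"
    and eN: "\<And>k. k \<le> N \<Longrightarrow> fps_nth e k = 0"
    and xy: "\<And>\<nu>. x \<nu> = y \<nu> + (\<Sum>n=1..N. Ver_pow n (c n) \<nu>)"
    by blast
  have "y \<nu> = 0" if "\<nu> \<le> N" for \<nu>
  proof -
    have "fps_nth (Abs_fps y * e) \<nu> = 0"
      unfolding fps_mult_nth using that by (intro sum.neutral) (auto simp: eN)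
    moreover have "fps_nth (Abs_fps y + Abs_fps y * e + coeff_mult e) \<nu> = 0"
      using ye by (simp add: is_log_deriv_def)
    ultimately show ?thesis
      using that by (simp add: coeff_mult_def eN)
  qed
  then show ?thesis
    using c xy by auto
qed

section \<open>Sums of the \<open>V\<^sub>n\<langle>a\<^sub>n\<rangle>\<close>\<close>

lemma truncation_set_dvd: "truncation_set S \<Longrightarrow> n \<in> S \<Longrightarrow> d dvd n \<Longrightarrow> d \<in> S"
  and truncation_set_pos: "truncation_set S \<Longrightarrow> n \<in> S \<Longrightarrow> 0 < n"
  by (auto simp: truncation_set_def intro: gr0I)

lemma trunc_quot_subset: "truncation_set S \<Longrightarrow> trunc_quot S n \<subseteq> S"
  using truncation_set_dvd[of S _] by (force simp: trunc_quot_def)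

lemma truncation_set_trunc_quot:
  assumes "truncation_set S" "n \<in> S"
  shows "truncation_set (trunc_quot S n)"
  unfolding truncation_set_def
proof (intro conjI ballI allI impI)
  show "trunc_quot S n \<noteq> {}" using assms(2) by (auto simp: trunc_quot_def intro: exI[of _ 1])
  show "0 \<notin> trunc_quot S n" by (simp add: trunc_quot_def)
  fix m d assume m: "m \<in> trunc_quot S n" and d: "d dvd m"
  have "d * n \<in> S"
    using truncation_set_dvd[OF assms(1), of "m * n" "d * n"] m d by (simp add: trunc_quot_def)
  moreover have "0 < d" using m d by (auto simp: trunc_quot_def intro!: gr0I)
  ultimately show "d \<in> trunc_quot S n" by (simp add: trunc_quot_def)
qed

lemma div_in_trunc_quot: "truncation_set S \<Longrightarrow> \<nu> \<in> S \<Longrightarrow> n dvd \<nu> \<Longrightarrow> \<nu> div n \<in> trunc_quot S n"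
  using truncation_set_pos[of S \<nu>] by (auto simp: trunc_quot_def Suc_le_eq elim!: dvdE)

lemma no_torsion_trunc_quot:
  "truncation_set S \<Longrightarrow> no_torsion S T \<Longrightarrow> no_torsion (trunc_quot S n) T"
  using trunc_quot_subset[of S n] unfolding no_torsion_def by blast

text \<open>The sum \<open>\<Sum>\<^sub>n V\<^sub>n\<langle>a\<^sub>n\<rangle>\<close>. Its value at \<open>\<nu>\<close> only involves \<open>a\<^sub>n\<close> for the divisors \<open>n\<close> of \<open>\<nu>\<close>, so the values
  on a truncation set \<open>S\<close> only depend on the restriction of \<open>a\<close> to \<open>S\<close>. Summing up to \<open>\<nu>\<close> instead of
  over the divisors keeps the index set uniform; the additional terms vanish.\<close>

definition ghost :: "(nat \<Rightarrow> 'a::comm_ring) \<Rightarrow> nat \<Rightarrow> 'a" where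
  "ghost a \<nu> = (\<Sum>n=1..\<nu>. Ver_pow n (a n) \<nu>)"

lemma ghost_eq_sum: "\<nu> \<le> N \<Longrightarrow> ghost a \<nu> = (\<Sum>n=1..N. Ver_pow n (a n) \<nu>)"
  unfolding ghost_def
  by (rule sum.mono_neutral_left) (auto simp: Ver_pow_def dest: dvd_imp_le)

lemma ghost_cong: "(\<And>n. n dvd \<nu> \<Longrightarrow> 0 < n \<Longrightarrow> n \<le> \<nu> \<Longrightarrow> a n = b n) \<Longrightarrow> ghost a \<nu> = ghost b \<nu>"
  unfolding ghost_def by (rule sum.cong) (auto simp: Ver_pow_def)

lemma Ver_pow_zero [simp]: "Ver_pow n 0 \<nu> = 0"
  by (simp add: Ver_pow_def)

lemma ghost_single: "0 < n \<Longrightarrow> ghost (\<lambda>k. if k = n then c else 0) \<nu> = Ver_pow n c \<nu>"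
proof -
  assume n: "0 < n"
  have "ghost (\<lambda>k. if k = n then c else 0) \<nu> =
      (\<Sum>k=1..\<nu> + n. Ver_pow k (if k = n then c else 0) \<nu>)"
    by (rule ghost_eq_sum) simp
  also have "\<dots> = (\<Sum>k=1..\<nu> + n. if k = n then Ver_pow n c \<nu> else 0)"
    by (rule sum.cong) auto
  also have "\<dots> = Ver_pow n c \<nu>"
    using n by (subst sum.delta) auto
  finally show ?thesis .
qed

lemma ghost_zero: "ghost (\<lambda>_. 0) \<nu> = 0"
  by (simp add: ghost_def)

text \<open>The \<open>\<nu>\<close>-th component is \<open>\<nu> a\<^sub>\<nu>\<close> plus terms in \<open>a\<^sub>n\<close> for proper divisors \<open>n\<close> of \<open>\<nu>\<close>, so the
  coefficients can be recovered one after the other when there is no torsion.\<close>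

lemma ghost_inj:
  fixes a b :: "nat \<Rightarrow> 'a::comm_ring"
  assumes S: "truncation_set S" and tf: "no_torsion S TYPE('a)"
    and eq: "\<And>\<nu>. \<nu> \<in> S \<Longrightarrow> \<nu> \<le> N \<Longrightarrow> ghost a \<nu> = ghost b \<nu>"
  shows "\<nu> \<in> S \<Longrightarrow> \<nu> \<le> N \<Longrightarrow> a \<nu> = b \<nu>"
proof (induction \<nu> rule: less_induct)
  case (less \<nu>)
  have pos: "0 < \<nu>" using S less.prems by (simp add: truncation_set_pos)
  have split: "ghost f \<nu> = (\<Sum>n=1..<\<nu>. Ver_pow n (f n) \<nu>) + nat_multiple \<nu> (f \<nu>)"
    for f :: "nat \<Rightarrow> 'a"
  proof -
    have "{1..\<nu>} = insert \<nu> {1..<\<nu>}" using pos by auto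
    then show ?thesis using pos by (simp add: ghost_def Ver_pow_def add.commute)
  qed
  have "Ver_pow n (a n) \<nu> = Ver_pow n (b n) \<nu>" if "n < \<nu>" for n
    using less.IH[OF that] truncation_set_dvd[OF S less.prems(1)] that less.prems(2)
    by (cases "n dvd \<nu>") (auto simp: Ver_pow_def)
  then have "(\<Sum>n=1..<\<nu>. Ver_pow n (a n) \<nu>) = (\<Sum>n=1..<\<nu>. Ver_pow n (b n) \<nu>)"
    by (intro sum.cong) auto
  then have "nat_multiple \<nu> (a \<nu> - b \<nu>) = 0"
    using eq[OF less.prems] by (simp add: split nat_multiple_diff)
  then show ?case
    using tf less.prems unfolding no_torsion_def by (metis eq_iff_diff_eq_0)
qed

definition ghost_image :: "nat set \<Rightarrow> 'a::comm_ring set \<Rightarrow> (nat \<Rightarrow> 'a) set" where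
  "ghost_image S B = {x. \<exists>c. (\<forall>n. c n \<in> B) \<and> (\<forall>\<nu>\<in>S. x \<nu> = ghost c \<nu>)}"

lemma ghost_imageE:
  assumes "x \<in> ghost_image S B"
  obtains c where "\<forall>n. c n \<in> B" "\<forall>\<nu>\<in>S. x \<nu> = ghost c \<nu>"
  using assms unfolding ghost_image_def mem_Collect_eq by (elim exE conjE) (rule that)

text \<open>The coefficients outside \<open>S\<close> may be replaced by \<open>0\<close>, which lies in \<open>B\<close>.\<close>

lemma ghost_in_ghost_image:
  assumes "truncation_set S" "subrng B" "\<And>n. n \<in> S \<Longrightarrow> a n \<in> B" "\<And>\<nu>. \<nu> \<in> S \<Longrightarrow> x \<nu> = ghost a \<nu>"
  shows "x \<in> ghost_image S B"
proof -
  have "ghost (\<lambda>n. if n \<in> S then a n else 0) \<nu> = ghost a \<nu>" if "\<nu> \<in> S" for \<nu>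
    using truncation_set_dvd[OF assms(1) that] by (intro ghost_cong) auto
  then show ?thesis
    using assms by (auto simp: ghost_image_def subrng_zero
        intro!: exI[of _ "\<lambda>n. if n \<in> S then a n else 0"])
qed

lemma ghost_image_coeffs:
  fixes B :: "'a::comm_ring set"
  assumes S: "truncation_set S" and tf: "no_torsion S TYPE('a)"
    and x: "x \<in> ghost_image S B" and eq: "\<And>\<nu>. \<nu> \<in> S \<Longrightarrow> x \<nu> = ghost c \<nu>"
  shows "n \<in> S \<Longrightarrow> c n \<in> B"
proof -
  assume n: "n \<in> S"
  obtain d where d: "\<forall>n. d n \<in> B" "\<forall>\<nu>\<in>S. x \<nu> = ghost d \<nu>"
    using ghost_imageE[OF x] .
  have "c n = d n"
    by (rule ghost_inj[OF S tf, where N = n]) (use d eq n in auto)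
  then show ?thesis using d by simp
qed

lemma log_derivs_ghost_sum:
  assumes "subrng B" "\<And>n. a n \<in> B"
  shows "(\<lambda>\<nu>. \<Sum>n=1..N. Ver_pow n (a n) \<nu>) \<in> log_derivs B"
  using assms by (intro log_derivs_sum Ver_pow_in_log_derivs) auto

lemma ghost_image_approx:
  assumes B: "subrng B" and x: "x \<in> ghost_image S B"
  obtains y where "y \<in> log_derivs B" "\<forall>\<nu>\<in>S. \<nu> \<le> N \<longrightarrow> x \<nu> = y \<nu>"
proof -
  obtain c where c: "\<forall>n. c n \<in> B" "\<forall>\<nu>\<in>S. x \<nu> = ghost c \<nu>"
    using ghost_imageE[OF x] .
  show thesis
    using c by (intro that[OF log_derivs_ghost_sum[OF B, of c N]]) (simp_all add: ghost_eq_sum)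
qed

text \<open>Near a limit point the coefficients can be computed from a sufficiently good approximation, and by
  \<open>ghost_inj\<close> the result does not depend on the approximation. So the coefficients up to \<open>N\<close>
  stabilise, and the diagonal sequence is the one sought.\<close>

lemma ghost_image_limit:
  fixes B :: "'a::comm_ring set"
  assumes S: "truncation_set S" and tf: "no_torsion S TYPE('a)" and B: "subrng B"
    and approx: "\<And>N. \<exists>y\<in>log_derivs B. \<forall>\<nu>\<in>S. \<nu> \<le> N \<longrightarrow> x \<nu> = y \<nu>"
  shows "x \<in> ghost_image S B"
proof -
  have "\<exists>c. (\<forall>n. c n \<in> B) \<and> (\<forall>\<nu>\<in>S. \<nu> \<le> N \<longrightarrow> x \<nu> = ghost c \<nu>)" for N
  proof -
    obtain y where y: "y \<in> log_derivs B" "\<forall>\<nu>\<in>S. \<nu> \<le> N \<longrightarrow> x \<nu> = y \<nu>"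
      using approx by blast
    obtain c where "\<And>n. c n \<in> B" "\<And>\<nu>. \<nu> \<le> N \<Longrightarrow> y \<nu> = (\<Sum>n=1..N. Ver_pow n (c n) \<nu>)"
      using log_derivs_factor[OF B y(1)] by blast
    then show ?thesis
      using y(2) by (intro exI[of _ c]) (simp add: ghost_eq_sum[of _ N])
  qed
  then obtain C where CB: "\<And>N n. C N n \<in> B"
    and C: "\<And>N \<nu>. \<nu> \<in> S \<Longrightarrow> \<nu> \<le> N \<Longrightarrow> x \<nu> = ghost (C N) \<nu>"
    by metis
  have "x \<nu> = ghost (\<lambda>n. C n n) \<nu>" if \<nu>: "\<nu> \<in> S" for \<nu>
  proof -
    have "ghost (C \<nu>) \<nu> = ghost (\<lambda>n. C n n) \<nu>"
    proof (rule ghost_cong)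
      fix n assume n: "n dvd \<nu>" "n \<le> \<nu>"
      show "C \<nu> n = C n n"
        by (rule ghost_inj[OF S tf, where N = n])
          (use n truncation_set_dvd[OF S \<nu>] in \<open>simp_all flip: C\<close>)
    qed
    then show ?thesis using C[OF \<nu> order_refl] by simp
  qed
  then show ?thesis
    using CB unfolding ghost_image_def mem_Collect_eq by (intro exI[of _ "\<lambda>n. C n n"]) simp
qed

text \<open>With \<open>g\<close> the greatest common divisor and \<open>l\<close> the least common multiple of \<open>n\<close> and \<open>m\<close>, one has
  \<open>V\<^sub>n\<langle>a\<rangle> V\<^sub>m\<langle>b\<rangle> = g V\<^sub>l\<langle>a\<^bsup>l/n\<^esup> b\<^bsup>l/m\<^esup>\<rangle>\<close>: both factors are nonzero at \<open>\<nu>\<close> only if \<open>l\<close> divides \<open>\<nu>\<close>, and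
  \<open>n m = g l\<close>.\<close>

lemma Ver_pow_mult:
  assumes n: "0 < n" and m: "0 < m"
  shows "Ver_pow n a \<nu> * Ver_pow m b \<nu> =
    nat_multiple (gcd n m) (Ver_pow (lcm n m) (pos_power a (lcm n m div n) * pos_power b (lcm n m div m)) \<nu>)"
proof (cases "0 < \<nu> \<and> lcm n m dvd \<nu>")
  case False
  then have "\<nu> = 0 \<or> \<not> (n dvd \<nu> \<and> m dvd \<nu>)" by (metis lcm_least neq0_conv)
  then show ?thesis using False by (auto simp: Ver_pow_def)
next
  case True
  define l where "l = lcm n m"
  have "l dvd \<nu>" using True by (simp only: l_def)
  then obtain k where k: "\<nu> = l * k" by (elim dvdE)
  have "n dvd l" "m dvd l" by (simp_all add: l_def)
  then obtain p q where pq: "l = n * p" "l = m * q" by (elim dvdE) (rule that)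
  have l: "0 < l" using n m by (simp add: l_def lcm_pos_nat)
  have "k \<noteq> 0" "p \<noteq> 0" "q \<noteq> 0"
    using True k l pq by (metis mult_0_right less_irrefl)+
  then have pos: "0 < k" "0 < p" "0 < q" by simp_all
  have power: "pos_power a (p * k) * pos_power b (q * k) = pos_power (pos_power a p * pos_power b q) k"
    using pos by (simp add: pos_power_mult pos_power_mult_distrib)
  have "\<nu> = n * (p * k)" "\<nu> = m * (q * k)"
    using k pq(1) by (simp, use k pq(2) in simp)
  then have div: "\<nu> div n = p * k" "\<nu> div m = q * k" "n dvd \<nu>" "m dvd \<nu>"
    using n m by (metis nonzero_mult_div_cancel_left dvd_triv_left neq0_conv)+
  have div': "l div n = p" "l div m = q"
    using pq n m by (metis nonzero_mult_div_cancel_left neq0_conv)+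
  have "Ver_pow n a \<nu> * Ver_pow m b \<nu> =
      nat_multiple n (pos_power a (p * k)) * nat_multiple m (pos_power b (q * k))"
    using True div by (simp add: Ver_pow_def)
  also have "\<dots> = nat_multiple (gcd n m * l) (pos_power (pos_power a p * pos_power b q) k)"
    unfolding nat_multiple_mult_left nat_multiple_mult_right nat_multiple_nat_multiple power
    by (simp add: l_def mult.commute)
  also have "\<dots> = nat_multiple (gcd n m) (Ver_pow l (pos_power a p * pos_power b q) \<nu>)"
    using k l pos by (simp add: Ver_pow_def nat_multiple_nat_multiple)
  finally show ?thesis
    unfolding l_def[symmetric] div' .
qed

text \<open>With \<open>g\<close> the greatest common divisor, \<open>F\<^sub>n V\<^sub>m\<langle>c\<rangle> = g V\<^bsub>m/g\<^esub>\<langle>c\<^bsup>n/g\<^esup>\<rangle>\<close>, because \<open>m\<close> divides \<open>\<nu> n\<close> exactly if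
  \<open>m/g\<close> divides \<open>\<nu>\<close>.\<close>

lemma Ver_pow_Fro:
  assumes n: "0 < n" and m: "0 < m"
  shows "Ver_pow m c (\<nu> * n) =
    nat_multiple (gcd m n) (Ver_pow (m div gcd m n) (pos_power c (n div gcd m n)) \<nu>)"
proof -
  define g where "g = gcd m n"
  have g: "0 < g" using n by (simp add: g_def)
  have "g dvd m" "g dvd n" by (simp_all add: g_def)
  then obtain p q where pq: "m = g * p" "n = g * q" by (elim dvdE) (rule that)
  have pos: "0 < p" "0 < q" using pq n m by (metis mult_0_right neq0_conv)+
  have "gcd (g * p) (g * q) = g" by (metis g_def pq)
  then have "g * gcd p q = g" by (simp add: gcd_mult_distrib_nat)
  then have "coprime p q" using g by (simp add: coprime_iff_gcd_eq_1)
  then have dvd: "m dvd \<nu> * n \<longleftrightarrow> p dvd \<nu>"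
    using g by (simp add: pq mult.left_commute[of _ g] coprime_dvd_mult_left_iff)
  show ?thesis
  proof (cases "0 < \<nu> \<and> p dvd \<nu>")
    case False
    moreover have "m div g = p" using g pq by simp
    ultimately show ?thesis using dvd g unfolding g_def[symmetric] by (auto simp: Ver_pow_def)
  next
    case True
    then obtain k where k: "\<nu> = p * k" by auto
    then have "0 < k" using True by (auto intro: gr0I)
    moreover have "\<nu> * n div m = q * k" using k pq g pos by (simp add: mult_ac)
    moreover have "m div g = p" "n div g = q" "\<nu> div p = k" using k pq g pos by auto
    ultimately show ?thesis
      using True dvd n pos unfolding g_def[symmetric]
      by (simp add: Ver_pow_def nat_multiple_nat_multiple pos_power_mult pq(1)[symmetric])
  qed
qed

lemma Ver_pow_Ver:
  assumes "0 < n" "0 < j"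
  shows "Ver_pow (n * j) c \<nu> = (if n dvd \<nu> then nat_multiple n (Ver_pow j c (\<nu> div n)) else 0)"
proof (cases "n dvd \<nu>")
  case True
  then obtain k where "\<nu> = n * k" by auto
  then show ?thesis using assms by (auto simp: Ver_pow_def nat_multiple_nat_multiple)
next
  case False
  then show ?thesis by (auto simp: Ver_pow_def dest: dvd_mult_left)
qed

context
  fixes S :: "nat set" and B :: "'a::comm_ring set"
  assumes S: "truncation_set S" and tf: "no_torsion S TYPE('a)" and B: "subrng B"
begin

lemma ghost_image_add:
  assumes x: "x \<in> ghost_image S B" and y: "y \<in> ghost_image S B"
  shows "(\<lambda>\<nu>. x \<nu> + y \<nu>) \<in> ghost_image S B"
proof (rule ghost_image_limit[OF S tf B])
  fix N
  obtain x' where x': "x' \<in> log_derivs B" "\<forall>\<nu>\<in>S. \<nu> \<le> N \<longrightarrow> x \<nu> = x' \<nu>"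
    using ghost_image_approx[OF B x, where N = N] .
  obtain y' where y': "y' \<in> log_derivs B" "\<forall>\<nu>\<in>S. \<nu> \<le> N \<longrightarrow> y \<nu> = y' \<nu>"
    using ghost_image_approx[OF B y, where N = N] .
  show "\<exists>z\<in>log_derivs B. \<forall>\<nu>\<in>S. \<nu> \<le> N \<longrightarrow> x \<nu> + y \<nu> = z \<nu>"
    using x'(2) y'(2) by (intro bexI[OF _ log_derivs_add[OF B x'(1) y'(1)]]) simp
qed

lemma ghost_image_diff:
  assumes x: "x \<in> ghost_image S B" and y: "y \<in> ghost_image S B"
  shows "(\<lambda>\<nu>. x \<nu> - y \<nu>) \<in> ghost_image S B"
proof (rule ghost_image_limit[OF S tf B])
  fix N
  obtain x' where x': "x' \<in> log_derivs B" "\<forall>\<nu>\<in>S. \<nu> \<le> N \<longrightarrow> x \<nu> = x' \<nu>"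
    using ghost_image_approx[OF B x, where N = N] .
  obtain y' where y': "y' \<in> log_derivs B" "\<forall>\<nu>\<in>S. \<nu> \<le> N \<longrightarrow> y \<nu> = y' \<nu>"
    using ghost_image_approx[OF B y, where N = N] .
  show "\<exists>z\<in>log_derivs B. \<forall>\<nu>\<in>S. \<nu> \<le> N \<longrightarrow> x \<nu> - y \<nu> = z \<nu>"
    using x'(2) y'(2) by (intro bexI[OF _ log_derivs_diff[OF B x'(1) y'(1)]]) simp
qed

text \<open>Up to the index \<open>N\<close> the product is a finite sum of products of generators, each of which is a
  multiple of a generator.\<close>

lemma ghost_image_mult:
  assumes x: "x \<in> ghost_image S B" and y: "y \<in> ghost_image S B"
  shows "(\<lambda>\<nu>. x \<nu> * y \<nu>) \<in> ghost_image S B"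
proof (rule ghost_image_limit[OF S tf B])
  fix N
  obtain a where a: "\<forall>n. a n \<in> B" "\<forall>\<nu>\<in>S. x \<nu> = ghost a \<nu>"
    using ghost_imageE[OF x] .
  obtain b where b: "\<forall>n. b n \<in> B" "\<forall>\<nu>\<in>S. y \<nu> = ghost b \<nu>"
    using ghost_imageE[OF y] .
  let ?z = "\<lambda>\<nu>. \<Sum>n=1..N. \<Sum>m=1..N. Ver_pow n (a n) \<nu> * Ver_pow m (b m) \<nu>"
  have "(\<lambda>\<nu>. Ver_pow n (a n) \<nu> * Ver_pow m (b m) \<nu>) \<in> log_derivs B" if "0 < n" "0 < m" for n m
    unfolding Ver_pow_mult[OF that]
    by (rule log_derivs_nat_multiple[OF B Ver_pow_in_log_derivs[OF B]])
      (use that a b in \<open>simp_all add: subrng_mult[OF B] subrng_pos_power[OF B] lcm_pos_nat\<close>)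
  then have "?z \<in> log_derivs B"
    by (intro log_derivs_sum[OF B]) auto
  moreover have "x \<nu> * y \<nu> = ?z \<nu>" if "\<nu> \<in> S" "\<nu> \<le> N" for \<nu>
    using that by (simp add: a b ghost_eq_sum[of _ N] sum_product)
  ultimately show "\<exists>z\<in>log_derivs B. \<forall>\<nu>\<in>S. \<nu> \<le> N \<longrightarrow> x \<nu> * y \<nu> = z \<nu>"
    by (intro bexI[of _ ?z]) simp_all
qed

lemma ghost_image_Fro:
  assumes n: "n \<in> S" and x: "x \<in> ghost_image S B"
  shows "(\<lambda>\<nu>. x (\<nu> * n)) \<in> ghost_image (trunc_quot S n) B"
proof (rule ghost_image_limit[OF truncation_set_trunc_quot[OF S n] no_torsion_trunc_quot[OF S tf] B])
  fix N
  obtain a where a: "\<forall>n. a n \<in> B" "\<forall>\<nu>\<in>S. x \<nu> = ghost a \<nu>"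
    using ghost_imageE[OF x] .
  have n0: "0 < n" using S n by (rule truncation_set_pos)
  let ?z = "\<lambda>\<nu>. \<Sum>m=1..N * n. Ver_pow m (a m) (\<nu> * n)"
  have "(\<lambda>\<nu>. Ver_pow m (a m) (\<nu> * n)) \<in> log_derivs B" if m: "0 < m" for m
    unfolding Ver_pow_Fro[OF n0 m]
    by (rule log_derivs_nat_multiple[OF B Ver_pow_in_log_derivs[OF B]])
      (use m n0 a in \<open>simp_all add: subrng_pos_power[OF B] div_greater_zero_iff gcd_le1_nat\<close>)
  then have "?z \<in> log_derivs B"
    by (intro log_derivs_sum[OF B]) auto
  moreover have "x (\<nu> * n) = ?z \<nu>" if "\<nu> \<in> trunc_quot S n" "\<nu> \<le> N" for \<nu>
    using that bspec[OF a(2), of "\<nu> * n"] ghost_eq_sum[of "\<nu> * n" "N * n" a] by (simp add: trunc_quot_def)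
  ultimately show "\<exists>z\<in>log_derivs B. \<forall>\<nu>\<in>trunc_quot S n. \<nu> \<le> N \<longrightarrow> x (\<nu> * n) = z \<nu>"
    by (intro bexI[of _ ?z]) simp_all
qed

lemma ghost_image_Ver:
  assumes n: "n \<in> S" and x: "x \<in> ghost_image (trunc_quot S n) B"
  shows "(\<lambda>\<nu>. nat_multiple n (if n dvd \<nu> then x (\<nu> div n) else 0)) \<in> ghost_image S B"
proof (rule ghost_image_limit[OF S tf B])
  fix N
  obtain a where a: "\<forall>n. a n \<in> B" "\<forall>\<nu>\<in>trunc_quot S n. x \<nu> = ghost a \<nu>"
    using ghost_imageE[OF x] .
  have n0: "0 < n" using S n by (rule truncation_set_pos)
  let ?z = "\<lambda>\<nu>. \<Sum>j=1..N. Ver_pow (n * j) (a j) \<nu>"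
  have "?z \<in> log_derivs B"
    using n0 a by (intro log_derivs_sum[OF B] Ver_pow_in_log_derivs[OF B]) auto
  moreover have "nat_multiple n (if n dvd \<nu> then x (\<nu> div n) else 0) = ?z \<nu>"
    if "\<nu> \<in> S" "\<nu> \<le> N" for \<nu>
  proof -
    have "\<nu> div n \<le> N" using that(2) div_le_dividend le_trans by blast
    then have "x (\<nu> div n) = (\<Sum>j=1..N. Ver_pow j (a j) (\<nu> div n))" if "n dvd \<nu>"
      using that a(2) div_in_trunc_quot[OF S \<open>\<nu> \<in> S\<close>] by (simp add: ghost_eq_sum[of _ N])
    then show ?thesis
      using n0 by (simp add: Ver_pow_Ver nat_multiple_sum)
  qed
  ultimately show "\<exists>z\<in>log_derivs B. \<forall>\<nu>\<in>S. \<nu> \<le> N \<longrightarrow>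
      nat_multiple n (if n dvd \<nu> then x (\<nu> div n) else 0) = z \<nu>"
    by (intro bexI[of _ ?z]) simp_all
qed

end

lemma ghost_in_UNIV: "truncation_set S \<Longrightarrow> ghost a \<in> ghost_image S UNIV"
  by (rule ghost_in_ghost_image[OF _ subrng_UNIV, of _ a]) simp_all

text \<open>Applied to sums, products, \<open>F\<^sub>n\<close> and \<open>V\<^sub>n\<close>, this supplies the coefficients of the result.\<close>

lemma obtain_ghost_coeffs:
  assumes "x \<in> ghost_image S UNIV"
  obtains c where "\<forall>\<nu>\<in>S. ghost c \<nu> = x \<nu>"
proof -
  obtain c where "\<forall>n. c n \<in> UNIV" "\<forall>\<nu>\<in>S. x \<nu> = ghost c \<nu>"
    using ghost_imageE[OF assms] .
  then show thesis by (intro that[of c]) simp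
qed

context
  fixes S :: "nat set" and a b :: "nat \<Rightarrow> 'a::comm_ring"
  assumes S: "truncation_set S" and tf: "no_torsion S TYPE('a)"
begin

lemma obtain_ghost_add:
  obtains c where "\<forall>\<nu>\<in>S. ghost c \<nu> = ghost a \<nu> + ghost b \<nu>"
  using obtain_ghost_coeffs[OF ghost_image_add[OF S tf subrng_UNIV
        ghost_in_UNIV[OF S] ghost_in_UNIV[OF S]]] .

lemma obtain_ghost_diff:
  obtains c where "\<forall>\<nu>\<in>S. ghost c \<nu> = ghost a \<nu> - ghost b \<nu>"
  using obtain_ghost_coeffs[OF ghost_image_diff[OF S tf subrng_UNIV
        ghost_in_UNIV[OF S] ghost_in_UNIV[OF S]]] .

lemma obtain_ghost_mult:
  obtains c where "\<forall>\<nu>\<in>S. ghost c \<nu> = ghost a \<nu> * ghost b \<nu>"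
  using obtain_ghost_coeffs[OF ghost_image_mult[OF S tf subrng_UNIV
        ghost_in_UNIV[OF S] ghost_in_UNIV[OF S]]] .

lemma obtain_ghost_Fro:
  assumes n: "n \<in> S"
  obtains c where "\<forall>\<nu>\<in>trunc_quot S n. ghost c \<nu> = ghost a (\<nu> * n)"
  using obtain_ghost_coeffs[OF ghost_image_Fro[OF S tf subrng_UNIV n ghost_in_UNIV[OF S]]] .

lemma obtain_ghost_Ver:
  assumes n: "n \<in> S"
  obtains c where
    "\<forall>\<nu>\<in>S. ghost c \<nu> = nat_multiple n (if n dvd \<nu> then ghost a (\<nu> div n) else 0)"
  using obtain_ghost_coeffs[OF ghost_image_Ver[OF S tf subrng_UNIV n
        ghost_in_UNIV[OF truncation_set_trunc_quot[OF S n]]]] .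

end

section \<open>The topology of \<open>A\<^sup>S\<close> and the groups \<open>X\<^sub>S(B)\<close>\<close>

lemma topspace_seq_topology [simp]: "topspace (seq_topology S) = seqs S"
  by (simp add: seq_topology_def)

text \<open>The sequences that agree with \<open>x\<close> on \<open>S \<inter> {..N}\<close> form a neighbourhood basis of \<open>x\<close>: finitely many
  prescribed coordinates have a largest index.\<close>

lemma openin_seq_topology:
  "openin (seq_topology S) U \<longleftrightarrow>
     U \<subseteq> seqs S \<and> (\<forall>x\<in>U. \<exists>N. \<forall>y\<in>seqs S. (\<forall>\<nu>\<in>S. \<nu> \<le> N \<longrightarrow> y \<nu> = x \<nu>) \<longrightarrow> y \<in> U)"
proof (intro iffI conjI ballI)
  assume U: "openin (seq_topology S) U"
  then show "U \<subseteq> seqs S"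
    using openin_subset by fastforce
  fix x assume "x \<in> U"
  then obtain W where W: "finite {i \<in> S. W i \<noteq> UNIV}" "x \<in> Pi\<^sub>E S W" "Pi\<^sub>E S W \<subseteq> U"
    using U unfolding seq_topology_def openin_product_topology_alt by force
  obtain N where N: "\<forall>i\<in>{i \<in> S. W i \<noteq> UNIV}. i \<le> N"
    using W(1) unfolding finite_nat_set_iff_bounded_le by (elim exE) (rule that)
  have "y \<in> Pi\<^sub>E S W" if y: "y \<in> seqs S" "\<And>\<nu>. \<nu> \<in> S \<Longrightarrow> \<nu> \<le> N \<Longrightarrow> y \<nu> = x \<nu>" for y
  proof (rule PiE_I)
    fix \<nu> assume \<nu>: "\<nu> \<in> S"
    show "y \<nu> \<in> W \<nu>"
    proof (cases "W \<nu> = UNIV")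
      case False
      then show ?thesis using y(2)[OF \<nu>] N \<nu> W(2) by (auto simp: PiE_iff)
    qed simp
  qed (use y in \<open>auto simp: PiE_iff extensional_def\<close>)
  then have "\<forall>y\<in>seqs S. (\<forall>\<nu>\<in>S. \<nu> \<le> N \<longrightarrow> y \<nu> = x \<nu>) \<longrightarrow> y \<in> U"
    by (intro ballI impI subsetD[OF W(3)]) simp
  then show "\<exists>N. \<forall>y\<in>seqs S. (\<forall>\<nu>\<in>S. \<nu> \<le> N \<longrightarrow> y \<nu> = x \<nu>) \<longrightarrow> y \<in> U"
    by (rule exI)
next
  assume R: "U \<subseteq> seqs S \<and>
    (\<forall>x\<in>U. \<exists>N. \<forall>y\<in>seqs S. (\<forall>\<nu>\<in>S. \<nu> \<le> N \<longrightarrow> y \<nu> = x \<nu>) \<longrightarrow> y \<in> U)"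
  show "openin (seq_topology S) U"
    unfolding seq_topology_def openin_product_topology_alt
  proof
    fix x assume x: "x \<in> U"
    obtain N where N: "\<forall>y\<in>seqs S. (\<forall>\<nu>\<in>S. \<nu> \<le> N \<longrightarrow> y \<nu> = x \<nu>) \<longrightarrow> y \<in> U"
      using bspec[OF conjunct2[OF R] x] by (elim exE) (rule that)
    let ?W = "\<lambda>i. if i \<le> N then {x i} else UNIV"
    have "finite {i \<in> S. ?W i \<noteq> UNIV}"
      by (rule finite_subset[of _ "{..N}"]) auto
    moreover have "x \<in> Pi\<^sub>E S ?W" using x R by (auto simp: PiE_iff)
    moreover have "Pi\<^sub>E S ?W \<subseteq> U"
    proof
      fix y assume y: "y \<in> Pi\<^sub>E S ?W"
      then have "y \<nu> = x \<nu>" if "\<nu> \<in> S" "\<nu> \<le> N" for \<nu>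
        using PiE_mem[OF y that(1)] that(2) by simp
      moreover have "y \<in> seqs S" using y by (simp add: PiE_iff)
      ultimately show "y \<in> U" using N by simp
    qed
    ultimately show "\<exists>W. finite {i \<in> S. W i \<noteq> topspace (discrete_topology UNIV)} \<and>
        (\<forall>i\<in>S. openin (discrete_topology UNIV) (W i)) \<and> x \<in> Pi\<^sub>E S W \<and> Pi\<^sub>E S W \<subseteq> U"
      unfolding topspace_discrete_topology openin_discrete_topology
      by (intro exI[of _ ?W] conjI ballI subset_UNIV)
  qed
qed

lemma openin_subtopology_seq_topology:
  assumes X: "X \<subseteq> seqs S"
  shows "openin (subtopology (seq_topology S) X) V \<longleftrightarrow>
    V \<subseteq> X \<and> (\<forall>x\<in>V. \<exists>N. \<forall>y\<in>X. (\<forall>\<nu>\<in>S. \<nu> \<le> N \<longrightarrow> y \<nu> = x \<nu>) \<longrightarrow> y \<in> V)"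
proof
  assume "openin (subtopology (seq_topology S) X) V"
  then obtain T where T: "openin (seq_topology S) T" "V = T \<inter> X"
    unfolding openin_subtopology by (elim exE conjE) (rule that)
  have "\<exists>N. \<forall>y\<in>X. (\<forall>\<nu>\<in>S. \<nu> \<le> N \<longrightarrow> y \<nu> = x \<nu>) \<longrightarrow> y \<in> V" if "x \<in> V" for x
  proof -
    have xT: "x \<in> T" using that T(2) by simp
    have "\<forall>x\<in>T. \<exists>N. \<forall>y\<in>seqs S. (\<forall>\<nu>\<in>S. \<nu> \<le> N \<longrightarrow> y \<nu> = x \<nu>) \<longrightarrow> y \<in> T"
      using T(1) unfolding openin_seq_topology by (rule conjunct2)
    then obtain N where N: "\<forall>y\<in>seqs S. (\<forall>\<nu>\<in>S. \<nu> \<le> N \<longrightarrow> y \<nu> = x \<nu>) \<longrightarrow> y \<in> T"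
      by (rule exE[OF bspec[OF _ xT]])
    have "\<forall>y\<in>X. (\<forall>\<nu>\<in>S. \<nu> \<le> N \<longrightarrow> y \<nu> = x \<nu>) \<longrightarrow> y \<in> V"
    proof (intro ballI impI)
      fix y assume "y \<in> X" "\<forall>\<nu>\<in>S. \<nu> \<le> N \<longrightarrow> y \<nu> = x \<nu>"
      then show "y \<in> V" using bspec[OF N subsetD[OF X]] T(2) by simp
    qed
    then show ?thesis by (rule exI)
  qed
  then show "V \<subseteq> X \<and> (\<forall>x\<in>V. \<exists>N. \<forall>y\<in>X. (\<forall>\<nu>\<in>S. \<nu> \<le> N \<longrightarrow> y \<nu> = x \<nu>) \<longrightarrow> y \<in> V)"
    using T(2) by simp
next
  assume R: "V \<subseteq> X \<and> (\<forall>x\<in>V. \<exists>N. \<forall>y\<in>X. (\<forall>\<nu>\<in>S. \<nu> \<le> N \<longrightarrow> y \<nu> = x \<nu>) \<longrightarrow> y \<in> V)"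
  obtain N where N: "\<forall>x\<in>V. \<forall>y\<in>X. (\<forall>\<nu>\<in>S. \<nu> \<le> N x \<longrightarrow> y \<nu> = x \<nu>) \<longrightarrow> y \<in> V"
    using bchoice[OF conjunct2[OF R]] by (elim exE) (rule that)
  \<comment> \<open>The union of the basic neighbourhoods in \<open>A\<^sup>S\<close> of the points of \<open>V\<close>.\<close>
  define T where "T = {y \<in> seqs S. \<exists>x\<in>V. \<forall>\<nu>\<in>S. \<nu> \<le> N x \<longrightarrow> y \<nu> = x \<nu>}"
  have "openin (seq_topology S) T"
    unfolding openin_seq_topology
  proof (intro conjI ballI)
    show "T \<subseteq> seqs S" unfolding T_def by (rule Collect_restrict)
    fix y assume "y \<in> T"
    then obtain x where x: "x \<in> V" "\<forall>\<nu>\<in>S. \<nu> \<le> N x \<longrightarrow> y \<nu> = x \<nu>"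
      unfolding T_def by (elim CollectE conjE bexE) (rule that)
    have "z \<in> T" if "z \<in> seqs S" "\<forall>\<nu>\<in>S. \<nu> \<le> N x \<longrightarrow> z \<nu> = y \<nu>" for z
      unfolding T_def using that x by (intro CollectI conjI bexI[of _ x]) simp_all
    then show "\<exists>N. \<forall>z\<in>seqs S. (\<forall>\<nu>\<in>S. \<nu> \<le> N \<longrightarrow> z \<nu> = y \<nu>) \<longrightarrow> z \<in> T"
      by (intro exI[of _ "N x"] ballI impI)
  qed
  moreover have "V = T \<inter> X"
  proof (intro subset_antisym subsetI IntI)
    fix x assume x: "x \<in> V"
    show "x \<in> X" using conjunct1[OF R] x by (rule subsetD)
    then have "x \<in> seqs S" by (rule subsetD[OF X])
    then show "x \<in> T" unfolding T_def using x by (intro CollectI conjI bexI[of _ x]) simp_all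
  next
    fix y assume y: "y \<in> T \<inter> X"
    obtain x where x: "x \<in> V" "\<forall>\<nu>\<in>S. \<nu> \<le> N x \<longrightarrow> y \<nu> = x \<nu>"
      using IntD1[OF y] unfolding T_def by (elim CollectE conjE bexE) (rule that)
    then show "y \<in> V" using bspec[OF bspec[OF N x(1)] IntD2[OF y]] by simp
  qed
  ultimately show "openin (subtopology (seq_topology S) X) V"
    unfolding openin_subtopology by (intro exI[of _ T] conjI)
qed

definition ghost_seq :: "nat set \<Rightarrow> (nat \<Rightarrow> 'a::comm_ring) \<Rightarrow> nat \<Rightarrow> 'a" where
  "ghost_seq S a = restrict (ghost a) S"

lemma Ver_power_eq:
  assumes S: "truncation_set S"
  shows "Ver_power S n a = restrict (Ver_pow n a) S"
proof
  fix \<nu>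
  show "Ver_power S n a \<nu> = restrict (Ver_pow n a) S \<nu>"
  proof (cases "\<nu> \<in> S")
    case True
    then show ?thesis
      using div_in_trunc_quot[OF S True, of n] truncation_set_pos[OF S True]
      by (cases "n dvd \<nu>") (simp_all add: Ver_power_def Ver_def power_seq_def Ver_pow_def)
  qed (simp add: Ver_power_def Ver_def)
qed

text \<open>A partial sum has its final value at \<open>\<nu>\<close> as soon as its index set contains the divisors of \<open>\<nu>\<close>.\<close>

lemma seq_sums_iff:
  assumes S: "truncation_set S"
  shows "seq_sums S (\<lambda>n. Ver_power S n (a n)) s \<longleftrightarrow> s = ghost_seq S a"
proof -
  let ?F = "finite_subsets_at_top S"
  let ?sum = "\<lambda>N \<nu>. \<Sum>n\<in>N. Ver_power S n (a n) \<nu>"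
  have ev: "eventually (\<lambda>N. ?sum N \<nu> = ghost a \<nu>) ?F" if \<nu>: "\<nu> \<in> S" for \<nu>
    unfolding eventually_finite_subsets_at_top
  proof (intro exI conjI allI impI)
    show "finite (S \<inter> {1..\<nu>})" "S \<inter> {1..\<nu>} \<subseteq> S" by auto
    fix N assume N: "finite N \<and> S \<inter> {1..\<nu>} \<subseteq> N \<and> N \<subseteq> S"
    have "?sum N \<nu> = (\<Sum>n\<in>N. Ver_pow n (a n) \<nu>)"
      using \<nu> S by (simp add: Ver_power_eq)
    also have "\<dots> = (\<Sum>n\<in>N \<union> {1..\<nu>}. Ver_pow n (a n) \<nu>)"
      using N truncation_set_dvd[OF S \<nu>]
      by (intro sum.mono_neutral_left) (auto simp: Ver_pow_def)
    also have "\<dots> = ghost a \<nu>"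
      unfolding ghost_def
      using N truncation_set_pos[OF S] by (intro sum.mono_neutral_right) (force simp: Ver_pow_def dest: dvd_imp_le)+
    finally show "?sum N \<nu> = ghost a \<nu>" .
  qed
  have "limitin (discrete_topology UNIV) (\<lambda>N. (\<lambda>\<nu>\<in>S. ?sum N \<nu>) i) (s i) ?F \<longleftrightarrow> s i = ghost a i"
    if i: "i \<in> S" for i
  proof
    assume "limitin (discrete_topology UNIV) (\<lambda>N. (\<lambda>\<nu>\<in>S. ?sum N \<nu>) i) (s i) ?F"
    then have "eventually (\<lambda>N. ?sum N i \<in> {s i}) ?F"
      using i unfolding limitin_def by (auto elim: allE[of _ "{s i}"])
    with ev[OF i] have "eventually (\<lambda>N. s i = ghost a i) ?F"
      by eventually_elim simp
    then show "s i = ghost a i" by simp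
  next
    assume "s i = ghost a i"
    then show "limitin (discrete_topology UNIV) (\<lambda>N. (\<lambda>\<nu>\<in>S. ?sum N \<nu>) i) (s i) ?F"
      using i ev[OF i] unfolding limitin_def by (auto elim: eventually_mono)
  qed
  then show ?thesis
    unfolding seq_sums_def seq_topology_def limitin_componentwise
    by (auto simp: ghost_seq_def fun_eq_iff restrict_def extensional_def)
qed

lemma seq_subgroup_add:
  assumes "seq_subgroup S T" "x \<in> T" "y \<in> T"
  shows "seq_add S x y \<in> T"
proof -
  have "seq_diff S x (seq_diff S (seq_zero S) y) \<in> T"
    using assms by (simp add: seq_subgroup_def)
  moreover have "seq_diff S x (seq_diff S (seq_zero S) y) = seq_add S x y"
    by (simp add: seq_diff_def seq_zero_def seq_add_def fun_eq_iff)
  ultimately show ?thesis by simp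
qed

text \<open>The sums \<open>\<Sum>\<^sub>n V\<^sub>n\<langle>b\<^sub>n\<rangle>\<close> with \<open>b\<^sub>n \<in> B\<close> form a closed subgroup, by \<open>ghost_image_limit\<close> and
  \<open>ghost_image_diff\<close>. Conversely, a closed subgroup with all \<open>V\<^sub>n\<langle>b\<rangle>\<close> contains their finite sums, and
  therefore the limits of these.\<close>

lemma XS_eq:
  fixes B :: "'a::comm_ring set"
  assumes S: "truncation_set S" and tf: "no_torsion S TYPE('a)" and B: "subrng B"
  shows "XS S B = seqs S \<inter> ghost_image S B"
proof
  let ?H = "seqs S \<inter> ghost_image S B"
  have "closedin (seq_topology S) ?H"
    unfolding closedin_def openin_seq_topology topspace_seq_topology
  proof (intro conjI ballI)
    fix x assume x: "x \<in> seqs S - ?H"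
    then obtain N where N: "\<And>y. y \<in> log_derivs B \<Longrightarrow> \<exists>\<nu>\<in>S. \<nu> \<le> N \<and> x \<nu> \<noteq> y \<nu>"
      using ghost_image_limit[OF S tf B, of x] by blast
    have "y \<notin> ghost_image S B" if y: "\<forall>\<nu>\<in>S. \<nu> \<le> N \<longrightarrow> y \<nu> = x \<nu>" for y
    proof
      assume yB: "y \<in> ghost_image S B"
      obtain z where "z \<in> log_derivs B" "\<forall>\<nu>\<in>S. \<nu> \<le> N \<longrightarrow> y \<nu> = z \<nu>"
        using ghost_image_approx[OF B yB, where N = N] .
      then show False using N y by metis
    qed
    then show "\<exists>N. \<forall>y\<in>seqs S. (\<forall>\<nu>\<in>S. \<nu> \<le> N \<longrightarrow> y \<nu> = x \<nu>) \<longrightarrow> y \<in> seqs S - ?H"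
      by blast
  qed auto
  moreover have "seq_subgroup S ?H"
    unfolding seq_subgroup_def
  proof (intro conjI ballI)
    show "seq_zero S \<in> ?H"
      using ghost_in_ghost_image[OF S B, of "\<lambda>_. 0" "seq_zero S"]
      by (auto simp: seq_zero_def ghost_zero subrng_zero[OF B])
    fix x y assume "x \<in> ?H" "y \<in> ?H"
    then have "(\<lambda>\<nu>. x \<nu> - y \<nu>) \<in> ghost_image S B"
      using ghost_image_diff[OF S tf B] by simp
    then show "seq_diff S x y \<in> ?H"
      by (auto simp: seq_diff_def ghost_image_def)
  qed simp
  moreover have "{Ver_power S n a |n a. n \<in> S \<and> a \<in> B} \<subseteq> ?H"
  proof
    fix x assume "x \<in> {Ver_power S n a |n a. n \<in> S \<and> a \<in> B}"
    then obtain n a where n: "n \<in> S" "a \<in> B" and x: "x = Ver_power S n a" by blast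
    have "Ver_power S n a \<in> seqs S" by (simp add: Ver_power_def Ver_def)
    moreover have "Ver_power S n a \<in> ghost_image S B"
      by (rule ghost_in_ghost_image[OF S B, of "\<lambda>k. if k = n then a else 0"])
        (use n in \<open>auto simp: Ver_power_eq[OF S] ghost_single truncation_set_pos[OF S] subrng_zero[OF B]\<close>)
    ultimately show "x \<in> ?H" by (simp add: x)
  qed
  ultimately show "XS S B \<subseteq> ?H"
    unfolding XS_def by (intro hull_minimal) auto
next
  show "seqs S \<inter> ghost_image S B \<subseteq> XS S B"
    unfolding XS_def hull_def
  proof (intro subsetI InterI)
    fix x T assume x: "x \<in> seqs S \<inter> ghost_image S B"
      and "T \<in> {t. (closedin (seq_topology S) t \<and> seq_subgroup S t) \<and>
          {Ver_power S n a |n a. n \<in> S \<and> a \<in> B} \<subseteq> t}"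
    then have closed: "closedin (seq_topology S) T" and sub: "seq_subgroup S T"
      and gen: "\<And>n a. n \<in> S \<Longrightarrow> a \<in> B \<Longrightarrow> Ver_power S n a \<in> T"
      by auto
    obtain a where a: "\<forall>n. a n \<in> B" "\<forall>\<nu>\<in>S. x \<nu> = ghost a \<nu>"
      using ghost_imageE[OF IntD2[OF x]] .
    have partial: "(\<lambda>\<nu>\<in>S. \<Sum>n=1..N. Ver_pow n (a n) \<nu>) \<in> T" for N
    proof (induction N)
      case 0
      have "(\<lambda>\<nu>\<in>S. \<Sum>n=1..0. Ver_pow n (a n) \<nu>) = seq_zero S"
        by (simp add: seq_zero_def)
      then show ?case using sub by (simp only: seq_subgroup_def)
    next
      case (Suc N)
      show ?case
      proof (cases "Suc N \<in> S")
        case True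
        have "seq_add S (\<lambda>\<nu>\<in>S. \<Sum>n=1..N. Ver_pow n (a n) \<nu>) (Ver_power S (Suc N) (a (Suc N))) \<in> T"
          using Suc gen[OF True spec[OF a(1)]] by (intro seq_subgroup_add[OF sub])
        moreover have "seq_add S (\<lambda>\<nu>\<in>S. \<Sum>n=1..N. Ver_pow n (a n) \<nu>)
            (Ver_power S (Suc N) (a (Suc N))) = (\<lambda>\<nu>\<in>S. \<Sum>n=1..Suc N. Ver_pow n (a n) \<nu>)"
          by (rule ext) (simp add: Ver_power_eq[OF S] seq_add_def)
        ultimately show ?thesis by (simp only:)
      next
        case False
        \<comment> \<open>An index outside \<open>S\<close> divides no element of \<open>S\<close>, so its term vanishes on \<open>S\<close>.\<close>
        then have "Ver_pow (Suc N) (a (Suc N)) \<nu> = 0" if "\<nu> \<in> S" for \<nu>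
          using truncation_set_dvd[OF S that] by (auto simp: Ver_pow_def)
        then have "(\<lambda>\<nu>\<in>S. \<Sum>n=1..Suc N. Ver_pow n (a n) \<nu>) = (\<lambda>\<nu>\<in>S. \<Sum>n=1..N. Ver_pow n (a n) \<nu>)"
          by (intro ext) simp
        then show ?thesis using Suc by (simp only:)
      qed
    qed
    show "x \<in> T"
    proof (rule ccontr)
      assume "x \<notin> T"
      then have xT: "x \<in> seqs S - T" using x by blast
      have "\<forall>x\<in>seqs S - T. \<exists>N. \<forall>y\<in>seqs S.
          (\<forall>\<nu>\<in>S. \<nu> \<le> N \<longrightarrow> y \<nu> = x \<nu>) \<longrightarrow> y \<in> seqs S - T"
        using closed unfolding closedin_def openin_seq_topology topspace_seq_topology by (elim conjE)
      then obtain N where "\<forall>y\<in>seqs S.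
          (\<forall>\<nu>\<in>S. \<nu> \<le> N \<longrightarrow> y \<nu> = x \<nu>) \<longrightarrow> y \<in> seqs S - T"
        by (rule exE[OF bspec[OF _ xT]])
      moreover have "(\<lambda>\<nu>\<in>S. \<Sum>n=1..N. Ver_pow n (a n) \<nu>) \<in> seqs S" by simp
      moreover have "\<forall>\<nu>\<in>S. \<nu> \<le> N \<longrightarrow> (\<lambda>\<nu>\<in>S. \<Sum>n=1..N. Ver_pow n (a n) \<nu>) \<nu> = x \<nu>"
        using a(2) by (simp add: ghost_eq_sum[of _ N])
      ultimately show False
        using partial[of N] by (metis DiffD2)
    qed
  qed
qed

section \<open>Products of rings\<close>

instantiation prod :: (comm_ring, comm_ring) comm_ring
begin

definition times_prod :: "'a \<times> 'b \<Rightarrow> 'a \<times> 'b \<Rightarrow> 'a \<times> 'b" where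
  "times_prod p q = (fst p * fst q, snd p * snd q)"

instance
  by standard (simp_all add: times_prod_def prod_eq_iff algebra_simps)

end

lemma nat_multiple_Pair: "nat_multiple n (x, y) = (nat_multiple n x, nat_multiple n y)"
  by (induction n) (simp_all add: zero_prod_def)

lemma pos_power_Pair: "pos_power (x, y) n = (pos_power x n, pos_power y n)"
proof -
  have "(((*) (x, y)) ^^ k) (x, y) = ((((*) x) ^^ k) x, (((*) y) ^^ k) y)" for k
    by (induction k) (simp_all add: times_prod_def)
  then show ?thesis by (simp add: pos_power_def)
qed

lemma Ver_pow_Pair: "Ver_pow n (x, y) \<nu> = (Ver_pow n x \<nu>, Ver_pow n y \<nu>)"
  by (simp add: Ver_pow_def nat_multiple_Pair pos_power_Pair zero_prod_def)

lemma ghost_Pair: "ghost (\<lambda>n. (a n, b n)) \<nu> = (ghost a \<nu>, ghost b \<nu>)"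
  by (simp add: ghost_def prod_eq_iff fst_sum snd_sum Ver_pow_Pair)

lemma no_torsion_prod:
  assumes "no_torsion S TYPE('a::comm_ring)" "no_torsion S TYPE('b::comm_ring)"
  shows "no_torsion S TYPE('a \<times> 'b)"
  using assms by (simp add: no_torsion_def nat_multiple_Pair zero_prod_def)

section \<open>Fibre products and naturality\<close>

definition fibre_product :: "('a \<Rightarrow> 'r) \<Rightarrow> ('b \<Rightarrow> 'r) \<Rightarrow> ('a \<times> 'b) set" where
  "fibre_product f g = {(x, y). f x = g y}"

lemma subrng_fibre_product:
  assumes "rng_hom f" "rng_hom g"
  shows "subrng (fibre_product f g)"
  using assms by (simp add: subrng_def fibre_product_def zero_prod_def times_prod_def
      rng_hom_zero rng_hom_diff rng_hom_mult split: prod.splits)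

text \<open>The pair \<open>(x, y)\<close>, read as a sequence in the product ring, is a sum of \<open>V\<^sub>n\<langle>p\<^sub>n\<rangle>\<close> with \<open>p\<^sub>n\<close> in the fibre
  product. Since subrings of the product ring are covered by the closure lemmas, this relation is
  preserved by all operations.\<close>

definition ghost_related ::
    "nat set \<Rightarrow> ('a::comm_ring \<Rightarrow> 'r) \<Rightarrow> ('b::comm_ring \<Rightarrow> 'r) \<Rightarrow> (nat \<Rightarrow> 'a) \<Rightarrow> (nat \<Rightarrow> 'b) \<Rightarrow> bool" where
  "ghost_related S f g x y \<longleftrightarrow> (\<lambda>\<nu>. (x \<nu>, y \<nu>)) \<in> ghost_image S (fibre_product f g)"

lemma ghost_related_cong:
  assumes "ghost_related S f g x y" "\<And>\<nu>. \<nu> \<in> S \<Longrightarrow> x \<nu> = x' \<nu>" "\<And>\<nu>. \<nu> \<in> S \<Longrightarrow> y \<nu> = y' \<nu>"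
  shows "ghost_related S f g x' y'"
  using assms unfolding ghost_related_def ghost_image_def by simp

context
  fixes S :: "nat set" and f :: "'a::comm_ring \<Rightarrow> 'r::comm_ring" and g :: "'b::comm_ring \<Rightarrow> 'r"
  assumes S: "truncation_set S"
    and f: "rng_hom f" and tf: "no_torsion S TYPE('a)"
    and g: "rng_hom g" and tg: "no_torsion S TYPE('b)"
begin

text \<open>Uniqueness of coefficients in the product ring turns the relation between sequences into a relation
  between their coefficients.\<close>

lemma ghost_related_ghost_iff:
  "ghost_related S f g (ghost a) (ghost b) \<longleftrightarrow> (\<forall>n\<in>S. f (a n) = g (b n))"
proof
  assume "ghost_related S f g (ghost a) (ghost b)"
  then have "(\<lambda>\<nu>. ghost (\<lambda>n. (a n, b n)) \<nu>) \<in> ghost_image S (fibre_product f g)"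
    by (simp add: ghost_related_def ghost_Pair)
  then have "(a n, b n) \<in> fibre_product f g" if "n \<in> S" for n
    using ghost_image_coeffs[OF S no_torsion_prod[OF tf tg]] that by blast
  then show "\<forall>n\<in>S. f (a n) = g (b n)"
    by (simp add: fibre_product_def)
next
  assume "\<forall>n\<in>S. f (a n) = g (b n)"
  then show "ghost_related S f g (ghost a) (ghost b)"
    unfolding ghost_related_def
    by (intro ghost_in_ghost_image[OF S subrng_fibre_product[OF f g], of "\<lambda>n. (a n, b n)"])
      (simp_all add: fibre_product_def ghost_Pair)
qed

lemmas fibre_product_rng = no_torsion_prod[OF tf tg] subrng_fibre_product[OF f g]

lemma ghost_related_add:
  assumes "ghost_related S f g x x'" "ghost_related S f g y y'"
  shows "ghost_related S f g (\<lambda>\<nu>. x \<nu> + y \<nu>) (\<lambda>\<nu>. x' \<nu> + y' \<nu>)"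
  using ghost_image_add[OF S fibre_product_rng assms[unfolded ghost_related_def]]
  by (simp add: ghost_related_def)

lemma ghost_related_diff:
  assumes "ghost_related S f g x x'" "ghost_related S f g y y'"
  shows "ghost_related S f g (\<lambda>\<nu>. x \<nu> - y \<nu>) (\<lambda>\<nu>. x' \<nu> - y' \<nu>)"
  using ghost_image_diff[OF S fibre_product_rng assms[unfolded ghost_related_def]]
  by (simp add: ghost_related_def)

lemma ghost_related_mult:
  assumes "ghost_related S f g x x'" "ghost_related S f g y y'"
  shows "ghost_related S f g (\<lambda>\<nu>. x \<nu> * y \<nu>) (\<lambda>\<nu>. x' \<nu> * y' \<nu>)"
  using ghost_image_mult[OF S fibre_product_rng assms[unfolded ghost_related_def]]
  by (simp add: ghost_related_def times_prod_def)

lemma ghost_related_Fro: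
  assumes "n \<in> S" "ghost_related S f g x x'"
  shows "ghost_related (trunc_quot S n) f g (\<lambda>\<nu>. x (\<nu> * n)) (\<lambda>\<nu>. x' (\<nu> * n))"
  using ghost_image_Fro[OF S fibre_product_rng assms(1) assms(2)[unfolded ghost_related_def]]
  by (simp add: ghost_related_def)

lemma ghost_related_Ver:
  assumes "n \<in> S" "ghost_related (trunc_quot S n) f g x x'"
  shows "ghost_related S f g (\<lambda>\<nu>. nat_multiple n (if n dvd \<nu> then x (\<nu> div n) else 0))
    (\<lambda>\<nu>. nat_multiple n (if n dvd \<nu> then x' (\<nu> div n) else 0))"
proof -
  have "nat_multiple n (if n dvd \<nu> then (x (\<nu> div n), x' (\<nu> div n)) else 0) =
      (nat_multiple n (if n dvd \<nu> then x (\<nu> div n) else 0),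
       nat_multiple n (if n dvd \<nu> then x' (\<nu> div n) else 0))" for \<nu>
    by (simp add: nat_multiple_Pair zero_prod_def)
  then show ?thesis
    using ghost_image_Ver[OF S fibre_product_rng assms(1) assms(2)[unfolded ghost_related_def]]
    by (simp only: ghost_related_def)
qed

end

lemma ghost_seq_in_seqs: "ghost_seq S a \<in> seqs S"
  by (simp add: ghost_seq_def)

section \<open>The classes in \<open>E\<^sub>S(R, \<pi>)\<close>\<close>

lemma presentation_rng_hom: "presentation S \<pi> \<Longrightarrow> rng_hom \<pi>"
  and presentation_surj: "presentation S \<pi> \<Longrightarrow> surj \<pi>"
  by (simp_all add: presentation_def)

lemma presentation_no_torsion:
  fixes \<pi> :: "'a::comm_ring \<Rightarrow> 'r::comm_ring"
  shows "presentation S \<pi> \<Longrightarrow> no_torsion S TYPE('a)"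
  by (simp add: presentation_def)

lemma presentation_trunc_quot:
  "truncation_set S \<Longrightarrow> presentation S \<pi> \<Longrightarrow> presentation (trunc_quot S n) \<pi>"
  unfolding presentation_def by (elim conjE, intro conjI no_torsion_trunc_quot)

text \<open>The class of \<open>\<Sum>\<^sub>n V\<^sub>n\<langle>a\<^sub>n\<rangle>\<close>. All elements of \<open>E\<^sub>S(R, \<pi>)\<close> have this form, and working with the
  coefficients \<open>a\<close> instead of the sequences makes every later statement one about \<open>\<pi> a\<^sub>n\<close>.\<close>

definition E_cls :: "nat set \<Rightarrow> ('a::comm_ring \<Rightarrow> 'r::comm_ring) \<Rightarrow> (nat \<Rightarrow> 'a) \<Rightarrow> (nat \<Rightarrow> 'a) set" where
  "E_cls S \<pi> a = E_class S \<pi> (ghost_seq S a)"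

context
  fixes S :: "nat set" and \<pi> :: "'a::comm_ring \<Rightarrow> 'r::comm_ring"
  assumes S: "truncation_set S" and P: "presentation S \<pi>"
begin

lemma XS_UNIV: "XS S (UNIV :: 'a set) = range (ghost_seq S)"
proof -
  have "x \<in> range (ghost_seq S)" if x: "x \<in> seqs S" "x \<in> ghost_image S UNIV" for x :: "nat \<Rightarrow> 'a"
  proof -
    obtain c where "\<forall>\<nu>\<in>S. ghost c \<nu> = x \<nu>"
      using obtain_ghost_coeffs[OF x(2)] .
    then have "x = ghost_seq S c"
      using x(1) by (intro extensionalityI[of _ S]) (auto simp: ghost_seq_def PiE_def)
    then show ?thesis by simp
  qed
  moreover have "ghost_seq S a \<in> ghost_image S UNIV" for a :: "nat \<Rightarrow> 'a"
    by (rule ghost_in_ghost_image[OF S subrng_UNIV, of a]) (simp_all add: ghost_seq_def)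
  ultimately show ?thesis
    unfolding XS_eq[OF S presentation_no_torsion[OF P] subrng_UNIV]
    by (intro subset_antisym subsetI; elim IntE rangeE)
      (simp_all add: ghost_seq_in_seqs del: PiE_UNIV_domain)
qed

text \<open>Both directions take place in the fibre product \<open>A \<times>\<^sub>R A\<close>. If \<open>x - y = \<Sum>\<^sub>n V\<^sub>n\<langle>c\<^sub>n\<rangle>\<close> with \<open>\<pi> c\<^sub>n = 0\<close>, then
  adding the pair \<open>(y, y)\<close> to the pair of this sum and \<open>0\<close> shows that \<open>(x, y)\<close> has coefficients in the
  fibre product; subtracting \<open>(y, y)\<close> from \<open>(x, y)\<close> gives the converse.\<close>

lemma ghost_seq_E_rel_iff:
  "(ghost_seq S a, ghost_seq S b) \<in> E_rel S \<pi> \<longleftrightarrow> (\<forall>n\<in>S. \<pi> (a n) = \<pi> (b n))"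
proof -
  note hom = presentation_rng_hom[OF P] and tf = presentation_no_torsion[OF P]
  note rel = ghost_related_ghost_iff[OF S hom tf hom tf]
  note rel_add = ghost_related_add[OF S hom tf hom tf]
  note rel_diff = ghost_related_diff[OF S hom tf hom tf]
  have refl: "ghost_related S \<pi> \<pi> (ghost b) (ghost b)"
    by (simp add: rel)
  have mem: "(ghost_seq S a, ghost_seq S b) \<in> E_rel S \<pi> \<longleftrightarrow>
      seq_diff S (ghost_seq S a) (ghost_seq S b) \<in> ghost_image S (kernel \<pi>)"
    using XS_eq[OF S tf subrng_kernel[OF hom]]
    by (simp add: E_rel_def XS_UNIV seq_diff_def)
  show ?thesis
  proof
    assume "(ghost_seq S a, ghost_seq S b) \<in> E_rel S \<pi>"
    then obtain c where c: "\<forall>n. c n \<in> kernel \<pi>"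
      "\<forall>\<nu>\<in>S. seq_diff S (ghost_seq S a) (ghost_seq S b) \<nu> = ghost c \<nu>"
      unfolding mem by (rule ghost_imageE)
    have "ghost_related S \<pi> \<pi> (ghost c) (ghost (\<lambda>_. 0))"
      using c(1) by (simp add: rel kernel_def rng_hom_zero[OF hom])
    then have "ghost_related S \<pi> \<pi> (\<lambda>\<nu>. ghost c \<nu> + ghost b \<nu>) (\<lambda>\<nu>. ghost (\<lambda>_. 0) \<nu> + ghost b \<nu>)"
      using refl by (rule rel_add)
    then have "ghost_related S \<pi> \<pi> (ghost a) (ghost b)"
      by (rule ghost_related_cong)
        (use c(2) in \<open>simp_all add: seq_diff_def ghost_seq_def ghost_zero flip: c(2)\<close>)
    then show "\<forall>n\<in>S. \<pi> (a n) = \<pi> (b n)" by (simp add: rel)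
  next
    assume "\<forall>n\<in>S. \<pi> (a n) = \<pi> (b n)"
    then have "ghost_related S \<pi> \<pi> (ghost a) (ghost b)" by (simp add: rel)
    then have R: "ghost_related S \<pi> \<pi> (\<lambda>\<nu>. ghost a \<nu> - ghost b \<nu>) (\<lambda>\<nu>. ghost b \<nu> - ghost b \<nu>)"
      using refl by (rule rel_diff)
    obtain c where c: "\<forall>\<nu>\<in>S. ghost c \<nu> = ghost a \<nu> - ghost b \<nu>"
      using obtain_ghost_diff[OF S tf] .
    have "ghost_related S \<pi> \<pi> (ghost c) (ghost (\<lambda>_. 0))"
      using R by (rule ghost_related_cong) (simp_all add: c ghost_zero)
    then have "\<forall>n\<in>S. \<pi> (c n) = 0" by (simp add: rel rng_hom_zero[OF hom])
    then show "(ghost_seq S a, ghost_seq S b) \<in> E_rel S \<pi>"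
      unfolding mem
      by (intro ghost_in_ghost_image[OF S subrng_kernel[OF hom], of c])
        (simp_all add: kernel_def seq_diff_def ghost_seq_def c)
  qed
qed

lemma mem_E_cls_iff:
  "x \<in> E_cls S \<pi> a \<longleftrightarrow> (\<exists>b. x = ghost_seq S b \<and> (\<forall>n\<in>S. \<pi> (a n) = \<pi> (b n)))"
proof
  assume "x \<in> E_cls S \<pi> a"
  then have r: "(ghost_seq S a, x) \<in> E_rel S \<pi>" by (simp add: E_cls_def E_class_def)
  then have "x \<in> range (ghost_seq S)" by (simp add: E_rel_def XS_UNIV)
  then obtain b where b: "x = ghost_seq S b" by (elim rangeE)
  show "\<exists>b. x = ghost_seq S b \<and> (\<forall>n\<in>S. \<pi> (a n) = \<pi> (b n))"
    using r b by (intro exI[of _ b]) (simp add: ghost_seq_E_rel_iff)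
next
  assume "\<exists>b. x = ghost_seq S b \<and> (\<forall>n\<in>S. \<pi> (a n) = \<pi> (b n))"
  then show "x \<in> E_cls S \<pi> a"
    by (elim exE conjE) (simp add: E_cls_def E_class_def ghost_seq_E_rel_iff)
qed

lemma ghost_seq_in_E_cls: "ghost_seq S a \<in> E_cls S \<pi> a"
  unfolding mem_E_cls_iff by blast

lemma E_cls_eq_iff: "E_cls S \<pi> a = E_cls S \<pi> b \<longleftrightarrow> (\<forall>n\<in>S. \<pi> (a n) = \<pi> (b n))"
proof
  assume "E_cls S \<pi> a = E_cls S \<pi> b"
  then have "ghost_seq S b \<in> E_cls S \<pi> a" using ghost_seq_in_E_cls by simp
  then show "\<forall>n\<in>S. \<pi> (a n) = \<pi> (b n)"
    by (simp add: E_cls_def E_class_def ghost_seq_E_rel_iff)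
next
  assume "\<forall>n\<in>S. \<pi> (a n) = \<pi> (b n)"
  then show "E_cls S \<pi> a = E_cls S \<pi> b"
    by (intro set_eqI) (simp add: mem_E_cls_iff)
qed

lemma E_set_eq: "E_set S \<pi> = range (E_cls S \<pi>)"
  unfolding E_set_def quotient_def XS_UNIV E_cls_def E_class_def
  by (simp only: UNION_singleton_eq_range image_image)

lemma E_class_of_seq:
  assumes "\<forall>\<nu>\<in>S. ghost c \<nu> = x \<nu>" "x \<in> seqs S"
  shows "E_class S \<pi> x = E_cls S \<pi> c"
proof -
  have "x = ghost_seq S c"
    using assms by (intro extensionalityI[of _ S]) (auto simp: ghost_seq_def PiE_def)
  then show ?thesis by (simp add: E_cls_def)
qed

text \<open>The operations on \<open>E\<^sub>S\<close> are unions over all representatives; a union of equal sets over a nonempty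
  index set collapses.\<close>

lemma UN_E_cls:
  assumes "\<And>a'. \<forall>n\<in>S. \<pi> (a n) = \<pi> (a' n) \<Longrightarrow> F (ghost_seq S a') = K"
  shows "(\<Union>x\<in>E_cls S \<pi> a. F x) = K"
proof -
  have "F x = K" if "x \<in> E_cls S \<pi> a" for x
    using that assms unfolding mem_E_cls_iff by blast
  then show ?thesis using ghost_seq_in_E_cls[of a] by blast
qed

text \<open>A sum of other representatives has coefficients congruent to \<open>c\<close>, because the relation
  \<open>ghost_related\<close> for \<open>\<pi>\<close> and \<open>\<pi>\<close> is additive.\<close>

lemma E_add_E_cls:
  assumes c: "\<forall>\<nu>\<in>S. ghost c \<nu> = ghost a \<nu> + ghost b \<nu>"
  shows "E_add S \<pi> (E_cls S \<pi> a) (E_cls S \<pi> b) = E_cls S \<pi> c"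
  unfolding E_add_def
proof (intro UN_E_cls)
  note hom = presentation_rng_hom[OF P] and tf = presentation_no_torsion[OF P]
  note rel = ghost_related_ghost_iff[OF S hom tf hom tf]
  fix a' b' assume "\<forall>n\<in>S. \<pi> (a n) = \<pi> (a' n)" "\<forall>n\<in>S. \<pi> (b n) = \<pi> (b' n)"
  then have R: "ghost_related S \<pi> \<pi> (\<lambda>\<nu>. ghost a \<nu> + ghost b \<nu>) (\<lambda>\<nu>. ghost a' \<nu> + ghost b' \<nu>)"
    by (intro ghost_related_add[OF S hom tf hom tf]) (simp_all add: rel)
  obtain c' where c': "\<forall>\<nu>\<in>S. ghost c' \<nu> = ghost a' \<nu> + ghost b' \<nu>"
    using obtain_ghost_add[OF S tf] .
  have "ghost_related S \<pi> \<pi> (ghost c) (ghost c')"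
    using R by (rule ghost_related_cong) (simp_all add: c c')
  moreover have "E_class S \<pi> (seq_add S (ghost_seq S a') (ghost_seq S b')) = E_cls S \<pi> c'"
    by (rule E_class_of_seq) (simp_all add: c' seq_add_def ghost_seq_def)
  ultimately show "E_class S \<pi> (seq_add S (ghost_seq S a') (ghost_seq S b')) = E_cls S \<pi> c"
    by (simp add: rel E_cls_eq_iff)
qed

lemma E_mult_E_cls:
  assumes c: "\<forall>\<nu>\<in>S. ghost c \<nu> = ghost a \<nu> * ghost b \<nu>"
  shows "E_mult S \<pi> (E_cls S \<pi> a) (E_cls S \<pi> b) = E_cls S \<pi> c"
  unfolding E_mult_def
proof (intro UN_E_cls)
  note hom = presentation_rng_hom[OF P] and tf = presentation_no_torsion[OF P]
  note rel = ghost_related_ghost_iff[OF S hom tf hom tf]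
  fix a' b' assume "\<forall>n\<in>S. \<pi> (a n) = \<pi> (a' n)" "\<forall>n\<in>S. \<pi> (b n) = \<pi> (b' n)"
  then have R: "ghost_related S \<pi> \<pi> (\<lambda>\<nu>. ghost a \<nu> * ghost b \<nu>) (\<lambda>\<nu>. ghost a' \<nu> * ghost b' \<nu>)"
    by (intro ghost_related_mult[OF S hom tf hom tf]) (simp_all add: rel)
  obtain c' where c': "\<forall>\<nu>\<in>S. ghost c' \<nu> = ghost a' \<nu> * ghost b' \<nu>"
    using obtain_ghost_mult[OF S tf] .
  have "ghost_related S \<pi> \<pi> (ghost c) (ghost c')"
    using R by (rule ghost_related_cong) (simp_all add: c c')
  moreover have "E_class S \<pi> (seq_mult S (ghost_seq S a') (ghost_seq S b')) = E_cls S \<pi> c'"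
    by (rule E_class_of_seq) (simp_all add: c' seq_mult_def ghost_seq_def)
  ultimately show "E_class S \<pi> (seq_mult S (ghost_seq S a') (ghost_seq S b')) = E_cls S \<pi> c"
    by (simp add: rel E_cls_eq_iff)
qed

text \<open>The map \<open>r \<mapsto>\<close> class of \<open>\<Sum>\<^sub>n V\<^sub>n\<langle>a\<^sub>n\<rangle>\<close>, for any lift \<open>a\<close> of \<open>r\<close>, is well defined and bijective by
  \<open>E_cls_eq_iff\<close>. It is the only map with the defining property of \<open>\<psi>\<^sub>S\<close>, as \<open>\<pi>\<close> is surjective and
  the sums are unique.\<close>

lemma psi_E_cls:
  assumes "r \<in> seqs S" "\<forall>n\<in>S. \<pi> (a n) = r n"
  shows "psi S \<pi> r = E_cls S \<pi> a"
proof -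
  note inv = surj_f_inv_f[OF presentation_surj[OF P]]
  define \<Psi> where "\<Psi> \<psi> \<longleftrightarrow> \<psi> \<in> extensional (seqs S) \<and> bij_betw \<psi> (seqs S) (E_set S \<pi>) \<and>
     (\<forall>a\<in>seqs S. \<exists>s. seq_sums S (\<lambda>n. Ver_power S n (a n)) s \<and>
        \<psi> (seq_map S \<pi> a) = E_class S \<pi> s)" for \<psi>
  define \<psi>\<^sub>0 where "\<psi>\<^sub>0 = restrict (\<lambda>r. E_cls S \<pi> (\<lambda>n. inv \<pi> (r n))) (seqs S)"
  have seq_map_seqs: "seq_map S \<pi> a \<in> seqs S" for a by (simp add: seq_map_def)
  have \<psi>\<^sub>0_map: "\<psi>\<^sub>0 (seq_map S \<pi> a) = E_cls S \<pi> a" for a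
    using seq_map_seqs[of a] by (simp add: \<psi>\<^sub>0_def E_cls_eq_iff inv seq_map_def)
  have "\<Psi> \<psi>\<^sub>0"
    unfolding \<Psi>_def
  proof (intro conjI ballI)
    show "\<psi>\<^sub>0 \<in> extensional (seqs S)" by (simp add: \<psi>\<^sub>0_def)
    show "bij_betw \<psi>\<^sub>0 (seqs S) (E_set S \<pi>)"
      unfolding bij_betw_def
    proof
      show "inj_on \<psi>\<^sub>0 (seqs S)"
      proof (rule inj_onI)
        fix r r' assume r: "r \<in> seqs S" "r' \<in> seqs S" "\<psi>\<^sub>0 r = \<psi>\<^sub>0 r'"
        then have "\<forall>n\<in>S. r n = r' n" by (simp add: \<psi>\<^sub>0_def E_cls_eq_iff inv)
        then show "r = r'" using r by (intro extensionalityI[of r S]) (auto simp: PiE_def)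
      qed
      have "\<psi>\<^sub>0 r \<in> E_set S \<pi>" if "r \<in> seqs S" for r
        using that by (simp add: \<psi>\<^sub>0_def E_set_eq)
      moreover have "E_cls S \<pi> a \<in> \<psi>\<^sub>0 ` seqs S" for a
        using \<psi>\<^sub>0_map[of a] seq_map_seqs[of a] by (metis imageI)
      ultimately show "\<psi>\<^sub>0 ` seqs S = E_set S \<pi>"
        unfolding E_set_eq by blast
    qed
    fix a :: "nat \<Rightarrow> 'a"
    show "\<exists>s. seq_sums S (\<lambda>n. Ver_power S n (a n)) s \<and> \<psi>\<^sub>0 (seq_map S \<pi> a) = E_class S \<pi> s"
      by (simp add: seq_sums_iff[OF S] \<psi>\<^sub>0_map E_cls_def)
  qed
  moreover have "\<psi> = \<psi>\<^sub>0" if "\<Psi> \<psi>" for \<psi>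
  proof (rule extensionalityI[of _ "seqs S"])
    show "\<psi> \<in> extensional (seqs S)" "\<psi>\<^sub>0 \<in> extensional (seqs S)"
      using that by (simp_all add: \<Psi>_def \<psi>\<^sub>0_def)
    fix r :: "nat \<Rightarrow> 'r" assume r: "r \<in> seqs S"
    define a where "a = restrict (\<lambda>n. inv \<pi> (r n)) S"
    have "a \<in> seqs S" by (simp add: a_def)
    moreover have map: "seq_map S \<pi> a = r"
      using r by (intro extensionalityI[of _ S]) (auto simp: PiE_def seq_map_def a_def inv)
    ultimately have "\<psi> r = E_cls S \<pi> a"
      using that by (auto simp: \<Psi>_def seq_sums_iff[OF S] E_cls_def)
    then show "\<psi> r = \<psi>\<^sub>0 r" using \<psi>\<^sub>0_map[of a] by (simp add: map)
  qed
  ultimately have "psi S \<pi> = \<psi>\<^sub>0"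
    unfolding psi_def \<Psi>_def[symmetric] by (rule the_equality)
  moreover have "seq_map S \<pi> a = r"
    using assms by (intro extensionalityI[of _ S]) (auto simp: PiE_def seq_map_def)
  ultimately show ?thesis using \<psi>\<^sub>0_map[of a] by simp
qed

end

section \<open>Frobenius and Verschiebung on classes\<close>

context
  fixes S :: "nat set" and \<pi> :: "'a::comm_ring \<Rightarrow> 'r::comm_ring" and n :: nat
  assumes S: "truncation_set S" and P: "presentation S \<pi>" and n: "n \<in> S"
begin

lemma E_Fro_E_cls:
  assumes c: "\<forall>\<nu>\<in>trunc_quot S n. ghost c \<nu> = ghost a (\<nu> * n)"
  shows "E_Fro S \<pi> n (E_cls S \<pi> a) = E_cls (trunc_quot S n) \<pi> c"
  unfolding E_Fro_def
proof (intro UN_E_cls[OF S P])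
  note hom = presentation_rng_hom[OF P] and tf = presentation_no_torsion[OF P]
  note S' = truncation_set_trunc_quot[OF S n] and P' = presentation_trunc_quot[OF S P, of n]
  note tf' = presentation_no_torsion[OF P']
  fix a' assume "\<forall>n\<in>S. \<pi> (a n) = \<pi> (a' n)"
  then have R: "ghost_related (trunc_quot S n) \<pi> \<pi> (\<lambda>\<nu>. ghost a (\<nu> * n)) (\<lambda>\<nu>. ghost a' (\<nu> * n))"
    by (intro ghost_related_Fro[OF S hom tf hom tf n]) (simp add: ghost_related_ghost_iff[OF S hom tf hom tf])
  obtain c' where c': "\<forall>\<nu>\<in>trunc_quot S n. ghost c' \<nu> = ghost a' (\<nu> * n)"
    using obtain_ghost_Fro[OF S tf n] .
  have "ghost_related (trunc_quot S n) \<pi> \<pi> (ghost c) (ghost c')"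
    using R by (rule ghost_related_cong) (simp_all add: c c')
  moreover have "E_class (trunc_quot S n) \<pi> (Fro S n (ghost_seq S a')) = E_cls (trunc_quot S n) \<pi> c'"
    by (rule E_class_of_seq[OF S' P']) (simp_all add: c' Fro_def ghost_seq_def, simp add: trunc_quot_def)
  ultimately show "E_class (trunc_quot S n) \<pi> (Fro S n (ghost_seq S a')) = E_cls (trunc_quot S n) \<pi> c"
    by (simp add: ghost_related_ghost_iff[OF S' hom tf' hom tf'] E_cls_eq_iff[OF S' P'])
qed

lemma E_Ver_E_cls:
  assumes c: "\<forall>\<nu>\<in>S. ghost c \<nu> = nat_multiple n (if n dvd \<nu> then ghost a (\<nu> div n) else 0)"
  shows "E_Ver S \<pi> n (E_cls (trunc_quot S n) \<pi> a) = E_cls S \<pi> c"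
  unfolding E_Ver_def
proof -
  note hom = presentation_rng_hom[OF P] and tf = presentation_no_torsion[OF P]
  note S' = truncation_set_trunc_quot[OF S n] and P' = presentation_trunc_quot[OF S P, of n]
  note tf' = presentation_no_torsion[OF P']
  show "(\<Union>x\<in>E_cls (trunc_quot S n) \<pi> a. E_class S \<pi> (Ver S n x)) = E_cls S \<pi> c"
  proof (intro UN_E_cls[OF S' P'])
    fix a' assume "\<forall>n\<in>trunc_quot S n. \<pi> (a n) = \<pi> (a' n)"
    then have R: "ghost_related S \<pi> \<pi>
        (\<lambda>\<nu>. nat_multiple n (if n dvd \<nu> then ghost a (\<nu> div n) else 0))
        (\<lambda>\<nu>. nat_multiple n (if n dvd \<nu> then ghost a' (\<nu> div n) else 0))"
      by (intro ghost_related_Ver[OF S hom tf hom tf n])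
        (simp add: ghost_related_ghost_iff[OF S' hom tf' hom tf'])
    obtain c' where c': "\<forall>\<nu>\<in>S. ghost c' \<nu> = nat_multiple n (if n dvd \<nu> then ghost a' (\<nu> div n) else 0)"
      using obtain_ghost_Ver[OF S tf n] .
    have "ghost_related S \<pi> \<pi> (ghost c) (ghost c')"
      using R by (rule ghost_related_cong) (simp_all add: c c')
    moreover have "E_class S \<pi> (Ver S n (ghost_seq (trunc_quot S n) a')) = E_cls S \<pi> c'"
      by (rule E_class_of_seq[OF S P])
        (simp_all add: c' Ver_def ghost_seq_def div_in_trunc_quot[OF S])
    ultimately show "E_class S \<pi> (Ver S n (ghost_seq (trunc_quot S n) a')) = E_cls S \<pi> c"
      by (simp add: ghost_related_ghost_iff[OF S hom tf hom tf] E_cls_eq_iff[OF S P])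
  qed
qed

text \<open>\<open>V\<^sub>n\<langle>r\<rangle>\<close> is \<open>\<psi>\<^sub>S\<close> of the sequence with the single entry \<open>r\<close> at the index \<open>n\<close>, because
  \<open>V\<^sub>n V\<^sub>1\<langle>x\<rangle> = V\<^sub>n\<langle>x\<rangle>\<close>.\<close>

lemma Ver_teich_E_cls: "Ver_teich S \<pi> n (\<pi> x) = E_cls S \<pi> (\<lambda>k. if k = n then x else 0)"
proof -
  note S' = truncation_set_trunc_quot[OF S n] and P' = presentation_trunc_quot[OF S P, of n]
  have "teich (trunc_quot S n) \<pi> (\<pi> x) = E_cls (trunc_quot S n) \<pi> (\<lambda>k. if k = Suc 0 then x else 0)"
    unfolding teich_def
    by (rule psi_E_cls[OF S' P']) (simp_all add: rng_hom_zero[OF presentation_rng_hom[OF P]])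
  moreover have "0 < n" using S n by (rule truncation_set_pos)
  then have "ghost (\<lambda>k. if k = n then x else 0) \<nu> = nat_multiple n
      (if n dvd \<nu> then ghost (\<lambda>k. if k = Suc 0 then x else 0) (\<nu> div n) else 0)" for \<nu>
    using Ver_pow_Ver[of n "Suc 0" x \<nu>] by (simp add: ghost_single)
  then have "E_Ver S \<pi> n (E_cls (trunc_quot S n) \<pi> (\<lambda>k. if k = Suc 0 then x else 0)) =
      E_cls S \<pi> (\<lambda>k. if k = n then x else 0)"
    by (intro E_Ver_E_cls) simp
  ultimately show ?thesis by (simp add: Ver_teich_def)
qed

end

section \<open>The topology of \<open>E\<^sub>S(R, \<pi>)\<close>\<close>

context
  fixes S :: "nat set" and \<pi> :: "'a::comm_ring \<Rightarrow> 'r::comm_ring"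
  assumes S: "truncation_set S" and P: "presentation S \<pi>"
begin

lemma topspace_E_topology: "topspace (E_topology S \<pi>) = E_set S \<pi>"
proof -
  have "range (ghost_seq S) \<subseteq> (seqs S :: (nat \<Rightarrow> 'a) set)"
    using ghost_seq_in_seqs by (intro image_subsetI)
  then have "seqs S \<inter> range (ghost_seq S) = (range (ghost_seq S) :: (nat \<Rightarrow> 'a) set)"
    by (rule Int_absorb1)
  then show ?thesis
    by (simp add: E_topology_def topspace_quotient_topology XS_UNIV[OF S P] E_set_eq[OF S P]
        image_image E_cls_def del: PiE_UNIV_domain)
qed

text \<open>In terms of coefficients, \<open>E\<^sub>S(R, \<pi>)\<close> carries the product topology of the discrete ring \<open>R\<close>: two
  sums of the \<open>V\<^sub>n\<langle>a\<^sub>n\<rangle>\<close> agree up to the index \<open>N\<close> exactly if their coefficients do, and the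
  projection to \<open>E\<^sub>S(R, \<pi>)\<close> forgets all but the \<open>\<pi> a\<^sub>n\<close>.\<close>

lemma openin_E_topology:
  "openin (E_topology S \<pi>) U \<longleftrightarrow> U \<subseteq> E_set S \<pi> \<and>
     (\<forall>a. E_cls S \<pi> a \<in> U \<longrightarrow>
        (\<exists>N. \<forall>b. (\<forall>n\<in>S. n \<le> N \<longrightarrow> \<pi> (a n) = \<pi> (b n)) \<longrightarrow> E_cls S \<pi> b \<in> U))"
proof -
  let ?X = "range (ghost_seq S) :: (nat \<Rightarrow> 'a) set"
  let ?V = "{x \<in> ?X. E_class S \<pi> x \<in> U}"
  have X: "?X \<subseteq> seqs S"
    using ghost_seq_in_seqs by (intro image_subsetI)
  have top: "topspace (subtopology (seq_topology S) ?X) = ?X"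
    using Int_absorb1[OF X] by (simp del: PiE_UNIV_domain)
  have "openin (E_topology S \<pi>) U \<longleftrightarrow> U \<subseteq> E_set S \<pi> \<and> openin (subtopology (seq_topology S) ?X) ?V"
    unfolding E_topology_def openin_quotient_topology XS_UNIV[OF S P] top E_set_eq[OF S P]
    by (simp add: image_image E_cls_def)
  also have "openin (subtopology (seq_topology S) ?X) ?V \<longleftrightarrow>
      (\<forall>x\<in>?V. \<exists>N. \<forall>y\<in>?X. (\<forall>\<nu>\<in>S. \<nu> \<le> N \<longrightarrow> y \<nu> = x \<nu>) \<longrightarrow> y \<in> ?V)"
    unfolding openin_subtopology_seq_topology[OF X] using Collect_restrict by blast
  also have "\<dots> \<longleftrightarrow> (\<forall>a. E_cls S \<pi> a \<in> U \<longrightarrow>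
      (\<exists>N. \<forall>b. (\<forall>\<nu>\<in>S. \<nu> \<le> N \<longrightarrow> ghost b \<nu> = ghost a \<nu>) \<longrightarrow> E_cls S \<pi> b \<in> U))"
  proof -
    have ball: "(\<forall>x\<in>{x \<in> range g. Q x}. R x) \<longleftrightarrow> (\<forall>a. Q (g a) \<longrightarrow> R (g a))"
      for g :: "(nat \<Rightarrow> 'a) \<Rightarrow> nat \<Rightarrow> 'a" and Q R by blast
    show ?thesis unfolding ball by (simp add: E_cls_def ghost_seq_def)
  qed
  also have "\<dots> \<longleftrightarrow> (\<forall>a. E_cls S \<pi> a \<in> U \<longrightarrow>
      (\<exists>N. \<forall>b. (\<forall>n\<in>S. n \<le> N \<longrightarrow> \<pi> (a n) = \<pi> (b n)) \<longrightarrow> E_cls S \<pi> b \<in> U))"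
  proof -
    have "(\<forall>b. (\<forall>\<nu>\<in>S. \<nu> \<le> N \<longrightarrow> ghost b \<nu> = ghost a \<nu>) \<longrightarrow> E_cls S \<pi> b \<in> U) \<longleftrightarrow>
        (\<forall>b. (\<forall>n\<in>S. n \<le> N \<longrightarrow> \<pi> (a n) = \<pi> (b n)) \<longrightarrow> E_cls S \<pi> b \<in> U)" (is "?L \<longleftrightarrow> ?R") for a N
    proof
      assume L: ?L
      show ?R
      proof (intro allI impI)
        fix b assume b: "\<forall>n\<in>S. n \<le> N \<longrightarrow> \<pi> (a n) = \<pi> (b n)"
        \<comment> \<open>Another representative of the class of \<open>b\<close>, equal to \<open>a\<close> itself up to \<open>N\<close>.\<close>
        define b' where "b' n = (if n \<le> N then a n else b n)" for n
        have "ghost b' \<nu> = ghost a \<nu>" if "\<nu> \<le> N" for \<nu>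
          using that by (intro ghost_cong) (simp add: b'_def)
        then have "E_cls S \<pi> b' \<in> U" using L by simp
        moreover have "E_cls S \<pi> b' = E_cls S \<pi> b"
          using b by (simp add: E_cls_eq_iff[OF S P] b'_def)
        ultimately show "E_cls S \<pi> b \<in> U" by simp
      qed
    next
      assume R: ?R
      show ?L
      proof (intro allI impI)
        fix b assume b: "\<forall>\<nu>\<in>S. \<nu> \<le> N \<longrightarrow> ghost b \<nu> = ghost a \<nu>"
        have "a n = b n" if "n \<in> S" "n \<le> N" for n
          by (rule ghost_inj[OF S presentation_no_torsion[OF P], where N = N])
            (use b that in simp_all)
        then show "E_cls S \<pi> b \<in> U" using R by simp
      qed
    qed
    then show ?thesis by simp
  qed
  finally show ?thesis .
qed

end

section \<open>The induced map\<close>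

lemma E_setE:
  assumes "truncation_set S" "presentation S \<pi>" "c \<in> E_set S \<pi>"
  obtains a where "c = E_cls S \<pi> a"
  using assms(3) unfolding E_set_eq[OF assms(1,2)] by (elim rangeE) (rule that)

lemma E_cls_in_E_set: "truncation_set S \<Longrightarrow> presentation S \<pi> \<Longrightarrow> E_cls S \<pi> a \<in> E_set S \<pi>"
  by (simp add: E_set_eq)

context
  fixes S :: "nat set"
    and \<pi>\<^sub>1 :: "'a1::comm_ring \<Rightarrow> 'r1::comm_ring"
    and \<pi>\<^sub>2 :: "'a2::comm_ring \<Rightarrow> 'r2::comm_ring"
    and \<alpha> :: "'r1 \<Rightarrow> 'r2"
  assumes S: "truncation_set S" and P1: "presentation S \<pi>\<^sub>1" and P2: "presentation S \<pi>\<^sub>2"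
    and hom: "rng_hom \<alpha>"
begin

lemma obtain_lift:
  obtains b where "\<forall>n. \<alpha> (\<pi>\<^sub>1 (a n)) = \<pi>\<^sub>2 (b n)"
  by (rule that[of "\<lambda>n. inv \<pi>\<^sub>2 (\<alpha> (\<pi>\<^sub>1 (a n)))"])
    (simp add: surj_f_inv_f[OF presentation_surj[OF P2]])

text \<open>The defining equation \<open>E\<^sub>S(\<alpha>) \<circ> \<psi>\<^sub>S = \<psi>\<^sub>S \<circ> \<alpha>\<^sup>S\<close> in terms of coefficients: any lift of the images
  in \<open>R\<^sub>2\<close> may be used.\<close>

lemma E_map_E_cls:
  assumes "\<forall>n\<in>S. \<alpha> (\<pi>\<^sub>1 (a n)) = \<pi>\<^sub>2 (b n)"
  shows "E_map S \<pi>\<^sub>1 \<pi>\<^sub>2 \<alpha> (E_cls S \<pi>\<^sub>1 a) = E_cls S \<pi>\<^sub>2 b"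
proof -
  have seq_map_seqs: "seq_map S h x \<in> seqs S" for h :: "'c \<Rightarrow> 'd" and x by (simp add: seq_map_def)
  have cls1: "E_cls S \<pi>\<^sub>1 x = psi S \<pi>\<^sub>1 (seq_map S \<pi>\<^sub>1 x)" for x
    by (rule psi_E_cls[OF S P1 seq_map_seqs, symmetric]) (simp add: seq_map_def)
  have inj: "r = r'" if r: "r \<in> seqs S" "r' \<in> seqs S" "psi S \<pi>\<^sub>1 r = psi S \<pi>\<^sub>1 r'" for r r'
  proof -
    have psi: "psi S \<pi>\<^sub>1 q = E_cls S \<pi>\<^sub>1 (\<lambda>n. inv \<pi>\<^sub>1 (q n))" if "q \<in> seqs S" for q
      by (rule psi_E_cls[OF S P1 that]) (simp add: surj_f_inv_f[OF presentation_surj[OF P1]])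
    have "\<forall>n\<in>S. r n = r' n"
      using r by (simp add: psi E_cls_eq_iff[OF S P1] surj_f_inv_f[OF presentation_surj[OF P1]])
    then show ?thesis using r by (intro extensionalityI[of r S]) (auto simp: PiE_def)
  qed
  define \<Phi> where "\<Phi> f \<longleftrightarrow> f \<in> extensional (E_set S \<pi>\<^sub>1) \<and>
     (\<forall>r\<in>seqs S. f (psi S \<pi>\<^sub>1 r) = psi S \<pi>\<^sub>2 (seq_map S \<alpha> r))" for f
  define f\<^sub>0 where "f\<^sub>0 = restrict (\<lambda>c. psi S \<pi>\<^sub>2 (seq_map S \<alpha> (SOME r. r \<in> seqs S \<and> psi S \<pi>\<^sub>1 r = c)))
      (E_set S \<pi>\<^sub>1)"
  have psi_in: "psi S \<pi>\<^sub>1 r \<in> E_set S \<pi>\<^sub>1" if "r \<in> seqs S" for r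
  proof -
    have "psi S \<pi>\<^sub>1 r = E_cls S \<pi>\<^sub>1 (\<lambda>n. inv \<pi>\<^sub>1 (r n))"
      by (rule psi_E_cls[OF S P1 that]) (simp add: surj_f_inv_f[OF presentation_surj[OF P1]])
    then show ?thesis by (simp add: E_cls_in_E_set[OF S P1])
  qed
  have "\<Phi> f\<^sub>0"
    unfolding \<Phi>_def
  proof (intro conjI ballI)
    show "f\<^sub>0 \<in> extensional (E_set S \<pi>\<^sub>1)" by (simp add: f\<^sub>0_def)
    fix r assume r: "r \<in> (seqs S :: (nat \<Rightarrow> 'r1) set)"
    have "(SOME r'. r' \<in> seqs S \<and> psi S \<pi>\<^sub>1 r' = psi S \<pi>\<^sub>1 r) = r"
    proof (rule some_equality)
      fix r' assume r': "r' \<in> seqs S \<and> psi S \<pi>\<^sub>1 r' = psi S \<pi>\<^sub>1 r"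
      show "r' = r" by (rule inj[OF conjunct1[OF r'] r conjunct2[OF r']])
    qed (intro conjI r refl)
    then show "f\<^sub>0 (psi S \<pi>\<^sub>1 r) = psi S \<pi>\<^sub>2 (seq_map S \<alpha> r)"
      using psi_in[OF r] by (simp add: f\<^sub>0_def)
  qed
  moreover have "f = f\<^sub>0" if f: "\<Phi> f" for f
  proof (rule extensionalityI[of _ "E_set S \<pi>\<^sub>1"])
    show "f \<in> extensional (E_set S \<pi>\<^sub>1)" "f\<^sub>0 \<in> extensional (E_set S \<pi>\<^sub>1)"
      using f by (simp_all add: \<Phi>_def f\<^sub>0_def)
    fix c assume "c \<in> E_set S \<pi>\<^sub>1"
    then obtain x where "c = psi S \<pi>\<^sub>1 (seq_map S \<pi>\<^sub>1 x)"
      using E_setE[OF S P1] cls1 by metis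
    then show "f c = f\<^sub>0 c"
      using f \<open>\<Phi> f\<^sub>0\<close> seq_map_seqs[of \<pi>\<^sub>1 x] by (simp add: \<Phi>_def)
  qed
  ultimately have "E_map S \<pi>\<^sub>1 \<pi>\<^sub>2 \<alpha> = f\<^sub>0"
    unfolding E_map_def \<Phi>_def[symmetric] by (rule the_equality)
  then have "E_map S \<pi>\<^sub>1 \<pi>\<^sub>2 \<alpha> (E_cls S \<pi>\<^sub>1 a) = psi S \<pi>\<^sub>2 (seq_map S \<alpha> (seq_map S \<pi>\<^sub>1 a))"
    using \<open>\<Phi> f\<^sub>0\<close> seq_map_seqs[of \<pi>\<^sub>1 a] by (simp add: \<Phi>_def cls1)
  also have "\<dots> = E_cls S \<pi>\<^sub>2 b"
    by (rule psi_E_cls[OF S P2 seq_map_seqs]) (use assms in \<open>simp add: seq_map_def\<close>)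
  finally show ?thesis .
qed

lemma E_map_in_E_set:
  assumes "c \<in> E_set S \<pi>\<^sub>1"
  shows "E_map S \<pi>\<^sub>1 \<pi>\<^sub>2 \<alpha> c \<in> E_set S \<pi>\<^sub>2"
proof -
  obtain a where a: "c = E_cls S \<pi>\<^sub>1 a" using E_setE[OF S P1 assms] .
  obtain b where "\<forall>n. \<alpha> (\<pi>\<^sub>1 (a n)) = \<pi>\<^sub>2 (b n)" using obtain_lift .
  then have "E_map S \<pi>\<^sub>1 \<pi>\<^sub>2 \<alpha> c = E_cls S \<pi>\<^sub>2 b" unfolding a by (intro E_map_E_cls) simp
  then show ?thesis by (simp add: E_cls_in_E_set[OF S P2])
qed

lemma lift_related_iff:
  "ghost_related S (\<alpha> \<circ> \<pi>\<^sub>1) \<pi>\<^sub>2 (ghost a) (ghost b) \<longleftrightarrow> (\<forall>n\<in>S. \<alpha> (\<pi>\<^sub>1 (a n)) = \<pi>\<^sub>2 (b n))"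
  using ghost_related_ghost_iff[OF S rng_hom_comp[OF hom presentation_rng_hom[OF P1]] presentation_no_torsion[OF P1]
      presentation_rng_hom[OF P2] presentation_no_torsion[OF P2], of a b]
  by simp

text \<open>Lift the coefficients of both summands to \<open>A\<^sub>2\<close>. The sums in \<open>A\<^sub>1\<close> and in \<open>A\<^sub>2\<close> are related over the
  fibre product of \<open>\<alpha> \<circ> \<pi>\<^sub>1\<close> and \<open>\<pi>\<^sub>2\<close>, so the coefficients of the second sum lift those of the first. The
  proofs for products, \<open>F\<^sub>n\<close> and \<open>V\<^sub>n\<close> have the same form.\<close>

lemma E_map_E_add:
  assumes c: "c \<in> E_set S \<pi>\<^sub>1" and d: "d \<in> E_set S \<pi>\<^sub>1"
  shows "E_map S \<pi>\<^sub>1 \<pi>\<^sub>2 \<alpha> (E_add S \<pi>\<^sub>1 c d) =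
    E_add S \<pi>\<^sub>2 (E_map S \<pi>\<^sub>1 \<pi>\<^sub>2 \<alpha> c) (E_map S \<pi>\<^sub>1 \<pi>\<^sub>2 \<alpha> d)"
proof -
  note t1 = presentation_no_torsion[OF P1] and t2 = presentation_no_torsion[OF P2]
  obtain a where a: "c = E_cls S \<pi>\<^sub>1 a" using E_setE[OF S P1 c] .
  obtain b where b: "d = E_cls S \<pi>\<^sub>1 b" using E_setE[OF S P1 d] .
  obtain a' where a': "\<forall>n. \<alpha> (\<pi>\<^sub>1 (a n)) = \<pi>\<^sub>2 (a' n)" using obtain_lift .
  obtain b' where b': "\<forall>n. \<alpha> (\<pi>\<^sub>1 (b n)) = \<pi>\<^sub>2 (b' n)" using obtain_lift .
  obtain s where s: "\<forall>\<nu>\<in>S. ghost s \<nu> = ghost a \<nu> + ghost b \<nu>"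
    using obtain_ghost_add[OF S t1] .
  obtain s' where s': "\<forall>\<nu>\<in>S. ghost s' \<nu> = ghost a' \<nu> + ghost b' \<nu>"
    using obtain_ghost_add[OF S t2] .
  have "ghost_related S (\<alpha> \<circ> \<pi>\<^sub>1) \<pi>\<^sub>2 (\<lambda>\<nu>. ghost a \<nu> + ghost b \<nu>) (\<lambda>\<nu>. ghost a' \<nu> + ghost b' \<nu>)"
    by (rule ghost_related_add[OF S rng_hom_comp[OF hom presentation_rng_hom[OF P1]] t1 presentation_rng_hom[OF P2] t2])
      (simp_all add: lift_related_iff a' b')
  then have "ghost_related S (\<alpha> \<circ> \<pi>\<^sub>1) \<pi>\<^sub>2 (ghost s) (ghost s')"
    by (rule ghost_related_cong) (simp_all add: s s')
  then have "E_map S \<pi>\<^sub>1 \<pi>\<^sub>2 \<alpha> (E_cls S \<pi>\<^sub>1 s) = E_cls S \<pi>\<^sub>2 s'"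
    by (intro E_map_E_cls) (simp add: lift_related_iff)
  then show ?thesis
    by (simp add: a b E_map_E_cls[OF spec[OF a', THEN ballI]] E_map_E_cls[OF spec[OF b', THEN ballI]]
        E_add_E_cls[OF S P1 s] E_add_E_cls[OF S P2 s'])
qed

lemma E_map_E_mult:
  assumes c: "c \<in> E_set S \<pi>\<^sub>1" and d: "d \<in> E_set S \<pi>\<^sub>1"
  shows "E_map S \<pi>\<^sub>1 \<pi>\<^sub>2 \<alpha> (E_mult S \<pi>\<^sub>1 c d) =
    E_mult S \<pi>\<^sub>2 (E_map S \<pi>\<^sub>1 \<pi>\<^sub>2 \<alpha> c) (E_map S \<pi>\<^sub>1 \<pi>\<^sub>2 \<alpha> d)"
proof -
  note t1 = presentation_no_torsion[OF P1] and t2 = presentation_no_torsion[OF P2]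
  obtain a where a: "c = E_cls S \<pi>\<^sub>1 a" using E_setE[OF S P1 c] .
  obtain b where b: "d = E_cls S \<pi>\<^sub>1 b" using E_setE[OF S P1 d] .
  obtain a' where a': "\<forall>n. \<alpha> (\<pi>\<^sub>1 (a n)) = \<pi>\<^sub>2 (a' n)" using obtain_lift .
  obtain b' where b': "\<forall>n. \<alpha> (\<pi>\<^sub>1 (b n)) = \<pi>\<^sub>2 (b' n)" using obtain_lift .
  obtain s where s: "\<forall>\<nu>\<in>S. ghost s \<nu> = ghost a \<nu> * ghost b \<nu>"
    using obtain_ghost_mult[OF S t1] .
  obtain s' where s': "\<forall>\<nu>\<in>S. ghost s' \<nu> = ghost a' \<nu> * ghost b' \<nu>"
    using obtain_ghost_mult[OF S t2] .
  have "ghost_related S (\<alpha> \<circ> \<pi>\<^sub>1) \<pi>\<^sub>2 (\<lambda>\<nu>. ghost a \<nu> * ghost b \<nu>) (\<lambda>\<nu>. ghost a' \<nu> * ghost b' \<nu>)"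
    by (rule ghost_related_mult[OF S rng_hom_comp[OF hom presentation_rng_hom[OF P1]] t1 presentation_rng_hom[OF P2] t2])
      (simp_all add: lift_related_iff a' b')
  then have "ghost_related S (\<alpha> \<circ> \<pi>\<^sub>1) \<pi>\<^sub>2 (ghost s) (ghost s')"
    by (rule ghost_related_cong) (simp_all add: s s')
  then have "E_map S \<pi>\<^sub>1 \<pi>\<^sub>2 \<alpha> (E_cls S \<pi>\<^sub>1 s) = E_cls S \<pi>\<^sub>2 s'"
    by (intro E_map_E_cls) (simp add: lift_related_iff)
  then show ?thesis
    by (simp add: a b E_map_E_cls[OF spec[OF a', THEN ballI]] E_map_E_cls[OF spec[OF b', THEN ballI]]
        E_mult_E_cls[OF S P1 s] E_mult_E_cls[OF S P2 s'])
qed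

lemma E_additive_E_map: "E_additive S \<pi>\<^sub>1 \<pi>\<^sub>2 (E_map S \<pi>\<^sub>1 \<pi>\<^sub>2 \<alpha>)"
  by (simp add: E_additive_def E_map_in_E_set E_map_E_add)

lemma E_rng_hom_E_map: "E_rng_hom S \<pi>\<^sub>1 \<pi>\<^sub>2 (E_map S \<pi>\<^sub>1 \<pi>\<^sub>2 \<alpha>)"
  by (simp add: E_rng_hom_def E_additive_E_map E_map_E_mult)

lemma E_map_teich: "E_map S \<pi>\<^sub>1 \<pi>\<^sub>2 \<alpha> (teich S \<pi>\<^sub>1 r) = teich S \<pi>\<^sub>2 (\<alpha> r)"
proof -
  obtain x where x: "\<pi>\<^sub>1 x = r" using presentation_surj[OF P1] by (metis surjD)
  obtain y where y: "\<pi>\<^sub>2 y = \<alpha> r" using presentation_surj[OF P2] by (metis surjD)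
  note z = rng_hom_zero[OF presentation_rng_hom[OF P1]] rng_hom_zero[OF presentation_rng_hom[OF P2]]
    rng_hom_zero[OF hom]
  have "teich S \<pi>\<^sub>1 r = E_cls S \<pi>\<^sub>1 (\<lambda>\<nu>. if \<nu> = 1 then x else 0)"
    unfolding teich_def by (rule psi_E_cls[OF S P1]) (simp_all add: x z)
  moreover have "teich S \<pi>\<^sub>2 (\<alpha> r) = E_cls S \<pi>\<^sub>2 (\<lambda>\<nu>. if \<nu> = 1 then y else 0)"
    unfolding teich_def by (rule psi_E_cls[OF S P2]) (simp_all add: y z)
  ultimately show ?thesis
    by (simp only:) (rule E_map_E_cls, simp add: x y z)
qed

lemma continuous_map_E_map:
  "continuous_map (E_topology S \<pi>\<^sub>1) (E_topology S \<pi>\<^sub>2) (E_map S \<pi>\<^sub>1 \<pi>\<^sub>2 \<alpha>)"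
  unfolding continuous_map_def topspace_E_topology[OF S P1] topspace_E_topology[OF S P2]
proof (intro conjI allI impI)
  show "E_map S \<pi>\<^sub>1 \<pi>\<^sub>2 \<alpha> \<in> E_set S \<pi>\<^sub>1 \<rightarrow> E_set S \<pi>\<^sub>2"
    by (simp add: E_map_in_E_set)
  fix U assume "openin (E_topology S \<pi>\<^sub>2) U"
  then have U: "\<forall>a. E_cls S \<pi>\<^sub>2 a \<in> U \<longrightarrow>
      (\<exists>N. \<forall>b. (\<forall>n\<in>S. n \<le> N \<longrightarrow> \<pi>\<^sub>2 (a n) = \<pi>\<^sub>2 (b n)) \<longrightarrow> E_cls S \<pi>\<^sub>2 b \<in> U)"
    unfolding openin_E_topology[OF S P2] by (rule conjunct2)
  show "openin (E_topology S \<pi>\<^sub>1) {c \<in> E_set S \<pi>\<^sub>1. E_map S \<pi>\<^sub>1 \<pi>\<^sub>2 \<alpha> c \<in> U}"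
    unfolding openin_E_topology[OF S P1]
  proof (intro conjI allI impI)
    show "{c \<in> E_set S \<pi>\<^sub>1. E_map S \<pi>\<^sub>1 \<pi>\<^sub>2 \<alpha> c \<in> U} \<subseteq> E_set S \<pi>\<^sub>1" by (rule Collect_restrict)
    fix a assume a: "E_cls S \<pi>\<^sub>1 a \<in> {c \<in> E_set S \<pi>\<^sub>1. E_map S \<pi>\<^sub>1 \<pi>\<^sub>2 \<alpha> c \<in> U}"
    obtain a' where a': "\<forall>n. \<alpha> (\<pi>\<^sub>1 (a n)) = \<pi>\<^sub>2 (a' n)" using obtain_lift .
    have "E_cls S \<pi>\<^sub>2 a' \<in> U"
      using a E_map_E_cls[of a a'] a' by simp
    with spec[OF U, of a'] obtain N where
      N: "\<forall>b. (\<forall>n\<in>S. n \<le> N \<longrightarrow> \<pi>\<^sub>2 (a' n) = \<pi>\<^sub>2 (b n)) \<longrightarrow> E_cls S \<pi>\<^sub>2 b \<in> U"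
      by (elim impE exE) (assumption, rule that)
    \<comment> \<open>The map acts on coefficients index by index, so the same \<open>N\<close> works in the source.\<close>
    show "\<exists>N. \<forall>b. (\<forall>n\<in>S. n \<le> N \<longrightarrow> \<pi>\<^sub>1 (a n) = \<pi>\<^sub>1 (b n)) \<longrightarrow>
        E_cls S \<pi>\<^sub>1 b \<in> {c \<in> E_set S \<pi>\<^sub>1. E_map S \<pi>\<^sub>1 \<pi>\<^sub>2 \<alpha> c \<in> U}"
    proof (intro exI[of _ N] allI impI CollectI conjI)
      fix b assume b: "\<forall>n\<in>S. n \<le> N \<longrightarrow> \<pi>\<^sub>1 (a n) = \<pi>\<^sub>1 (b n)"
      show "E_cls S \<pi>\<^sub>1 b \<in> E_set S \<pi>\<^sub>1" by (rule E_cls_in_E_set[OF S P1])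
      obtain b' where b': "\<forall>n. \<alpha> (\<pi>\<^sub>1 (b n)) = \<pi>\<^sub>2 (b' n)" using obtain_lift .
      have "E_cls S \<pi>\<^sub>2 b' \<in> U"
        using N b by (simp flip: a' b'[rule_format])
      then show "E_map S \<pi>\<^sub>1 \<pi>\<^sub>2 \<alpha> (E_cls S \<pi>\<^sub>1 b) \<in> U"
        using E_map_E_cls[of b b'] b' by simp
    qed
  qed
qed

end

context
  fixes S :: "nat set"
    and \<pi>\<^sub>1 :: "'a1::comm_ring \<Rightarrow> 'r1::comm_ring"
    and \<pi>\<^sub>2 :: "'a2::comm_ring \<Rightarrow> 'r2::comm_ring"
    and \<alpha> :: "'r1 \<Rightarrow> 'r2" and n :: nat
  assumes S: "truncation_set S" and P1: "presentation S \<pi>\<^sub>1" and P2: "presentation S \<pi>\<^sub>2"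
    and hom: "rng_hom \<alpha>" and n: "n \<in> S"
begin

lemma E_map_E_Fro:
  assumes "c \<in> E_set S \<pi>\<^sub>1"
  shows "E_Fro S \<pi>\<^sub>2 n (E_map S \<pi>\<^sub>1 \<pi>\<^sub>2 \<alpha> c) = E_map (trunc_quot S n) \<pi>\<^sub>1 \<pi>\<^sub>2 \<alpha> (E_Fro S \<pi>\<^sub>1 n c)"
proof -
  note S' = truncation_set_trunc_quot[OF S n]
  note P1' = presentation_trunc_quot[OF S P1, of n] and P2' = presentation_trunc_quot[OF S P2, of n]
  note t1 = presentation_no_torsion[OF P1] and t2 = presentation_no_torsion[OF P2]
  obtain a where a: "c = E_cls S \<pi>\<^sub>1 a" using E_setE[OF S P1 assms] .
  obtain a' where a': "\<forall>n. \<alpha> (\<pi>\<^sub>1 (a n)) = \<pi>\<^sub>2 (a' n)" using obtain_lift[OF S P1 P2 hom] .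
  obtain s where s: "\<forall>\<nu>\<in>trunc_quot S n. ghost s \<nu> = ghost a (\<nu> * n)"
    using obtain_ghost_Fro[OF S t1 n] .
  obtain s' where s': "\<forall>\<nu>\<in>trunc_quot S n. ghost s' \<nu> = ghost a' (\<nu> * n)"
    using obtain_ghost_Fro[OF S t2 n] .
  have "ghost_related (trunc_quot S n) (\<alpha> \<circ> \<pi>\<^sub>1) \<pi>\<^sub>2 (\<lambda>\<nu>. ghost a (\<nu> * n)) (\<lambda>\<nu>. ghost a' (\<nu> * n))"
    by (rule ghost_related_Fro[OF S rng_hom_comp[OF hom presentation_rng_hom[OF P1]] t1 presentation_rng_hom[OF P2] t2 n])
      (simp add: lift_related_iff[OF S P1 P2 hom] a')
  then have "ghost_related (trunc_quot S n) (\<alpha> \<circ> \<pi>\<^sub>1) \<pi>\<^sub>2 (ghost s) (ghost s')"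
    by (rule ghost_related_cong) (simp_all add: s s')
  then have "E_map (trunc_quot S n) \<pi>\<^sub>1 \<pi>\<^sub>2 \<alpha> (E_cls (trunc_quot S n) \<pi>\<^sub>1 s) = E_cls (trunc_quot S n) \<pi>\<^sub>2 s'"
    by (intro E_map_E_cls[OF S' P1' P2' hom]) (simp add: lift_related_iff[OF S' P1' P2' hom])
  then show ?thesis
    by (simp add: a E_map_E_cls[OF S P1 P2 hom spec[OF a', THEN ballI]]
        E_Fro_E_cls[OF S P1 n s] E_Fro_E_cls[OF S P2 n s'])
qed

lemma E_map_E_Ver:
  assumes "c \<in> E_set (trunc_quot S n) \<pi>\<^sub>1"
  shows "E_Ver S \<pi>\<^sub>2 n (E_map (trunc_quot S n) \<pi>\<^sub>1 \<pi>\<^sub>2 \<alpha> c) = E_map S \<pi>\<^sub>1 \<pi>\<^sub>2 \<alpha> (E_Ver S \<pi>\<^sub>1 n c)"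
proof -
  note S' = truncation_set_trunc_quot[OF S n]
  note P1' = presentation_trunc_quot[OF S P1, of n] and P2' = presentation_trunc_quot[OF S P2, of n]
  note t1 = presentation_no_torsion[OF P1] and t2 = presentation_no_torsion[OF P2]
  obtain a where a: "c = E_cls (trunc_quot S n) \<pi>\<^sub>1 a" using E_setE[OF S' P1' assms] .
  obtain a' where a': "\<forall>n. \<alpha> (\<pi>\<^sub>1 (a n)) = \<pi>\<^sub>2 (a' n)" using obtain_lift[OF S P1 P2 hom] .
  obtain s where s: "\<forall>\<nu>\<in>S. ghost s \<nu> = nat_multiple n (if n dvd \<nu> then ghost a (\<nu> div n) else 0)"
    using obtain_ghost_Ver[OF S t1 n] .
  obtain s' where s': "\<forall>\<nu>\<in>S. ghost s' \<nu> = nat_multiple n (if n dvd \<nu> then ghost a' (\<nu> div n) else 0)"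
    using obtain_ghost_Ver[OF S t2 n] .
  have "ghost_related S (\<alpha> \<circ> \<pi>\<^sub>1) \<pi>\<^sub>2
      (\<lambda>\<nu>. nat_multiple n (if n dvd \<nu> then ghost a (\<nu> div n) else 0))
      (\<lambda>\<nu>. nat_multiple n (if n dvd \<nu> then ghost a' (\<nu> div n) else 0))"
    by (rule ghost_related_Ver[OF S rng_hom_comp[OF hom presentation_rng_hom[OF P1]] t1 presentation_rng_hom[OF P2] t2 n])
      (simp add: lift_related_iff[OF S' P1' P2' hom] a')
  then have "ghost_related S (\<alpha> \<circ> \<pi>\<^sub>1) \<pi>\<^sub>2 (ghost s) (ghost s')"
    by (rule ghost_related_cong) (simp_all add: s s')
  then have "E_map S \<pi>\<^sub>1 \<pi>\<^sub>2 \<alpha> (E_cls S \<pi>\<^sub>1 s) = E_cls S \<pi>\<^sub>2 s'"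
    by (intro E_map_E_cls[OF S P1 P2 hom]) (simp add: lift_related_iff[OF S P1 P2 hom])
  then show ?thesis
    by (simp add: a E_map_E_cls[OF S' P1' P2' hom spec[OF a', THEN ballI]]
        E_Ver_E_cls[OF S P1 n s] E_Ver_E_cls[OF S P2 n s'])
qed

lemma E_map_Ver_teich: "E_map S \<pi>\<^sub>1 \<pi>\<^sub>2 \<alpha> (Ver_teich S \<pi>\<^sub>1 n r) = Ver_teich S \<pi>\<^sub>2 n (\<alpha> r)"
proof -
  note S' = truncation_set_trunc_quot[OF S n]
  note P1' = presentation_trunc_quot[OF S P1, of n] and P2' = presentation_trunc_quot[OF S P2, of n]
  have "teich (trunc_quot S n) \<pi>\<^sub>1 r \<in> E_set (trunc_quot S n) \<pi>\<^sub>1"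
  proof -
    have "teich (trunc_quot S n) \<pi>\<^sub>1 r = E_cls (trunc_quot S n) \<pi>\<^sub>1
        (\<lambda>\<nu>. inv \<pi>\<^sub>1 (if \<nu> = 1 then r else 0))"
      unfolding teich_def
      by (rule psi_E_cls[OF S' P1']) (simp_all add: surj_f_inv_f[OF presentation_surj[OF P1]])
    then show ?thesis by (simp add: E_cls_in_E_set[OF S' P1'])
  qed
  then show ?thesis
    unfolding Ver_teich_def
    by (simp add: E_map_E_Ver[symmetric] E_map_teich[OF S' P1' P2' hom])
qed

end

section \<open>Continuous additive maps\<close>

context
  fixes S :: "nat set"
    and \<pi>\<^sub>1 :: "'a1::comm_ring \<Rightarrow> 'r1::comm_ring"
    and \<pi>\<^sub>2 :: "'a2::comm_ring \<Rightarrow> 'r2::comm_ring"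
  assumes S: "truncation_set S" and P1: "presentation S \<pi>\<^sub>1" and P2: "presentation S \<pi>\<^sub>2"
begin

text \<open>In \<open>E\<^sub>S(R\<^sub>2, \<pi>\<^sub>2)\<close> an element that equals its double is zero.\<close>

lemma E_additive_zero:
  assumes f: "E_additive S \<pi>\<^sub>1 \<pi>\<^sub>2 f"
  shows "f (E_cls S \<pi>\<^sub>1 (\<lambda>_. 0)) = E_cls S \<pi>\<^sub>2 (\<lambda>_. 0)"
proof -
  note hom = presentation_rng_hom[OF P2] and tf = presentation_no_torsion[OF P2]
  let ?z = "E_cls S \<pi>\<^sub>1 (\<lambda>_. 0)"
  have z: "?z \<in> E_set S \<pi>\<^sub>1" by (rule E_cls_in_E_set[OF S P1])
  have "f ?z \<in> E_set S \<pi>\<^sub>2" using f z by (auto simp: E_additive_def)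
  then obtain b where b: "f ?z = E_cls S \<pi>\<^sub>2 b" using E_setE[OF S P2] by blast
  have "E_add S \<pi>\<^sub>1 ?z ?z = ?z"
    by (rule E_add_E_cls[OF S P1]) (simp add: ghost_zero)
  moreover have "f (E_add S \<pi>\<^sub>1 ?z ?z) = E_add S \<pi>\<^sub>2 (f ?z) (f ?z)"
    using f z unfolding E_additive_def by blast
  ultimately have double: "E_add S \<pi>\<^sub>2 (E_cls S \<pi>\<^sub>2 b) (E_cls S \<pi>\<^sub>2 b) = E_cls S \<pi>\<^sub>2 b"
    by (simp add: b)
  obtain s where s: "\<forall>\<nu>\<in>S. ghost s \<nu> = ghost b \<nu> + ghost b \<nu>"
    using obtain_ghost_add[OF S tf] .
  have "\<forall>n\<in>S. \<pi>\<^sub>2 (s n) = \<pi>\<^sub>2 (b n)"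
    using double by (simp add: E_add_E_cls[OF S P2 s] E_cls_eq_iff[OF S P2])
  then have "ghost_related S \<pi>\<^sub>2 \<pi>\<^sub>2 (\<lambda>\<nu>. ghost s \<nu> - ghost b \<nu>) (\<lambda>\<nu>. ghost b \<nu> - ghost b \<nu>)"
    by (intro ghost_related_diff[OF S hom tf hom tf])
      (simp_all add: ghost_related_ghost_iff[OF S hom tf hom tf])
  then have "ghost_related S \<pi>\<^sub>2 \<pi>\<^sub>2 (ghost b) (ghost (\<lambda>_. 0))"
    by (rule ghost_related_cong) (simp_all add: s ghost_zero)
  then have "E_cls S \<pi>\<^sub>2 b = E_cls S \<pi>\<^sub>2 (\<lambda>_. 0)"
    by (simp add: ghost_related_ghost_iff[OF S hom tf hom tf] E_cls_eq_iff[OF S P2])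
  then show ?thesis by (simp add: b)
qed

text \<open>The class of a truncated coefficient sequence is a finite sum of elements \<open>V\<^sub>n\<langle>r\<rangle>\<close>.\<close>

lemma E_additive_eq_on_truncations:
  assumes f: "E_additive S \<pi>\<^sub>1 \<pi>\<^sub>2 f" and g: "E_additive S \<pi>\<^sub>1 \<pi>\<^sub>2 g"
    and eq: "\<forall>n\<in>S. \<forall>r. f (Ver_teich S \<pi>\<^sub>1 n r) = g (Ver_teich S \<pi>\<^sub>1 n r)"
  shows "f (E_cls S \<pi>\<^sub>1 (\<lambda>n. if n \<le> M then a n else 0)) = g (E_cls S \<pi>\<^sub>1 (\<lambda>n. if n \<le> M then a n else 0))"
proof (induction M)
  case 0
  have "E_cls S \<pi>\<^sub>1 (\<lambda>n. if n \<le> 0 then a n else 0) = E_cls S \<pi>\<^sub>1 (\<lambda>_. 0)"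
    using truncation_set_pos[OF S] by (auto simp: E_cls_eq_iff[OF S P1])
  then show ?case by (simp only: E_additive_zero[OF f] E_additive_zero[OF g])
next
  case (Suc M)
  let ?t = "\<lambda>M n. if n \<le> M then a n else 0"
  let ?s = "\<lambda>n. if n = Suc M then a (Suc M) else 0"
  show ?case
  proof (cases "Suc M \<in> S")
    case True
    have "ghost (?t (Suc M)) \<nu> = ghost (?t M) \<nu> + ghost ?s \<nu>" for \<nu>
      unfolding ghost_def sum.distrib[symmetric] by (rule sum.cong) (auto simp: le_Suc_eq)
    then have split: "E_add S \<pi>\<^sub>1 (E_cls S \<pi>\<^sub>1 (?t M)) (E_cls S \<pi>\<^sub>1 ?s) = E_cls S \<pi>\<^sub>1 (?t (Suc M))"
      by (intro E_add_E_cls[OF S P1]) simp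
    have add: "h (E_cls S \<pi>\<^sub>1 (?t (Suc M))) = E_add S \<pi>\<^sub>2 (h (E_cls S \<pi>\<^sub>1 (?t M))) (h (E_cls S \<pi>\<^sub>1 ?s))"
      if "E_additive S \<pi>\<^sub>1 \<pi>\<^sub>2 h" for h
      unfolding split[symmetric] using that E_cls_in_E_set[OF S P1] unfolding E_additive_def by blast
    have "f (E_cls S \<pi>\<^sub>1 ?s) = g (E_cls S \<pi>\<^sub>1 ?s)"
      using eq True by (simp flip: Ver_teich_E_cls[OF S P1 True])
    then show ?thesis unfolding add[OF f] add[OF g] Suc.IH by simp
  next
    case False
    then have "E_cls S \<pi>\<^sub>1 (?t (Suc M)) = E_cls S \<pi>\<^sub>1 (?t M)"
      by (simp add: E_cls_eq_iff[OF S P1] le_Suc_eq)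
    then show ?thesis using Suc.IH by (simp only:)
  qed
qed

text \<open>The classes whose coefficients agree with those of \<open>b\<close> up to the index \<open>n\<close> form an open set.\<close>

lemma E_cls_neighbourhood:
  assumes f: "continuous_map (E_topology S \<pi>\<^sub>1) (E_topology S \<pi>\<^sub>2) f"
    and fa: "f (E_cls S \<pi>\<^sub>1 a) = E_cls S \<pi>\<^sub>2 b"
  obtains N where "\<forall>a'. (\<forall>k\<in>S. k \<le> N \<longrightarrow> \<pi>\<^sub>1 (a k) = \<pi>\<^sub>1 (a' k)) \<longrightarrow>
    (\<exists>b'. f (E_cls S \<pi>\<^sub>1 a') = E_cls S \<pi>\<^sub>2 b' \<and> (\<forall>k\<in>S. k \<le> n \<longrightarrow> \<pi>\<^sub>2 (b k) = \<pi>\<^sub>2 (b' k)))"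
proof -
  define U where "U = {E_cls S \<pi>\<^sub>2 x | x. \<forall>k\<in>S. k \<le> n \<longrightarrow> \<pi>\<^sub>2 (b k) = \<pi>\<^sub>2 (x k)}"
  have U_iff: "E_cls S \<pi>\<^sub>2 x \<in> U \<longleftrightarrow> (\<forall>k\<in>S. k \<le> n \<longrightarrow> \<pi>\<^sub>2 (b k) = \<pi>\<^sub>2 (x k))" for x
    unfolding U_def mem_Collect_eq E_cls_eq_iff[OF S P2] by metis
  have "openin (E_topology S \<pi>\<^sub>2) U"
    unfolding openin_E_topology[OF S P2]
  proof (intro conjI allI impI)
    show "U \<subseteq> E_set S \<pi>\<^sub>2" unfolding U_def E_set_eq[OF S P2] by blast
    fix x assume "E_cls S \<pi>\<^sub>2 x \<in> U"
    then show "\<exists>N. \<forall>y. (\<forall>k\<in>S. k \<le> N \<longrightarrow> \<pi>\<^sub>2 (x k) = \<pi>\<^sub>2 (y k)) \<longrightarrow> E_cls S \<pi>\<^sub>2 y \<in> U"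
      unfolding U_iff by (intro exI[of _ n]) simp
  qed
  then have op: "openin (E_topology S \<pi>\<^sub>1) {c \<in> E_set S \<pi>\<^sub>1. f c \<in> U}"
    using f unfolding continuous_map_def topspace_E_topology[OF S P1] by simp
  have "E_cls S \<pi>\<^sub>1 a \<in> {c \<in> E_set S \<pi>\<^sub>1. f c \<in> U}"
    by (simp add: fa U_iff E_cls_in_E_set[OF S P1])
  then obtain N where N: "\<forall>a'. (\<forall>k\<in>S. k \<le> N \<longrightarrow> \<pi>\<^sub>1 (a k) = \<pi>\<^sub>1 (a' k)) \<longrightarrow>
      E_cls S \<pi>\<^sub>1 a' \<in> {c \<in> E_set S \<pi>\<^sub>1. f c \<in> U}"
    using spec[OF conjunct2[OF op[unfolded openin_E_topology[OF S P1]]], of a]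
    by (elim impE exE) (assumption, rule that)
  show thesis
  proof (rule that[of N], intro allI impI)
    fix a' assume "\<forall>k\<in>S. k \<le> N \<longrightarrow> \<pi>\<^sub>1 (a k) = \<pi>\<^sub>1 (a' k)"
    then have "f (E_cls S \<pi>\<^sub>1 a') \<in> U" using N by simp
    then show "\<exists>b'. f (E_cls S \<pi>\<^sub>1 a') = E_cls S \<pi>\<^sub>2 b' \<and> (\<forall>k\<in>S. k \<le> n \<longrightarrow> \<pi>\<^sub>2 (b k) = \<pi>\<^sub>2 (b' k))"
      unfolding U_def by (elim CollectE)
  qed
qed

text \<open>The coefficient at \<open>n\<close> of \<open>f c\<close> does not change when \<open>c\<close> is replaced by a sufficiently long truncation,
  and likewise for \<open>g\<close>. On truncations \<open>f\<close> and \<open>g\<close> coincide.\<close>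

lemma continuous_additive_unique:
  assumes cf: "continuous_map (E_topology S \<pi>\<^sub>1) (E_topology S \<pi>\<^sub>2) f"
    and cg: "continuous_map (E_topology S \<pi>\<^sub>1) (E_topology S \<pi>\<^sub>2) g"
    and f: "E_additive S \<pi>\<^sub>1 \<pi>\<^sub>2 f" and g: "E_additive S \<pi>\<^sub>1 \<pi>\<^sub>2 g"
    and eq: "\<forall>n\<in>S. \<forall>r. f (Ver_teich S \<pi>\<^sub>1 n r) = g (Ver_teich S \<pi>\<^sub>1 n r)"
    and c: "c \<in> E_set S \<pi>\<^sub>1"
  shows "f c = g c"
proof -
  obtain a where a: "c = E_cls S \<pi>\<^sub>1 a" using E_setE[OF S P1 c] .
  have "f c \<in> E_set S \<pi>\<^sub>2" "g c \<in> E_set S \<pi>\<^sub>2"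
    using f g c by (auto simp: E_additive_def)
  then obtain u v where u: "f (E_cls S \<pi>\<^sub>1 a) = E_cls S \<pi>\<^sub>2 u" and v: "g (E_cls S \<pi>\<^sub>1 a) = E_cls S \<pi>\<^sub>2 v"
    using E_setE[OF S P2] unfolding a by metis
  have "\<pi>\<^sub>2 (u n) = \<pi>\<^sub>2 (v n)" if n: "n \<in> S" for n
  proof -
    obtain N where N: "\<forall>a'. (\<forall>k\<in>S. k \<le> N \<longrightarrow> \<pi>\<^sub>1 (a k) = \<pi>\<^sub>1 (a' k)) \<longrightarrow>
      (\<exists>b'. f (E_cls S \<pi>\<^sub>1 a') = E_cls S \<pi>\<^sub>2 b' \<and> (\<forall>k\<in>S. k \<le> n \<longrightarrow> \<pi>\<^sub>2 (u k) = \<pi>\<^sub>2 (b' k)))"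
      using E_cls_neighbourhood[OF cf u, where n = n] .
    obtain N' where N': "\<forall>a'. (\<forall>k\<in>S. k \<le> N' \<longrightarrow> \<pi>\<^sub>1 (a k) = \<pi>\<^sub>1 (a' k)) \<longrightarrow>
      (\<exists>b'. g (E_cls S \<pi>\<^sub>1 a') = E_cls S \<pi>\<^sub>2 b' \<and> (\<forall>k\<in>S. k \<le> n \<longrightarrow> \<pi>\<^sub>2 (v k) = \<pi>\<^sub>2 (b' k)))"
      using E_cls_neighbourhood[OF cg v, where n = n] .
    define t where "t k = (if k \<le> max N N' then a k else 0)" for k
    have fg: "f (E_cls S \<pi>\<^sub>1 t) = g (E_cls S \<pi>\<^sub>1 t)"
      unfolding t_def by (rule E_additive_eq_on_truncations[OF f g eq])
    obtain p where p: "f (E_cls S \<pi>\<^sub>1 t) = E_cls S \<pi>\<^sub>2 p" "\<pi>\<^sub>2 (u n) = \<pi>\<^sub>2 (p n)"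
      using spec[OF N, of t] n by (auto simp: t_def)
    obtain q where q: "g (E_cls S \<pi>\<^sub>1 t) = E_cls S \<pi>\<^sub>2 q" "\<pi>\<^sub>2 (v n) = \<pi>\<^sub>2 (q n)"
      using spec[OF N', of t] n by (auto simp: t_def)
    have "\<pi>\<^sub>2 (p n) = \<pi>\<^sub>2 (q n)"
      using fg p(1) q(1) n by (simp add: E_cls_eq_iff[OF S P2])
    then show ?thesis using p q by simp
  qed
  then have "E_cls S \<pi>\<^sub>2 u = E_cls S \<pi>\<^sub>2 v" by (simp add: E_cls_eq_iff[OF S P2])
  then show ?thesis by (simp add: a u v)
qed

end

section \<open>Independence of the presentation\<close>

lemma E_map_id_inverse:
  assumes S: "truncation_set S" and P: "presentation S \<pi>" and P': "presentation S \<pi>'"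
    and c: "c \<in> E_set S \<pi>"
  shows "E_map S \<pi>' \<pi> id (E_map S \<pi> \<pi>' id c) = c"
proof -
  obtain a where a: "c = E_cls S \<pi> a" using E_setE[OF S P c] .
  obtain b where b: "\<forall>n. id (\<pi> (a n)) = \<pi>' (b n)" using obtain_lift[OF S P P' rng_hom_id] .
  have "E_map S \<pi> \<pi>' id c = E_cls S \<pi>' b"
    unfolding a by (rule E_map_E_cls[OF S P P' rng_hom_id]) (use b in simp)
  moreover have "E_map S \<pi>' \<pi> id (E_cls S \<pi>' b) = c"
    unfolding a by (rule E_map_E_cls[OF S P' P rng_hom_id]) (use b in simp)
  ultimately show ?thesis by simp
qed

lemma homeomorphic_map_E_map_id:
  assumes S: "truncation_set S" and P: "presentation S \<pi>" and P': "presentation S \<pi>'"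
  shows "homeomorphic_map (E_topology S \<pi>) (E_topology S \<pi>') (E_map S \<pi> \<pi>' id)"
proof -
  have "homeomorphic_maps (E_topology S \<pi>) (E_topology S \<pi>') (E_map S \<pi> \<pi>' id) (E_map S \<pi>' \<pi> id)"
    unfolding homeomorphic_maps_def
    by (simp add: continuous_map_E_map[OF S P P' rng_hom_id] continuous_map_E_map[OF S P' P rng_hom_id]
        topspace_E_topology[OF S P] topspace_E_topology[OF S P']
        E_map_id_inverse[OF S P P'] E_map_id_inverse[OF S P' P])
  then show ?thesis unfolding homeomorphic_map_maps by blast
qed

lemma bij_betw_E_map_id:
  assumes S: "truncation_set S" and P: "presentation S \<pi>" and P': "presentation S \<pi>'"
  shows "bij_betw (E_map S \<pi> \<pi>' id) (E_set S \<pi>) (E_set S \<pi>')"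
proof (rule bij_betw_byWitness[where f' = "E_map S \<pi>' \<pi> id"])
  show "\<forall>c\<in>E_set S \<pi>. E_map S \<pi>' \<pi> id (E_map S \<pi> \<pi>' id c) = c"
    and "\<forall>c\<in>E_set S \<pi>'. E_map S \<pi> \<pi>' id (E_map S \<pi>' \<pi> id c) = c"
    using E_map_id_inverse[OF S P P'] E_map_id_inverse[OF S P' P] by blast+
  show "E_map S \<pi> \<pi>' id ` E_set S \<pi> \<subseteq> E_set S \<pi>'"
    and "E_map S \<pi>' \<pi> id ` E_set S \<pi>' \<subseteq> E_set S \<pi>"
    using E_map_in_E_set[OF S P P' rng_hom_id] E_map_in_E_set[OF S P' P rng_hom_id] by blast+
qed

section \<open>The standard presentation\<close>

lemma int_multiple_diff_nat: "int_multiple (int m - int n) x = nat_multiple m x - nat_multiple n x"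
proof (cases "n \<le> m")
  case True
  then obtain k where "m = n + k" by (auto simp: le_iff_add)
  then show ?thesis by (simp add: int_multiple_def nat_multiple_add_left)
next
  case False
  then obtain k where "n = m + k" "0 < k" by (metis less_imp_add_positive not_le)
  then show ?thesis by (simp add: int_multiple_def nat_multiple_add_left)
qed

lemma int_multiple_diff: "int_multiple (k - l) x = int_multiple k x - int_multiple l x"
proof -
  obtain m n where k: "k = int m - int n" by (rule int_diff_cases)
  obtain p q where l: "l = int p - int q" by (rule int_diff_cases)
  have "k - l = int (m + q) - int (n + p)" by (simp add: k l)
  then show ?thesis
    unfolding k l by (simp only: int_multiple_diff_nat nat_multiple_add_left) simp
qed

lemma int_multiple_zero [simp]: "int_multiple 0 x = 0"
  by (simp add: int_multiple_def)

text \<open>A common finite index set for the supports of several elements makes additivity visible.\<close>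

lemma std_proj_eq_sum:
  assumes "finite K" "Poly_Mapping.keys (sa_frag f) \<subseteq> K"
  shows "std_proj f = (\<Sum>r\<in>K. int_multiple (Poly_Mapping.lookup (sa_frag f) r) r)"
  unfolding std_proj_def
  by (rule sum.mono_neutral_left) (use assms in \<open>auto simp: in_keys_iff\<close>)

lemma std_proj_zero: "std_proj 0 = 0"
  by (simp add: std_proj_def zero_semigroup_algebra.rep_eq)

lemma std_proj_diff: "std_proj (f - g) = std_proj f - std_proj g"
proof -
  let ?K = "Poly_Mapping.keys (sa_frag f) \<union> Poly_Mapping.keys (sa_frag g)"
  have fin: "finite ?K" by simp
  have "Poly_Mapping.keys (sa_frag (f - g)) \<subseteq> ?K"
    by (auto simp: minus_semigroup_algebra.rep_eq in_keys_iff lookup_minus)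
  then have "std_proj (f - g) = (\<Sum>r\<in>?K. int_multiple (Poly_Mapping.lookup (sa_frag (f - g)) r) r)"
    by (rule std_proj_eq_sum[OF fin])
  also have "\<dots> = (\<Sum>r\<in>?K. int_multiple (Poly_Mapping.lookup (sa_frag f) r) r) -
      (\<Sum>r\<in>?K. int_multiple (Poly_Mapping.lookup (sa_frag g) r) r)"
    by (simp add: minus_semigroup_algebra.rep_eq lookup_minus int_multiple_diff sum_subtractf)
  also have "\<dots> = std_proj f - std_proj g"
    by (simp add: std_proj_eq_sum[OF fin, of f] std_proj_eq_sum[OF fin, of g])
  finally show ?thesis .
qed

text \<open>\<open>\<int>R\<close> is generated by the symbols \<open>[r]\<close> as a group, so bilinear identities need only be checked on
  symbols.\<close>

lemma semigroup_algebra_induct [case_names zero of diff]: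
  assumes "P 0" "\<And>r. P (sa_of r)" "\<And>f g. P f \<Longrightarrow> P g \<Longrightarrow> P (f - g)"
  shows "P (f :: 'r::ab_semigroup_mult semigroup_algebra)"
proof -
  have "P (Sa_frag h)" for h :: "'r \<Rightarrow>\<^sub>0 int"
  proof (induction h rule: frag_induct)
    case zero
    then show ?case using assms(1) by (simp add: zero_semigroup_algebra_def)
  next
    case (one r)
    then show ?case using assms(2) by (simp add: sa_of_def)
  next
    case (diff a b)
    then show ?case using assms(3) by (metis Sa_frag_inverse UNIV_I minus_semigroup_algebra.rep_eq sa_frag_inverse)
  qed
  then show ?thesis by (metis sa_frag_inverse)
qed

lemma std_proj_mult: "std_proj (f * g) = std_proj f * std_proj g"
proof (induction f rule: semigroup_algebra_induct)
  case zero
  then show ?case by (simp add: std_proj_zero)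
next
  case (of r)
  show ?case
  proof (induction g rule: semigroup_algebra_induct)
    case zero
    then show ?case by (simp add: std_proj_zero)
  next
    case (of s)
    then show ?case by (simp add: sa_of_mult std_proj_sa_of)
  next
    case (diff f g)
    then show ?case by (simp add: right_diff_distrib std_proj_diff)
  qed
next
  case (diff f h)
  then show ?case by (simp add: left_diff_distrib std_proj_diff)
qed

lemma rng_hom_std_proj: "rng_hom std_proj"
proof -
  have "std_proj (x + y) = std_proj x + std_proj y" for x y :: "'a semigroup_algebra"
    using std_proj_diff[of "x + y" y] by simp
  then show ?thesis by (simp add: rng_hom_def std_proj_mult)
qed

lemma lookup_nat_multiple:
  "Poly_Mapping.lookup (sa_frag (nat_multiple n f)) r = int n * Poly_Mapping.lookup (sa_frag f) r"
  by (induction n)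
    (simp_all add: zero_semigroup_algebra.rep_eq plus_semigroup_algebra.rep_eq lookup_add algebra_simps)

lemma no_torsion_semigroup_algebra:
  assumes "truncation_set S"
  shows "no_torsion S TYPE('r::comm_ring semigroup_algebra)"
  unfolding no_torsion_def
proof (intro ballI allI impI)
  fix n and x :: "'r semigroup_algebra" assume n: "n \<in> S" "nat_multiple n x = 0"
  have "int n * Poly_Mapping.lookup (sa_frag x) r = 0" for r
    using n(2) by (simp flip: lookup_nat_multiple add: zero_semigroup_algebra.rep_eq)
  then have "Poly_Mapping.lookup (sa_frag x) r = 0" for r
    using truncation_set_pos[OF assms n(1)] by simp
  then have "sa_frag x = 0" by (intro poly_mapping_eqI) simp
  then show "x = 0" by (metis sa_frag_inverse zero_semigroup_algebra_def)
qed

lemma presentation_std_proj: "truncation_set S \<Longrightarrow> presentation S std_proj"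
  unfolding presentation_def
  by (intro conjI rng_hom_std_proj surjI[of _ sa_of] std_proj_sa_of no_torsion_semigroup_algebra)

lemma E_map_E_Fro_E_Ver:
  assumes "truncation_set S" "presentation S \<pi>\<^sub>1" "presentation S \<pi>\<^sub>2" "rng_hom \<alpha>"
  shows "\<forall>n\<in>S.
    (\<forall>c\<in>E_set S \<pi>\<^sub>1.
       E_Fro S \<pi>\<^sub>2 n (E_map S \<pi>\<^sub>1 \<pi>\<^sub>2 \<alpha> c) =
       E_map (trunc_quot S n) \<pi>\<^sub>1 \<pi>\<^sub>2 \<alpha> (E_Fro S \<pi>\<^sub>1 n c)) \<and>
    (\<forall>c\<in>E_set (trunc_quot S n) \<pi>\<^sub>1.
       E_Ver S \<pi>\<^sub>2 n (E_map (trunc_quot S n) \<pi>\<^sub>1 \<pi>\<^sub>2 \<alpha> c) =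
       E_map S \<pi>\<^sub>1 \<pi>\<^sub>2 \<alpha> (E_Ver S \<pi>\<^sub>1 n c))"
  by (intro ballI conjI E_map_E_Fro[OF assms] E_map_E_Ver[OF assms])

theorem corollary2p5:
  fixes S :: "nat set"
    and \<pi>\<^sub>1 :: "'a1::comm_ring \<Rightarrow> 'r1::comm_ring"
    and \<pi>\<^sub>2 :: "'a2::comm_ring \<Rightarrow> 'r2::comm_ring"
    and \<alpha> :: "'r1 \<Rightarrow> 'r2"
  assumes "truncation_set S"
    and "presentation S \<pi>\<^sub>1"
    and "presentation S \<pi>\<^sub>2"
    and "rng_hom \<alpha>"
  shows
    "\<comment> \<open>a)\<close>
    (continuous_map (E_topology S \<pi>\<^sub>1) (E_topology S \<pi>\<^sub>2) (E_map S \<pi>\<^sub>1 \<pi>\<^sub>2 \<alpha>) \<and>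
      E_rng_hom S \<pi>\<^sub>1 \<pi>\<^sub>2 (E_map S \<pi>\<^sub>1 \<pi>\<^sub>2 \<alpha>) \<and>
      (\<forall>r. E_map S \<pi>\<^sub>1 \<pi>\<^sub>2 \<alpha> (teich S \<pi>\<^sub>1 r) = teich S \<pi>\<^sub>2 (\<alpha> r)) \<and>
      (\<forall>n\<in>S.
        (\<forall>c\<in>E_set S \<pi>\<^sub>1.
           E_Fro S \<pi>\<^sub>2 n (E_map S \<pi>\<^sub>1 \<pi>\<^sub>2 \<alpha> c) =
           E_map (trunc_quot S n) \<pi>\<^sub>1 \<pi>\<^sub>2 \<alpha> (E_Fro S \<pi>\<^sub>1 n c)) \<and>
        (\<forall>c\<in>E_set (trunc_quot S n) \<pi>\<^sub>1.
           E_Ver S \<pi>\<^sub>2 n (E_map (trunc_quot S n) \<pi>\<^sub>1 \<pi>\<^sub>2 \<alpha> c) =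
           E_map S \<pi>\<^sub>1 \<pi>\<^sub>2 \<alpha> (E_Ver S \<pi>\<^sub>1 n c)))) \<and>
    \<comment> \<open>b)\<close>
    (let sends_Ver_teich = (\<lambda>f.
        continuous_map (E_topology S \<pi>\<^sub>1) (E_topology S \<pi>\<^sub>2) f \<and>
        E_additive S \<pi>\<^sub>1 \<pi>\<^sub>2 f \<and>
        (\<forall>n\<in>S. \<forall>r. f (Ver_teich S \<pi>\<^sub>1 n r) = Ver_teich S \<pi>\<^sub>2 n (\<alpha> r)))
      in sends_Ver_teich (E_map S \<pi>\<^sub>1 \<pi>\<^sub>2 \<alpha>) \<and>
         (\<forall>f. sends_Ver_teich f \<longrightarrow> (\<forall>c\<in>E_set S \<pi>\<^sub>1. f c = E_map S \<pi>\<^sub>1 \<pi>\<^sub>2 \<alpha> c))) \<and>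
    \<comment> \<open>c)\<close>
    (\<forall>\<pi> :: 'a::comm_ring \<Rightarrow> 'r::comm_ring. presentation S \<pi> \<longrightarrow>
      E_rng_hom S \<pi> std_proj (E_map S \<pi> std_proj id) \<and>
      bij_betw (E_map S \<pi> std_proj id) (E_set S \<pi>) (E_set S std_proj) \<and>
      homeomorphic_map (E_topology S \<pi>) (E_topology S std_proj) (E_map S \<pi> std_proj id) \<and>
      (\<forall>r. E_map S \<pi> std_proj id (teich S \<pi> r) = teich S std_proj r) \<and>
      (\<forall>n\<in>S.
        (\<forall>c\<in>E_set S \<pi>.
           E_Fro S std_proj n (E_map S \<pi> std_proj id c) =
           E_map (trunc_quot S n) \<pi> std_proj id (E_Fro S \<pi> n c)) \<and>
        (\<forall>c\<in>E_set (trunc_quot S n) \<pi>.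
           E_Ver S std_proj n (E_map (trunc_quot S n) \<pi> std_proj id c) =
           E_map S \<pi> std_proj id (E_Ver S \<pi> n c))))"
  (is "?a \<and> ?b \<and> ?c")
proof (rule conjI[OF _ conjI])
  note S = assms(1) and P1 = assms(2) and P2 = assms(3) and hom = assms(4)
  show ?a
    by (intro conjI allI continuous_map_E_map[OF assms] E_rng_hom_E_map[OF assms]
        E_map_teich[OF assms] E_map_E_Fro_E_Ver[OF assms])
  have unique: "f c = E_map S \<pi>\<^sub>1 \<pi>\<^sub>2 \<alpha> c"
    if f: "continuous_map (E_topology S \<pi>\<^sub>1) (E_topology S \<pi>\<^sub>2) f \<and> E_additive S \<pi>\<^sub>1 \<pi>\<^sub>2 f \<and>
        (\<forall>n\<in>S. \<forall>r. f (Ver_teich S \<pi>\<^sub>1 n r) = Ver_teich S \<pi>\<^sub>2 n (\<alpha> r))"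
      and c: "c \<in> E_set S \<pi>\<^sub>1" for f c
  proof (rule continuous_additive_unique[OF S P1 P2 conjunct1[OF f] continuous_map_E_map[OF assms]
        conjunct1[OF conjunct2[OF f]] E_additive_E_map[OF assms] _ c])
    show "\<forall>n\<in>S. \<forall>r. f (Ver_teich S \<pi>\<^sub>1 n r) = E_map S \<pi>\<^sub>1 \<pi>\<^sub>2 \<alpha> (Ver_teich S \<pi>\<^sub>1 n r)"
      using conjunct2[OF conjunct2[OF f]] by (simp add: E_map_Ver_teich[OF assms])
  qed
  have "continuous_map (E_topology S \<pi>\<^sub>1) (E_topology S \<pi>\<^sub>2) (E_map S \<pi>\<^sub>1 \<pi>\<^sub>2 \<alpha>) \<and>
      E_additive S \<pi>\<^sub>1 \<pi>\<^sub>2 (E_map S \<pi>\<^sub>1 \<pi>\<^sub>2 \<alpha>) \<and>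
      (\<forall>n\<in>S. \<forall>r. E_map S \<pi>\<^sub>1 \<pi>\<^sub>2 \<alpha> (Ver_teich S \<pi>\<^sub>1 n r) = Ver_teich S \<pi>\<^sub>2 n (\<alpha> r))"
    by (intro conjI ballI allI continuous_map_E_map[OF assms] E_additive_E_map[OF assms]
        E_map_Ver_teich[OF assms])
  then show ?b
    unfolding Let_def by (rule conjI) (intro allI impI ballI, rule unique)
  show ?c
  proof (intro allI impI)
    fix \<pi> :: "'a \<Rightarrow> 'r" assume P: "presentation S \<pi>"
    note iso = S P presentation_std_proj[OF S]
    have "E_map S \<pi> std_proj id (teich S \<pi> r) = teich S std_proj r" for r
      using E_map_teich[OF iso rng_hom_id, of r] by simp
    then show "E_rng_hom S \<pi> std_proj (E_map S \<pi> std_proj id) \<and>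
      bij_betw (E_map S \<pi> std_proj id) (E_set S \<pi>) (E_set S std_proj) \<and>
      homeomorphic_map (E_topology S \<pi>) (E_topology S std_proj) (E_map S \<pi> std_proj id) \<and>
      (\<forall>r. E_map S \<pi> std_proj id (teich S \<pi> r) = teich S std_proj r) \<and>
      (\<forall>n\<in>S.
        (\<forall>c\<in>E_set S \<pi>.
           E_Fro S std_proj n (E_map S \<pi> std_proj id c) =
           E_map (trunc_quot S n) \<pi> std_proj id (E_Fro S \<pi> n c)) \<and>
        (\<forall>c\<in>E_set (trunc_quot S n) \<pi>.
           E_Ver S std_proj n (E_map (trunc_quot S n) \<pi> std_proj id c) =
           E_map S \<pi> std_proj id (E_Ver S \<pi> n c)))"
      by (intro conjI allI E_rng_hom_E_map[OF iso rng_hom_id] bij_betw_E_map_id[OF iso]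
          homeomorphic_map_E_map_id[OF iso] E_map_E_Fro_E_Ver[OF iso rng_hom_id])
  qed
qed

end
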